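(* Consider a purely kinetic Chaplygin system with symmetry group $G$ and bundle $\pi:Q\to Q/G$, and suppose that $(\overline g_{ai},F=f\circ\pi)$, with $f\in C^\infty(Q/G)$ and $\overline g$ $G$-invariant, is a projective geodesic extension. (i) If $\gamma$ satisfies $\iota_{\Gamma^{red}}\gamma=\alpha$ (equivalently, if $B=\gamma-\Xi^G$ is a dynamical gauge transformation), then the projective geodesic extension leads to a Hamiltonian reparametrization: the reduced trajectories (the base integral curves of $\Gamma^{red}$) are a complete set of pregeodesics of a Riemannian metric on $Q/G$. (ii) If the projective geodesic extension is $(V\pi,\mathcal D)$-orthogonal (of the form $(\overline g_{ai}=-G_{ai},F=f\circ\pi)$), we always have such a Hamiltonian reparametrization.
   Context: Setting: $Q$ is an $n$-dimensional manifold with Riemannian metric $g$, $\mathcal D\subset TQ$ is a distribution of rank $m$, $L(v)=\frac12g(v,v)$. The system $(L,\mathcal D)$ is a (purely kinetic) Chaplygin system: a Lie group $G$ acts freely and properly on $Q$, $\pi:Q\to Q/G$ is the principal bundle, $g$ and $\mathcal D$ are $G$-invariant, and $\mathcal D$ is the horizontal distribution of a principal connection on $\pi$ (so $TQ=\mathcal D\oplus V\pi$, with $V\pi=\ker T\pi$, and $\dim Q/G=m$). Indices $a,b,c,d,e=1,\dots,m$; $i,j,k=1,\dots,n-m$. Summation convention is used. Frames: $V_i$ are the infinitesimal generators of a basis of the Lie algebra of $G$; $X_a$ are the horizontal lifts of the coordinate fields $\partial/\partial q^a$ on $Q/G$. Set $G_{ab}=g(X_a,X_b)$ (inverse $G^{ab}$),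 $G_{ai}=g(X_a,V_i)$, $K^b_i=-G^{ab}G_{ai}$, $X_i=V_i+K^b_iX_b$ (so $\{X_i\}$ spans the $g$-orthogonal complement of $\mathcal D$). Write $[X_\alpha,X_\beta]=R^\gamma_{\alpha\beta}X_\gamma$ in the frame $\{X_a,X_i\}$, $g_{ab}=G_{ab}$, $\overline g_{ai}=\overline g(X_a,X_i)$. For $G$-invariant $\overline g$, the functions $g_{ab}$, $R^c_{ab}$, $G_{ak}R^k_{bc}$ and $\overline g_{ak}R^k_{bc}$ are $G$-invariant and are regarded as functions on $Q/G$; one has $g_{ad}R^d_{bc}=G_{ak}R^k_{bc}$. Projective geodesic extension: for a symmetric $(0,2)$-tensor field $\overline g$ with $\overline g|_{\mathcal D\times\mathcal D}=g|_{\mathcal D\times\mathcal D}$ and $F\in C^\infty(Q)$, the couple $(\overline g_{ai},F)$ is a projective geodesic extension if, with $\theta_i=\overline g_{ai}v^a$, for all $v^a$, $(A')$: $g_{bd}(\delta_a^dX_c(F)-\delta_c^dX_a(F))v^av^b+\theta_kR^k_{ac}v^a=0$ for all $c$, and $(B')$: $\Gamma^{nh}(\theta_i)+\lambda_i+\theta_k(R^k_{ia}+\delta^k_iX_a(F))v^a-g_{ab}X_i(F)v^av^b=0$ for all $i$. Here $\nabla_{X_a}X_b=\Gamma^c_{ab}X_c+\Gamma^i_{ab}X_i$ for the Levi-Civita connection of $g$, $\lambda_i=g(X_k,X_i)\Gamma^k_{ab}v^av^b$ and $\Gamma^{nh}(\theta_bv^b)=(X_a(\theta_b)-\theta_d\Gamma^d_{ab})v^av^b$.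 It is $(V\pi,\mathcal D)$-orthogonal when $\overline g|_{V\pi\times\mathcal D}=0$, equivalently $\overline g_{ai}=-G_{ai}$. On $T(Q/G)$, with coordinates $(q^a,\dot q^a)$: $l=\frac12g_{ab}\dot q^a\dot q^b$, $\theta_l=g_{ab}\dot q^a dq^b$, $\omega_l=-d\theta_l$, $E_l=l$, $\alpha=-G_{ak}R^k_{bc}\dot q^a\dot q^b dq^c$, $\Xi^G=-\frac12 G_{ak}R^k_{bc}\dot q^a dq^b\wedge dq^c$, $\gamma=\frac16\left(\overline g_{bk}R^k_{ac}-\overline g_{ck}R^k_{ab}+2\overline g_{ak}R^k_{bc}\right)\dot q^a\,dq^b\wedge dq^c$. The reduced vector field $\Gamma^{red}$ is the second-order vector field with $\iota_{\Gamma^{red}}\omega_l=dE_l+\alpha$, i.e. $\Gamma^{red}=\dot q^e\frac{\partial}{\partial q^e}+(-\Gamma^{e,red}_{ab}+g^{ce}g_{db}R^d_{ac})\dot q^a\dot q^b\frac{\partial}{\partial\dot q^e}$, with $\Gamma^{e,red}_{ab}$ the Christoffel symbols of $(g_{ab})$. A dynamical gauge transformation is a semi-basic 2-form $B$ on $T(Q/G)$ with $\iota_{\Gamma^{red}}B=0$. The base integral curves of $\Gamma^{red}$ are a complete set of pregeodesics of a Riemannian metric on $Q/G$ if they coincide, up to orientation-preserving reparametrization, with the geodesics of this metric; equivalently the geodesic spray of the metric equals $\Gamma^{red}+\tilde P\Delta$ for some fibrewise linear function $\tilde P$, with $\Delta=\dot q^a\partial/\partial\dot q^a$. *)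

theory Defs
  imports "HOL-Analysis.Analysis" "HOL-Algebra.Group_Action"
begin

section \<open>Smooth manifolds\<close>

primrec Ck_on :: "nat \<Rightarrow> 'a::real_normed_vector set \<Rightarrow> ('a \<Rightarrow> 'b::real_normed_vector) \<Rightarrow> bool" where
  "Ck_on 0 S f \<longleftrightarrow> continuous_on S f"
| "Ck_on (Suc k) S f \<longleftrightarrow> (\<forall>x\<in>S. f differentiable (at x)) \<and>
     (\<forall>v. Ck_on k S (\<lambda>x. frechet_derivative f (at x) v))"

text \<open>Only used for open sets \<open>S\<close>, where it is the usual notion of a \<open>C\<close>-infinity map.\<close>

definition smooth_on :: "'a::real_normed_vector set \<Rightarrow> ('a \<Rightarrow> 'b::real_normed_vector) \<Rightarrow> bool" where
  "smooth_on S f \<longleftrightarrow> (\<forall>k. Ck_on k S f)"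

type_synonym ('p, 'e) chart = "'p set \<times> ('p \<Rightarrow> 'e)"

definition chart_inv :: "('p, 'e) chart \<Rightarrow> 'e \<Rightarrow> 'p" where
  "chart_inv c = inv_into (fst c) (snd c)"

text \<open>The manifold is the whole type \<open>'p\<close>; Hausdorff and second countable are sort constraints.\<close>

definition smooth_atlas ::
  "('p::{t2_space,second_countable_topology}, 'e::euclidean_space) chart set \<Rightarrow> bool" where
  "smooth_atlas A \<longleftrightarrow>
     (\<Union>c\<in>A. fst c) = UNIV \<and>
     (\<forall>c\<in>A. open (fst c) \<and> open (snd c ` fst c) \<and>
        homeomorphism (fst c) (snd c ` fst c) (snd c) (chart_inv c)) \<and>
     (\<forall>c\<in>A. \<forall>d\<in>A. smooth_on (snd c ` (fst c \<inter> fst d)) (snd d \<circ> chart_inv c))"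

definition smooth_fun ::
  "('p::topological_space, 'e::euclidean_space) chart set \<Rightarrow> 'p set \<Rightarrow> ('p \<Rightarrow> real) \<Rightarrow> bool" where
  "smooth_fun A W F \<longleftrightarrow>
     open W \<and> (\<forall>c\<in>A. smooth_on (snd c ` (fst c \<inter> W)) (F \<circ> chart_inv c))"

definition smooth_at ::
  "('p::topological_space, 'e::euclidean_space) chart set \<Rightarrow> 'p \<Rightarrow> ('p \<Rightarrow> real) \<Rightarrow> bool" where
  "smooth_at A q F \<longleftrightarrow> (\<exists>W. q \<in> W \<and> smooth_fun A W F)"

definition smooth_map ::
  "('p::topological_space, 'e::euclidean_space) chart set \<Rightarrow>
   ('r::topological_space, 'f::euclidean_space) chart set \<Rightarrow> 'p set \<Rightarrow> ('p \<Rightarrow> 'r) \<Rightarrow> bool" where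
  "smooth_map A B W f \<longleftrightarrow>
     open W \<and> continuous_on W f \<and>
     (\<forall>c\<in>A. \<forall>d\<in>B. smooth_on (snd c ` (fst c \<inter> W \<inter> f -` fst d)) (snd d \<circ> f \<circ> chart_inv c))"

definition prod_atlas ::
  "('p, 'e) chart set \<Rightarrow> ('r, 'f) chart set \<Rightarrow> ('p \<times> 'r, 'e \<times> 'f) chart set" where
  "prod_atlas A B = {(fst c \<times> fst d, map_prod (snd c) (snd d)) |c d. c \<in> A \<and> d \<in> B}"


section \<open>Tangent vectors and vector fields\<close>

text \<open>Real functionals on real functions, wrapped in a type so as to be a real vector space.\<close>

typedef 'p tvec = "UNIV :: (('p \<Rightarrow> real) \<Rightarrow> real) set"
  morphisms app Tvec by simp

lemma app_Tvec [simp]: "app (Tvec f) = f"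
  by (simp add: Tvec_inverse)

lemma tvec_eqI: "(\<And>F. app v F = app w F) \<Longrightarrow> v = w"
  using app_inject[of v w] by auto

instantiation tvec :: (type) real_vector
begin

definition "0 = Tvec (\<lambda>F. 0)"
definition "v + w = Tvec (\<lambda>F. app v F + app w F)"
definition "- v = Tvec (\<lambda>F. - app v F)"
definition "v - w = Tvec (\<lambda>F. app v F - app w F)"
definition "r *\<^sub>R v = Tvec (\<lambda>F. r * app v F)"

instance
  by standard (auto intro!: tvec_eqI simp: zero_tvec_def plus_tvec_def uminus_tvec_def
      minus_tvec_def scaleR_tvec_def algebra_simps)

end

text \<open>
  A tangent vector is the directional derivative operator on functions smooth near the base
  point. It is extended by \<open>0\<close> to all other functions, so that the operator does
  not depend on the chart used to represent it.
\<close>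

definition coord_vec ::
  "('p::topological_space, 'e::euclidean_space) chart set \<Rightarrow> ('p, 'e) chart \<Rightarrow> 'p \<Rightarrow> 'e \<Rightarrow> 'p tvec" where
  "coord_vec A c q u = Tvec (\<lambda>F. if smooth_at A q F
     then frechet_derivative (F \<circ> chart_inv c) (at (snd c q)) u else 0)"

definition tangent_space ::
  "('p::topological_space, 'e::euclidean_space) chart set \<Rightarrow> 'p \<Rightarrow> 'p tvec set" where
  "tangent_space A q = {coord_vec A c q u |c u. c \<in> A \<and> q \<in> fst c}"

definition push ::
  "('p::topological_space, 'e::euclidean_space) chart set \<Rightarrow>
   ('r::topological_space, 'f::euclidean_space) chart set \<Rightarrow> ('p \<Rightarrow> 'r) \<Rightarrow> 'p \<Rightarrow> 'p tvec \<Rightarrow> 'r tvec" where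
  "push A B f q v = Tvec (\<lambda>F. if smooth_at B (f q) F then app v (F \<circ> f) else 0)"

definition vector_field ::
  "('p::topological_space, 'e::euclidean_space) chart set \<Rightarrow> 'p set \<Rightarrow> ('p \<Rightarrow> 'p tvec) \<Rightarrow> bool" where
  "vector_field A W X \<longleftrightarrow>
     open W \<and> (\<forall>q\<in>W. X q \<in> tangent_space A q) \<and>
     (\<forall>V F. V \<subseteq> W \<longrightarrow> smooth_fun A V F \<longrightarrow> smooth_fun A V (\<lambda>q. app (X q) F))"

definition lie_bracket ::
  "('p::topological_space, 'e::euclidean_space) chart set \<Rightarrow>
   ('p \<Rightarrow> 'p tvec) \<Rightarrow> ('p \<Rightarrow> 'p tvec) \<Rightarrow> 'p \<Rightarrow> 'p tvec" where
  "lie_bracket A X Y q = Tvec (\<lambda>F. if smooth_at A q F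
     then app (X q) (\<lambda>p. app (Y p) F) - app (Y q) (\<lambda>p. app (X p) F) else 0)"

definition distribution ::
  "('p::topological_space, 'e::euclidean_space) chart set \<Rightarrow> nat \<Rightarrow> ('p \<Rightarrow> 'p tvec set) \<Rightarrow> bool" where
  "distribution A m D \<longleftrightarrow>
     (\<forall>q. D q \<subseteq> tangent_space A q \<and> subspace (D q) \<and> dim (D q) = m) \<and>
     (\<forall>q. \<exists>W E. q \<in> W \<and> (\<forall>a<m. vector_field A W (E a)) \<and>
        (\<forall>p\<in>W. D p = span ((\<lambda>a. E a p) ` {..<m})))"


section \<open>Riemannian metrics, geodesics and pregeodesics\<close>

definition sym_tensor_field ::
  "('p::topological_space, 'e::euclidean_space) chart set \<Rightarrow> ('p \<Rightarrow> 'p tvec \<Rightarrow> 'p tvec \<Rightarrow> real) \<Rightarrow> bool" where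
  "sym_tensor_field A T \<longleftrightarrow>
     (\<forall>q. \<forall>u\<in>tangent_space A q. \<forall>v\<in>tangent_space A q. T q u v = T q v u \<and>
        (\<forall>r. T q (r *\<^sub>R u) v = r * T q u v) \<and>
        (\<forall>w\<in>tangent_space A q. T q (u + w) v = T q u v + T q w v)) \<and>
     (\<forall>W X Y. vector_field A W X \<longrightarrow> vector_field A W Y \<longrightarrow>
        smooth_fun A W (\<lambda>q. T q (X q) (Y q)))"

definition riemannian_metric ::
  "('p::topological_space, 'e::euclidean_space) chart set \<Rightarrow> ('p \<Rightarrow> 'p tvec \<Rightarrow> 'p tvec \<Rightarrow> real) \<Rightarrow> bool" where
  "riemannian_metric A g \<longleftrightarrow>
     sym_tensor_field A g \<and> (\<forall>q. \<forall>v\<in>tangent_space A q. v \<noteq> 0 \<longrightarrow> g q v v > 0)"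

text \<open>
  The connection acts on vector fields over arbitrary open sets \<open>W\<close>; its values at points of
  \<open>W\<close> are determined by the torsion-free and metric conditions on \<open>W\<close>.
\<close>

definition levi_civita ::
  "('p::topological_space, 'e::euclidean_space) chart set \<Rightarrow> ('p \<Rightarrow> 'p tvec \<Rightarrow> 'p tvec \<Rightarrow> real) \<Rightarrow>
   (('p \<Rightarrow> 'p tvec) \<Rightarrow> ('p \<Rightarrow> 'p tvec) \<Rightarrow> 'p \<Rightarrow> 'p tvec) \<Rightarrow> bool" where
  "levi_civita A g nabla \<longleftrightarrow>
     (\<forall>W X Y. vector_field A W X \<longrightarrow> vector_field A W Y \<longrightarrow>
        vector_field A W (nabla X Y) \<and>
        (\<forall>q\<in>W. nabla X Y q - nabla Y X q = lie_bracket A X Y q) \<and>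
        (\<forall>Z. vector_field A W Z \<longrightarrow> (\<forall>q\<in>W.
           nabla (\<lambda>p. X p + Y p) Z q = nabla X Z q + nabla Y Z q \<and>
           nabla Z (\<lambda>p. X p + Y p) q = nabla Z X q + nabla Z Y q \<and>
           app (X q) (\<lambda>p. g p (Y p) (Z p)) =
             g q (nabla X Y q) (Z q) + g q (Y q) (nabla X Z q))) \<and>
        (\<forall>u. smooth_fun A W u \<longrightarrow> (\<forall>q\<in>W.
           nabla (\<lambda>p. u p *\<^sub>R X p) Y q = u q *\<^sub>R nabla X Y q \<and>
           nabla X (\<lambda>p. u p *\<^sub>R Y p) q = app (X q) u *\<^sub>R Y q + u q *\<^sub>R nabla X Y q)))"

definition metric_coeffs ::
  "('p::topological_space, real^'m) chart set \<Rightarrow> ('p \<Rightarrow> 'p tvec \<Rightarrow> 'p tvec \<Rightarrow> real) \<Rightarrow>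
   ('p, real^'m) chart \<Rightarrow> real^'m \<Rightarrow> real^'m^'m" where
  "metric_coeffs A h c x = (let p = chart_inv c x in
     \<chi> a b. h p (coord_vec A c p (axis a 1)) (coord_vec A c p (axis b 1)))"

definition christoffel ::
  "(real^'m \<Rightarrow> real^'m^'m) \<Rightarrow> real^'m \<Rightarrow> 'm \<Rightarrow> 'm \<Rightarrow> 'm \<Rightarrow> real" where
  "christoffel H x e a b =
     (let pd = (\<lambda>a b d. frechet_derivative (\<lambda>y. H y $ b $ d) (at x) (axis a 1)) in
      (\<Sum>d\<in>UNIV. matrix_inv (H x) $ e $ d * (pd a d b + pd b d a - pd d a b)) / 2)"

text \<open>
  On a chart with domain \<open>U\<close> the tangent bundle is \<open>x(U) \<times> real^'m\<close>, with coordinates \<open>z = (q, v)\<close>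
  for the pair of base point and velocity. Vector fields and forms on it are given by their
  expressions in these induced charts, tangent vectors \<open>w\<close> at \<open>z\<close> again being pairs.
\<close>

definition tchart_dom :: "('p, real^'m) chart \<Rightarrow> ((real^'m) \<times> (real^'m)) set" where
  "tchart_dom c = (snd c ` fst c) \<times> UNIV"

type_synonym ('p, 'm) tfield =
  "('p, real^'m) chart \<Rightarrow> (real^'m) \<times> (real^'m) \<Rightarrow> (real^'m) \<times> (real^'m)"
type_synonym 'm form1 = "(real^'m) \<times> (real^'m) \<Rightarrow> (real^'m) \<times> (real^'m) \<Rightarrow> real"
type_synonym 'm form2 =
  "(real^'m) \<times> (real^'m) \<Rightarrow> (real^'m) \<times> (real^'m) \<Rightarrow> (real^'m) \<times> (real^'m) \<Rightarrow> real"

definition geodesic_spray ::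
  "('p::topological_space, real^'m) chart set \<Rightarrow> ('p \<Rightarrow> 'p tvec \<Rightarrow> 'p tvec \<Rightarrow> real) \<Rightarrow> ('p, 'm) tfield" where
  "geodesic_spray A h c z = (snd z, \<chi> e. - (\<Sum>a\<in>UNIV. \<Sum>b\<in>UNIV.
     christoffel (metric_coeffs A h c) (fst z) e a b * snd z $ a * snd z $ b))"

definition open_interval :: "real set \<Rightarrow> bool" where
  "open_interval J \<longleftrightarrow> open J \<and> is_interval J \<and> J \<noteq> {}"

text \<open>Base integral curves of a second-order field: the velocity lift is an integral curve.\<close>

definition base_integral_curve ::
  "('p::topological_space, real^'m) chart set \<Rightarrow> ('p, 'm) tfield \<Rightarrow> real set \<Rightarrow> (real \<Rightarrow> 'p) \<Rightarrow> bool" where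
  "base_integral_curve A Z J \<sigma> \<longleftrightarrow>
     open_interval J \<and> continuous_on J \<sigma> \<and>
     (\<forall>c\<in>A. let x = snd c \<circ> \<sigma>; I = J \<inter> \<sigma> -` fst c in
        smooth_on I x \<and>
        (\<forall>t\<in>I. ((\<lambda>s. (x s, vector_derivative x (at s))) has_vector_derivative
           Z c (x t, vector_derivative x (at t))) (at t)))"

definition orientation_preserving_reparam :: "real set \<Rightarrow> real set \<Rightarrow> (real \<Rightarrow> real) \<Rightarrow> bool" where
  "orientation_preserving_reparam I J \<tau> \<longleftrightarrow>
     open_interval I \<and> smooth_on I \<tau> \<and> (\<forall>s\<in>I. deriv \<tau> s > 0) \<and> \<tau> ` I = J"

definition complete_set_of_pregeodesics ::
  "('p::topological_space, real^'m) chart set \<Rightarrow> ('p, 'm) tfield \<Rightarrow>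
   ('p \<Rightarrow> 'p tvec \<Rightarrow> 'p tvec \<Rightarrow> real) \<Rightarrow> bool" where
  "complete_set_of_pregeodesics A Z h \<longleftrightarrow>
     (\<forall>J \<sigma>. base_integral_curve A Z J \<sigma> \<longrightarrow>
        (\<exists>I \<tau>. orientation_preserving_reparam I J \<tau> \<and>
           base_integral_curve A (geodesic_spray A h) I (\<sigma> \<circ> \<tau>))) \<and>
     (\<forall>J \<sigma>. base_integral_curve A (geodesic_spray A h) J \<sigma> \<longrightarrow>
        (\<exists>I \<tau>. orientation_preserving_reparam I J \<tau> \<and>
           base_integral_curve A Z I (\<sigma> \<circ> \<tau>)))"


section \<open>Chaplygin systems\<close>

definition lie_group ::
  "('g::{t2_space,second_countable_topology}, 'e::euclidean_space) chart set \<Rightarrow> 'g monoid \<Rightarrow> bool" where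
  "lie_group A G \<longleftrightarrow>
     smooth_atlas A \<and> group G \<and> carrier G = UNIV \<and>
     smooth_map (prod_atlas A A) A UNIV (\<lambda>(h, k). h \<otimes>\<^bsub>G\<^esub> k) \<and>
     smooth_map A A UNIV (m_inv G)"

text \<open>
  The quotient of the configuration manifold \<open>'q\<close> by the group \<open>'g\<close> is represented by a manifold
  \<open>'b\<close> together with a surjection \<open>proj\<close> whose fibres are the orbits. The model dimensions are
  \<open>CARD('n) = n\<close>, \<open>CARD('m) = m\<close> and \<open>CARD('k) = n - m\<close>.
\<close>

record ('q, 'n, 'g, 'k, 'b, 'm) chaplygin_data =
  Q_atlas :: "('q, real^'n) chart set"
  Q_metric :: "'q \<Rightarrow> 'q tvec \<Rightarrow> 'q tvec \<Rightarrow> real"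
  constr :: "'q \<Rightarrow> 'q tvec set"
  G_atlas :: "('g, real^'k) chart set"
  grp :: "'g monoid"
  actn :: "'g \<Rightarrow> 'q \<Rightarrow> 'q"
  B_atlas :: "('b, real^'m) chart set"
  proj :: "'q \<Rightarrow> 'b"

definition free_proper_action ::
  "('q::{t2_space,second_countable_topology}, 'n::finite, 'g::{t2_space,second_countable_topology},
    'k::finite, 'b, 'm::finite) chaplygin_data \<Rightarrow> bool" where
  "free_proper_action C \<longleftrightarrow>
     group_action (grp C) UNIV (actn C) \<and>
     smooth_map (prod_atlas (G_atlas C) (Q_atlas C)) (Q_atlas C) UNIV (\<lambda>(h, q). actn C h q) \<and>
     (\<forall>h q. actn C h q = q \<longrightarrow> h = \<one>\<^bsub>grp C\<^esub>) \<and>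
     proper_map euclidean euclidean (\<lambda>(h, q). (q, actn C h q))"

definition principal_bundle ::
  "('q::{t2_space,second_countable_topology}, 'n::finite, 'g::{t2_space,second_countable_topology},
    'k::finite, 'b::{t2_space,second_countable_topology}, 'm::finite) chaplygin_data \<Rightarrow> bool" where
  "principal_bundle C \<longleftrightarrow>
     surj (proj C) \<and> smooth_map (Q_atlas C) (B_atlas C) UNIV (proj C) \<and>
     (\<forall>q. proj C -` {proj C q} = orbit (grp C) (actn C) q) \<and>
     (\<forall>p. \<exists>U \<tau>. open U \<and> p \<in> U \<and>
        (let W = proj C -` U; triv = (\<lambda>q. (proj C q, \<tau> q)); BG = prod_atlas (B_atlas C) (G_atlas C) in
           bij_betw triv W (U \<times> UNIV) \<and>
           smooth_map (Q_atlas C) BG W triv \<and>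
           smooth_map BG (Q_atlas C) (U \<times> UNIV) (inv_into W triv) \<and>
           (\<forall>h. \<forall>q\<in>W. \<tau> (actn C h q) = h \<otimes>\<^bsub>grp C\<^esub> \<tau> q)))"

definition vertical ::
  "('q::topological_space, 'n::finite, 'g, 'k::finite, 'b::topological_space, 'm::finite) chaplygin_data
   \<Rightarrow> 'q \<Rightarrow> 'q tvec set" where
  "vertical C q = {v \<in> tangent_space (Q_atlas C) q. push (Q_atlas C) (B_atlas C) (proj C) q v = 0}"

definition G_invariant_tensor ::
  "('q::topological_space, 'n::finite, 'g, 'k::finite, 'b, 'm::finite) chaplygin_data \<Rightarrow>
   ('q \<Rightarrow> 'q tvec \<Rightarrow> 'q tvec \<Rightarrow> real) \<Rightarrow> bool" where
  "G_invariant_tensor C T \<longleftrightarrow>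
     (\<forall>h q. \<forall>u\<in>tangent_space (Q_atlas C) q. \<forall>v\<in>tangent_space (Q_atlas C) q.
        T (actn C h q) (push (Q_atlas C) (Q_atlas C) (actn C h) q u)
          (push (Q_atlas C) (Q_atlas C) (actn C h) q v) = T q u v)"

definition principal_connection ::
  "('q::topological_space, 'n::finite, 'g, 'k::finite, 'b::topological_space, 'm::finite) chaplygin_data
   \<Rightarrow> bool" where
  "principal_connection C \<longleftrightarrow>
     (\<forall>q. constr C q \<inter> vertical C q = {0} \<and>
        (\<forall>u\<in>tangent_space (Q_atlas C) q. \<exists>v\<in>constr C q. \<exists>w\<in>vertical C q. u = v + w)) \<and>
     (\<forall>h q. push (Q_atlas C) (Q_atlas C) (actn C h) q ` constr C q = constr C (actn C h q))"

definition chaplygin_system ::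
  "('q::{t2_space,second_countable_topology}, 'n::finite, 'g::{t2_space,second_countable_topology},
    'k::finite, 'b::{t2_space,second_countable_topology}, 'm::finite) chaplygin_data \<Rightarrow> bool" where
  "chaplygin_system C \<longleftrightarrow>
     smooth_atlas (Q_atlas C) \<and> riemannian_metric (Q_atlas C) (Q_metric C) \<and>
     distribution (Q_atlas C) CARD('m) (constr C) \<and>
     lie_group (G_atlas C) (grp C) \<and> free_proper_action C \<and>
     smooth_atlas (B_atlas C) \<and> principal_bundle C \<and>
     G_invariant_tensor C (Q_metric C) \<and> principal_connection C"


section \<open>Adapted frames\<close>

definition lie_algebra_basis ::
  "('q, 'n::finite, 'g::topological_space, 'k::finite, 'b, 'm::finite) chaplygin_data \<Rightarrow> ('k \<Rightarrow> 'g tvec) \<Rightarrow> bool" where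
  "lie_algebra_basis C \<xi> \<longleftrightarrow>
     inj \<xi> \<and> independent (range \<xi>) \<and> span (range \<xi>) = tangent_space (G_atlas C) \<one>\<^bsub>grp C\<^esub>"

text \<open>The derivative at \<open>t = 0\<close> of \<open>exp(t \<xi>\<^sub>i) q\<close>, as the image of \<open>\<xi>\<^sub>i\<close> under the orbit map.\<close>

definition inf_gen ::
  "('q::topological_space, 'n::finite, 'g::topological_space, 'k::finite, 'b, 'm::finite) chaplygin_data \<Rightarrow>
   ('k \<Rightarrow> 'g tvec) \<Rightarrow> 'k \<Rightarrow> 'q \<Rightarrow> 'q tvec" where
  "inf_gen C \<xi> i q = push (G_atlas C) (Q_atlas C) (\<lambda>h. actn C h q) \<one>\<^bsub>grp C\<^esub> (\<xi> i)"

text \<open>For every chart \<open>c\<close> of the base, \<open>X c a\<close> lifts the \<open>a\<close>-th coordinate field of \<open>c\<close>.\<close>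

type_synonym ('q, 'b, 'm) lifts = "('b, real^'m) chart \<Rightarrow> 'm \<Rightarrow> 'q \<Rightarrow> 'q tvec"

definition tube :: "('q, 'n::finite, 'g, 'k::finite, 'b, 'm::finite) chaplygin_data \<Rightarrow> ('b, real^'m) chart \<Rightarrow> 'q set" where
  "tube C c = proj C -` fst c"

definition horizontal_lifts ::
  "('q::topological_space, 'n::finite, 'g, 'k::finite, 'b::topological_space, 'm::finite) chaplygin_data
   \<Rightarrow> ('q, 'b, 'm) lifts \<Rightarrow> bool" where
  "horizontal_lifts C X \<longleftrightarrow>
     (\<forall>c\<in>B_atlas C. \<forall>a. vector_field (Q_atlas C) (tube C c) (X c a) \<and>
        (\<forall>q\<in>tube C c. X c a q \<in> constr C q \<and>
           push (Q_atlas C) (B_atlas C) (proj C) q (X c a q) =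
             coord_vec (B_atlas C) c (proj C q) (axis a 1)))"

definition G_hor ::
  "('q, 'n::finite, 'g, 'k::finite, 'b, 'm::finite) chaplygin_data \<Rightarrow> ('q, 'b, 'm) lifts \<Rightarrow>
   ('b, real^'m) chart \<Rightarrow> 'q \<Rightarrow> real^'m^'m" where
  "G_hor C X c q = (\<chi> a b. Q_metric C q (X c a q) (X c b q))"

definition G_mix ::
  "('q::topological_space, 'n::finite, 'g::topological_space, 'k::finite, 'b, 'm::finite) chaplygin_data \<Rightarrow>
   ('k \<Rightarrow> 'g tvec) \<Rightarrow> ('q, 'b, 'm) lifts \<Rightarrow> ('b, real^'m) chart \<Rightarrow> 'm \<Rightarrow> 'k \<Rightarrow> 'q \<Rightarrow> real" where
  "G_mix C \<xi> X c a i q = Q_metric C q (X c a q) (inf_gen C \<xi> i q)"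

definition K_coeff ::
  "('q::topological_space, 'n::finite, 'g::topological_space, 'k::finite, 'b, 'm::finite) chaplygin_data \<Rightarrow>
   ('k \<Rightarrow> 'g tvec) \<Rightarrow> ('q, 'b, 'm) lifts \<Rightarrow> ('b, real^'m) chart \<Rightarrow> 'm \<Rightarrow> 'k \<Rightarrow> 'q \<Rightarrow> real" where
  "K_coeff C \<xi> X c b i q =
     - (\<Sum>a\<in>UNIV. matrix_inv (G_hor C X c q) $ a $ b * G_mix C \<xi> X c a i q)"

text \<open>
  The frame \<open>{X\<^sub>a, X\<^sub>i}\<close>; indices \<open>a\<close> are \<open>Inl a\<close> and indices \<open>i\<close> are \<open>Inr i\<close>.
\<close>

definition frame ::
  "('q::topological_space, 'n::finite, 'g::topological_space, 'k::finite, 'b, 'm::finite) chaplygin_data \<Rightarrow>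
   ('k \<Rightarrow> 'g tvec) \<Rightarrow> ('q, 'b, 'm) lifts \<Rightarrow> ('b, real^'m) chart \<Rightarrow> 'm + 'k \<Rightarrow> 'q \<Rightarrow> 'q tvec" where
  "frame C \<xi> X c \<kappa> q = (case \<kappa> of
       Inl a \<Rightarrow> X c a q
     | Inr i \<Rightarrow> inf_gen C \<xi> i q + (\<Sum>b\<in>UNIV. K_coeff C \<xi> X c b i q *\<^sub>R X c b q))"

text \<open>Coefficient functions \<open>R c \<gamma> \<alpha> \<beta>\<close>, with upper index \<open>\<gamma>\<close> and lower indices \<open>\<alpha> \<beta>\<close>.\<close>

type_synonym ('q, 'b, 'm, 'k) coeffs =
  "('b, real^'m) chart \<Rightarrow> 'm + 'k \<Rightarrow> 'm + 'k \<Rightarrow> 'm + 'k \<Rightarrow> 'q \<Rightarrow> real"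

definition structure_functions ::
  "('q::topological_space, 'n::finite, 'g::topological_space, 'k::finite, 'b, 'm::finite) chaplygin_data \<Rightarrow>
   ('k \<Rightarrow> 'g tvec) \<Rightarrow> ('q, 'b, 'm) lifts \<Rightarrow> ('q, 'b, 'm, 'k) coeffs \<Rightarrow> bool" where
  "structure_functions C \<xi> X R \<longleftrightarrow>
     (\<forall>c\<in>B_atlas C. \<forall>\<alpha> \<beta>.
        (\<forall>\<gamma>. smooth_fun (Q_atlas C) (tube C c) (R c \<gamma> \<alpha> \<beta>)) \<and>
        (\<forall>q\<in>tube C c. lie_bracket (Q_atlas C) (frame C \<xi> X c \<alpha>) (frame C \<xi> X c \<beta>) q =
           (\<Sum>\<gamma>\<in>UNIV. R c \<gamma> \<alpha> \<beta> q *\<^sub>R frame C \<xi> X c \<gamma> q)))"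

text \<open>Connection coefficients of a connection \<open>nabla\<close>, of which only \<open>nabla X\<^sub>a X\<^sub>b\<close> is needed.\<close>

definition connection_coeffs ::
  "('q::topological_space, 'n::finite, 'g::topological_space, 'k::finite, 'b, 'm::finite) chaplygin_data \<Rightarrow>
   ('k \<Rightarrow> 'g tvec) \<Rightarrow> ('q, 'b, 'm) lifts \<Rightarrow>
   (('q \<Rightarrow> 'q tvec) \<Rightarrow> ('q \<Rightarrow> 'q tvec) \<Rightarrow> 'q \<Rightarrow> 'q tvec) \<Rightarrow>
   (('b, real^'m) chart \<Rightarrow> 'm + 'k \<Rightarrow> 'm \<Rightarrow> 'm \<Rightarrow> 'q \<Rightarrow> real) \<Rightarrow> bool" where
  "connection_coeffs C \<xi> X nabla \<Gamma> \<longleftrightarrow>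
     (\<forall>c\<in>B_atlas C. \<forall>a b. \<forall>q\<in>tube C c.
        nabla (X c a) (X c b) q = (\<Sum>\<gamma>\<in>UNIV. \<Gamma> c \<gamma> a b q *\<^sub>R frame C \<xi> X c \<gamma> q))"


section \<open>Projective geodesic extensions\<close>

definition gbar_mix ::
  "('q::topological_space, 'n::finite, 'g::topological_space, 'k::finite, 'b, 'm::finite) chaplygin_data \<Rightarrow>
   ('k \<Rightarrow> 'g tvec) \<Rightarrow> ('q, 'b, 'm) lifts \<Rightarrow> ('q \<Rightarrow> 'q tvec \<Rightarrow> 'q tvec \<Rightarrow> real) \<Rightarrow>
   ('b, real^'m) chart \<Rightarrow> 'm \<Rightarrow> 'k \<Rightarrow> 'q \<Rightarrow> real" where
  "gbar_mix C \<xi> X gbar c a i q = gbar q (X c a q) (frame C \<xi> X c (Inr i) q)"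

text \<open>The \<open>\<theta> b\<close> are the coefficients of a fibrewise linear function on the constraint distribution.\<close>

definition Gamma_nh ::
  "('q, 'b, 'm::finite) lifts \<Rightarrow> (('b, real^'m) chart \<Rightarrow> 'm + 'k \<Rightarrow> 'm \<Rightarrow> 'm \<Rightarrow> 'q \<Rightarrow> real) \<Rightarrow>
   ('b, real^'m) chart \<Rightarrow> ('m \<Rightarrow> 'q \<Rightarrow> real) \<Rightarrow> 'q \<Rightarrow> real^'m \<Rightarrow> real" where
  "Gamma_nh X \<Gamma> c \<theta> q v = (\<Sum>a\<in>UNIV. \<Sum>b\<in>UNIV.
     (app (X c a q) (\<theta> b) - (\<Sum>d\<in>UNIV. \<theta> d q * \<Gamma> c (Inl d) a b q)) * v $ a * v $ b)"

definition condition_A ::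
  "('q::topological_space, 'n::finite, 'g::topological_space, 'k::finite, 'b, 'm::finite) chaplygin_data \<Rightarrow>
   ('k \<Rightarrow> 'g tvec) \<Rightarrow> ('q, 'b, 'm) lifts \<Rightarrow> ('q, 'b, 'm, 'k) coeffs \<Rightarrow>
   ('q \<Rightarrow> 'q tvec \<Rightarrow> 'q tvec \<Rightarrow> real) \<Rightarrow> ('q \<Rightarrow> real) \<Rightarrow> bool" where
  "condition_A C \<xi> X R gbar F \<longleftrightarrow>
     (\<forall>ch\<in>B_atlas C. \<forall>q\<in>tube C ch. \<forall>v :: real^'m. \<forall>c.
        (\<Sum>a\<in>UNIV. \<Sum>b\<in>UNIV. \<Sum>d\<in>UNIV. G_hor C X ch q $ b $ d *
           ((if a = d then app (X ch c q) F else 0) - (if c = d then app (X ch a q) F else 0)) *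
           v $ a * v $ b)
        + (\<Sum>k\<in>UNIV. \<Sum>a\<in>UNIV. (\<Sum>b\<in>UNIV. gbar_mix C \<xi> X gbar ch b k q * v $ b) *
             R ch (Inr k) (Inl a) (Inl c) q * v $ a) = 0)"

definition condition_B ::
  "('q::topological_space, 'n::finite, 'g::topological_space, 'k::finite, 'b, 'm::finite) chaplygin_data \<Rightarrow>
   ('k \<Rightarrow> 'g tvec) \<Rightarrow> ('q, 'b, 'm) lifts \<Rightarrow> ('q, 'b, 'm, 'k) coeffs \<Rightarrow>
   (('b, real^'m) chart \<Rightarrow> 'm + 'k \<Rightarrow> 'm \<Rightarrow> 'm \<Rightarrow> 'q \<Rightarrow> real) \<Rightarrow>
   ('q \<Rightarrow> 'q tvec \<Rightarrow> 'q tvec \<Rightarrow> real) \<Rightarrow> ('q \<Rightarrow> real) \<Rightarrow> bool" where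
  "condition_B C \<xi> X R \<Gamma> gbar F \<longleftrightarrow>
     (\<forall>ch\<in>B_atlas C. \<forall>q\<in>tube C ch. \<forall>v :: real^'m. \<forall>i.
        Gamma_nh X \<Gamma> ch (\<lambda>a. gbar_mix C \<xi> X gbar ch a i) q v
        + (\<Sum>k\<in>UNIV. \<Sum>a\<in>UNIV. \<Sum>b\<in>UNIV.
             Q_metric C q (frame C \<xi> X ch (Inr k) q) (frame C \<xi> X ch (Inr i) q) *
             \<Gamma> ch (Inr k) a b q * v $ a * v $ b)
        + (\<Sum>k\<in>UNIV. \<Sum>a\<in>UNIV. (\<Sum>b\<in>UNIV. gbar_mix C \<xi> X gbar ch b k q * v $ b) *
             (R ch (Inr k) (Inr i) (Inl a) q + (if k = i then app (X ch a q) F else 0)) * v $ a)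
        - (\<Sum>a\<in>UNIV. \<Sum>b\<in>UNIV.
             G_hor C X ch q $ a $ b * app (frame C \<xi> X ch (Inr i) q) F * v $ a * v $ b) = 0)"

definition projective_geodesic_extension ::
  "('q::topological_space, 'n::finite, 'g::topological_space, 'k::finite, 'b, 'm::finite) chaplygin_data \<Rightarrow>
   ('k \<Rightarrow> 'g tvec) \<Rightarrow> ('q, 'b, 'm) lifts \<Rightarrow> ('q, 'b, 'm, 'k) coeffs \<Rightarrow>
   (('b, real^'m) chart \<Rightarrow> 'm + 'k \<Rightarrow> 'm \<Rightarrow> 'm \<Rightarrow> 'q \<Rightarrow> real) \<Rightarrow>
   ('q \<Rightarrow> 'q tvec \<Rightarrow> 'q tvec \<Rightarrow> real) \<Rightarrow> ('q \<Rightarrow> real) \<Rightarrow> bool" where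
  "projective_geodesic_extension C \<xi> X R \<Gamma> gbar F \<longleftrightarrow>
     sym_tensor_field (Q_atlas C) gbar \<and>
     (\<forall>q. \<forall>u\<in>constr C q. \<forall>v\<in>constr C q. gbar q u v = Q_metric C q u v) \<and>
     smooth_fun (Q_atlas C) UNIV F \<and>
     condition_A C \<xi> X R gbar F \<and> condition_B C \<xi> X R \<Gamma> gbar F"

definition VD_orthogonal ::
  "('q::topological_space, 'n::finite, 'g, 'k::finite, 'b::topological_space, 'm::finite) chaplygin_data
   \<Rightarrow> ('q \<Rightarrow> 'q tvec \<Rightarrow> 'q tvec \<Rightarrow> real) \<Rightarrow> bool" where
  "VD_orthogonal C gbar \<longleftrightarrow> (\<forall>q. \<forall>u\<in>vertical C q. \<forall>v\<in>constr C q. gbar q u v = 0)"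


section \<open>The reduced system on the tangent bundle of the quotient\<close>

text \<open>
  A \<open>G\<close>-invariant function as a function of the coordinates of a chart of the quotient, by
  evaluation at an arbitrary point of the fibre.
\<close>

definition descend ::
  "('q, 'n::finite, 'g, 'k::finite, 'b, 'm::finite) chaplygin_data \<Rightarrow> ('b, real^'m) chart \<Rightarrow> ('q \<Rightarrow> 'x) \<Rightarrow> real^'m \<Rightarrow> 'x" where
  "descend C c F x = F (inv_into UNIV (proj C) (chart_inv c x))"

text \<open>\<open>curv T R c a b e\<close> is \<open>T\<^sub>a\<^sub>k R\<^sup>k\<^sub>b\<^sub>e\<close>.\<close>

definition curv ::
  "(('b, real^'m) chart \<Rightarrow> 'm \<Rightarrow> 'k::finite \<Rightarrow> 'q \<Rightarrow> real) \<Rightarrow> ('q, 'b, 'm, 'k) coeffs \<Rightarrow>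
   ('b, real^'m) chart \<Rightarrow> 'm \<Rightarrow> 'm \<Rightarrow> 'm \<Rightarrow> 'q \<Rightarrow> real" where
  "curv T R c a b e q = (\<Sum>k\<in>UNIV. T c a k q * R c (Inr k) (Inl b) (Inl e) q)"

definition ext_deriv :: "'m::finite form1 \<Rightarrow> 'm form2" where
  "ext_deriv \<theta> z w w' =
     frechet_derivative (\<lambda>y. \<theta> y w') (at z) w - frechet_derivative (\<lambda>y. \<theta> y w) (at z) w'"

text \<open>The 2-form \<open>dq\<^sup>b \<and> dq\<^sup>c\<close>, and the contraction of a 2-form with a vector field.\<close>

definition dq_wedge :: "'m::finite \<Rightarrow> 'm \<Rightarrow> (real^'m) \<times> (real^'m) \<Rightarrow> (real^'m) \<times> (real^'m) \<Rightarrow> real" where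
  "dq_wedge b c w w' = fst w $ b * fst w' $ c - fst w $ c * fst w' $ b"

definition contract :: "((real^'m) \<times> (real^'m) \<Rightarrow> (real^'m) \<times> (real^'m)) \<Rightarrow> 'm::finite form2 \<Rightarrow> 'm form1" where
  "contract Z \<omega> z w = \<omega> z (Z z) w"

definition reduced_energy ::
  "('q, 'n::finite, 'g, 'k::finite, 'b, 'm::finite) chaplygin_data \<Rightarrow> ('q, 'b, 'm) lifts \<Rightarrow>
   ('b, real^'m) chart \<Rightarrow> (real^'m) \<times> (real^'m) \<Rightarrow> real" where
  "reduced_energy C X c z = (\<Sum>a\<in>UNIV. \<Sum>b\<in>UNIV.
     descend C c (G_hor C X c) (fst z) $ a $ b * snd z $ a * snd z $ b) / 2"

definition theta_l ::
  "('q, 'n::finite, 'g, 'k::finite, 'b, 'm::finite) chaplygin_data \<Rightarrow> ('q, 'b, 'm) lifts \<Rightarrow>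
   ('b, real^'m) chart \<Rightarrow> 'm form1" where
  "theta_l C X c z w = (\<Sum>a\<in>UNIV. \<Sum>b\<in>UNIV.
     descend C c (G_hor C X c) (fst z) $ a $ b * snd z $ a * fst w $ b)"

definition omega_l ::
  "('q, 'n::finite, 'g, 'k::finite, 'b, 'm::finite) chaplygin_data \<Rightarrow> ('q, 'b, 'm) lifts \<Rightarrow>
   ('b, real^'m) chart \<Rightarrow> 'm form2" where
  "omega_l C X c z w w' = - ext_deriv (theta_l C X c) z w w'"

definition alpha_form ::
  "('q::topological_space, 'n::finite, 'g::topological_space, 'k::finite, 'b, 'm::finite) chaplygin_data \<Rightarrow>
   ('k \<Rightarrow> 'g tvec) \<Rightarrow> ('q, 'b, 'm) lifts \<Rightarrow> ('q, 'b, 'm, 'k) coeffs \<Rightarrow>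
   ('b, real^'m) chart \<Rightarrow> 'm form1" where
  "alpha_form C \<xi> X R ch z w = - (\<Sum>a\<in>UNIV. \<Sum>b\<in>UNIV. \<Sum>c\<in>UNIV.
     descend C ch (curv (G_mix C \<xi> X) R ch a b c) (fst z) * snd z $ a * snd z $ b * fst w $ c)"

definition Xi_form ::
  "('q::topological_space, 'n::finite, 'g::topological_space, 'k::finite, 'b, 'm::finite) chaplygin_data \<Rightarrow>
   ('k \<Rightarrow> 'g tvec) \<Rightarrow> ('q, 'b, 'm) lifts \<Rightarrow> ('q, 'b, 'm, 'k) coeffs \<Rightarrow>
   ('b, real^'m) chart \<Rightarrow> 'm form2" where
  "Xi_form C \<xi> X R ch z w w' = - (\<Sum>a\<in>UNIV. \<Sum>b\<in>UNIV. \<Sum>c\<in>UNIV.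
     descend C ch (curv (G_mix C \<xi> X) R ch a b c) (fst z) * snd z $ a * dq_wedge b c w w') / 2"

definition gamma_form ::
  "('q::topological_space, 'n::finite, 'g::topological_space, 'k::finite, 'b, 'm::finite) chaplygin_data \<Rightarrow>
   ('k \<Rightarrow> 'g tvec) \<Rightarrow> ('q, 'b, 'm) lifts \<Rightarrow> ('q, 'b, 'm, 'k) coeffs \<Rightarrow>
   ('q \<Rightarrow> 'q tvec \<Rightarrow> 'q tvec \<Rightarrow> real) \<Rightarrow> ('b, real^'m) chart \<Rightarrow> 'm form2" where
  "gamma_form C \<xi> X R gbar ch z w w' =
     (let S = (\<lambda>a b c. descend C ch (curv (gbar_mix C \<xi> X gbar) R ch a b c) (fst z)) in
      (\<Sum>a\<in>UNIV. \<Sum>b\<in>UNIV. \<Sum>c\<in>UNIV.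
         (S b a c - S c a b + 2 * S a b c) * snd z $ a * dq_wedge b c w w') / 6)"

definition second_order_field :: "('b, real^'m) chart set \<Rightarrow> ('b, 'm::finite) tfield \<Rightarrow> bool" where
  "second_order_field A Z \<longleftrightarrow> (\<forall>c\<in>A. \<forall>z\<in>tchart_dom c. fst (Z c z) = snd z)"

definition reduced_vector_field ::
  "('q::topological_space, 'n::finite, 'g::topological_space, 'k::finite, 'b, 'm::finite) chaplygin_data \<Rightarrow>
   ('k \<Rightarrow> 'g tvec) \<Rightarrow> ('q, 'b, 'm) lifts \<Rightarrow> ('q, 'b, 'm, 'k) coeffs \<Rightarrow> ('b, 'm) tfield \<Rightarrow> bool" where
  "reduced_vector_field C \<xi> X R Z \<longleftrightarrow>
     second_order_field (B_atlas C) Z \<and>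
     (\<forall>c\<in>B_atlas C. \<forall>z\<in>tchart_dom c. \<forall>w.
        contract (Z c) (omega_l C X c) z w =
          frechet_derivative (reduced_energy C X c) (at z) w + alpha_form C \<xi> X R c z w)"

definition semibasic_2form :: "('b, real^'m) chart \<Rightarrow> 'm::finite form2 \<Rightarrow> bool" where
  "semibasic_2form c B \<longleftrightarrow>
     (\<forall>w w'. smooth_on (tchart_dom c) (\<lambda>z. B z w w')) \<and>
     (\<forall>z\<in>tchart_dom c. (\<forall>w. linear (B z w)) \<and> (\<forall>w w'. B z w w' = - B z w' w) \<and>
        (\<forall>w w'. fst w = 0 \<longrightarrow> B z w w' = 0))"

definition dynamical_gauge ::
  "('b, real^'m) chart set \<Rightarrow> ('b, 'm) tfield \<Rightarrow> (('b, real^'m) chart \<Rightarrow> 'm::finite form2) \<Rightarrow> bool" where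
  "dynamical_gauge A Z B \<longleftrightarrow>
     (\<forall>c\<in>A. semibasic_2form c (B c) \<and> (\<forall>z\<in>tchart_dom c. \<forall>w. contract (Z c) (B c) z w = 0))"

definition gamma_condition ::
  "('q::topological_space, 'n::finite, 'g::topological_space, 'k::finite, 'b, 'm::finite) chaplygin_data \<Rightarrow>
   ('k \<Rightarrow> 'g tvec) \<Rightarrow> ('q, 'b, 'm) lifts \<Rightarrow> ('q, 'b, 'm, 'k) coeffs \<Rightarrow>
   ('q \<Rightarrow> 'q tvec \<Rightarrow> 'q tvec \<Rightarrow> real) \<Rightarrow> ('b, 'm) tfield \<Rightarrow> bool" where
  "gamma_condition C \<xi> X R gbar Z \<longleftrightarrow>
     (\<forall>c\<in>B_atlas C. \<forall>z\<in>tchart_dom c. \<forall>w.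
        contract (Z c) (gamma_form C \<xi> X R gbar c) z w = alpha_form C \<xi> X R c z w)"

definition hamiltonian_reparametrization ::
  "('b::topological_space, real^('m::finite)) chart set \<Rightarrow> ('b, 'm) tfield \<Rightarrow> bool" where
  "hamiltonian_reparametrization A Z \<longleftrightarrow>
     (\<exists>h. riemannian_metric A h \<and> complete_set_of_pregeodesics A Z h)"

end

theory Submission
  imports Defs
begin

text \<open>
  Brackets of horizontal lifts are vertical, so \<open>G\<^sub>a\<^sub>k R\<^sup>k\<^sub>b\<^sub>c = g(X\<^sub>a, [X\<^sub>b, X\<^sub>c])\<close> and
  \<open>gbar\<^sub>a\<^sub>k R\<^sup>k\<^sub>b\<^sub>c = (gbar - g)(X\<^sub>a, [X\<^sub>b, X\<^sub>c])\<close>; call these invariant functions \<open>T\<close> and \<open>S\<close>.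
  Contracting with the reduced field turns \<open>\<gamma>\<close> into \<open>S(v, v, \<cdot>)\<close> and the form \<open>\<Xi>\<close> into
  \<open>\<alpha> = - T(v, v, \<cdot>)\<close>. Hence the condition on \<open>\<gamma>\<close> reads \<open>S(v, v, \<cdot>) = - T(v, v, \<cdot>)\<close>, which
  is automatic in the orthogonal case, where \<open>S = - T\<close>. Condition (A') then rewrites the
  gyroscopic term as \<open>T(v, v, \<cdot>) = g(v, v) df - df(v) g(v, \<cdot>)\<close>, and this makes the geodesic
  spray of the metric \<open>exp (2 f) g\<close> on the quotient equal to the reduced field minus
  \<open>df(v)\<close> times the Liouville field: both have the same curves, up to the change of
  time \<open>ds = exp f dt\<close>.
\<close>

section \<open>Calculus of smooth maps\<close>

text \<open>The exponent 2 is forced. Passing from g to exp (r f) g changes the geodesic spray by (r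
  / 2) g(v, v) grad f - r df(v) v, while the gyroscopic acceleration given by (A') is g(v, v) grad f
  - df(v) v. The gradient terms match for r = 2, and the remainder - df(v) v is a multiple of the
  velocity, hence a matter of time change alone. Accelerations are compared with the index lowered
  by the reduced metric, so that the inverse matrix enters only through its defining property and is
  never differentiated. The obstacle is descent to the quotient. The generators V_i are in general
  not invariant, and functions on Q/G are read off at arbitrarily chosen points of the fibres, a
  choice that need not be continuous. Indices k are therefore contracted away into brackets of
  horizontal lifts, which are invariant, and invariant functions are pulled back by local smooth
  sections instead of the arbitrary choice.\<close>

lemma frechet_derivative_eqI: "(f has_derivative f') (at x) \<Longrightarrow> frechet_derivative f (at x) = f'"
  by (metis frechet_derivative_at)

text \<open>A derivative at a point depends on values nearby, so agreement on \<open>S\<close>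
  transfers to derivatives because \<open>S\<close> is open; the derivatives then agree on
  \<open>S\<close> again and the induction closes.\<close>

lemma Ck_on_cong:
  assumes "open S" "Ck_on k S f" "\<And>x. x \<in> S \<Longrightarrow> f x = g x"
  shows "Ck_on k S g"
  using assms(2,3)
proof (induction k arbitrary: f g)
  case 0
  then show ?case by (simp cong: continuous_on_cong)
next
  case (Suc k)
  have df: "f differentiable (at x)" if "x \<in> S" for x
    using Suc.prems that by auto
  have der: "(g has_derivative frechet_derivative f (at x)) (at x)" if "x \<in> S" for x
    by (rule has_derivative_transform_within_open[OF _ \<open>open S\<close> that Suc.prems(2)])
      (use df[OF that] in \<open>auto simp: frechet_derivative_works\<close>)
  have "Ck_on k S (\<lambda>x. frechet_derivative g (at x) v)" for v
    by (rule Suc.IH[of "\<lambda>x. frechet_derivative f (at x) v"])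
      (use Suc.prems(1) in \<open>auto simp: frechet_derivative_eqI[OF der]\<close>)
  then show ?case
    using der by (auto simp: differentiable_def)
qed

lemma Ck_on_subset: "Ck_on k S f \<Longrightarrow> T \<subseteq> S \<Longrightarrow> Ck_on k T f"
  by (induction k arbitrary: f) (auto intro: continuous_on_subset)

lemma Ck_on_Suc_imp: "Ck_on (Suc k) S f \<Longrightarrow> Ck_on k S f"
proof (induction k arbitrary: f)
  case 0
  then show ?case
    by (auto intro!: continuous_at_imp_continuous_on differentiable_imp_continuous_within)
qed auto

text \<open>Continuity and differentiability at a point are local. This is what patches chart-wise
  smoothness together.\<close>

lemma Ck_on_local:
  assumes "\<And>x. x \<in> S \<Longrightarrow> \<exists>T. open T \<and> x \<in> T \<and> Ck_on k T f"
  shows "Ck_on k S f"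
  using assms
proof (induction k arbitrary: f)
  case 0
  have "isCont f x" if "x \<in> S" for x
    using "0.prems"[OF that] continuous_on_eq_continuous_at by auto
  then show ?case by (simp add: continuous_at_imp_continuous_on)
next
  case (Suc k)
  have "f differentiable (at x)" if "x \<in> S" for x
    using Suc.prems[OF that] by auto
  moreover have "Ck_on k S (\<lambda>x. frechet_derivative f (at x) v)" for v
    by (rule Suc.IH) (use Suc.prems in fastforce)
  ultimately show ?case by simp
qed

lemma Ck_on_const: "Ck_on k S (\<lambda>x. c)"
  by (induction k arbitrary: c) auto

lemma Ck_on_bounded_linear:
  assumes "bounded_linear L"
  shows "Ck_on k S L"
proof (cases k)
  case 0
  then show ?thesis using assms by (simp add: linear_continuous_on)
next
  case (Suc k')
  have der: "(L has_derivative L) (at x)" for x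
    using assms by (rule bounded_linear_imp_has_derivative)
  show ?thesis
    using Suc der by (auto simp: differentiable_def frechet_derivative_eqI[OF der] Ck_on_const)
qed

lemma Ck_on_compose_linear:
  assumes "bounded_linear L" "open S" "Ck_on k S f"
  shows "Ck_on k S (\<lambda>x. L (f x))"
  using assms(3)
proof (induction k arbitrary: f)
  case 0
  then show ?case
    using assms(1) by (auto intro: bounded_linear.continuous_on)
next
  case (Suc k)
  have der: "((\<lambda>x. L (f x)) has_derivative (\<lambda>v. L (frechet_derivative f (at x) v))) (at x)"
    if "x \<in> S" for x
    using Suc.prems that assms(1)
    by (intro bounded_linear.has_derivative[OF assms(1)])
      (auto simp flip: frechet_derivative_works)
  show ?case
    unfolding Ck_on.simps
  proof (intro conjI ballI allI)
    show "(\<lambda>x. L (f x)) differentiable (at x)" if "x \<in> S" for x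
      using der[OF that] by (auto simp: differentiable_def)
    show "Ck_on k S (\<lambda>x. frechet_derivative (\<lambda>x. L (f x)) (at x) v)" for v
    proof (rule Ck_on_cong[OF \<open>open S\<close> Suc.IH])
      show "Ck_on k S (\<lambda>x. frechet_derivative f (at x) v)" using Suc.prems by simp
      show "L (frechet_derivative f (at x) v) = frechet_derivative (\<lambda>x. L (f x)) (at x) v"
        if "x \<in> S" for x
        using frechet_derivative_eqI[OF der[OF that]] by simp
    qed
  qed
qed

lemma Ck_on_add:
  assumes "open S" "Ck_on k S f" "Ck_on k S g"
  shows "Ck_on k S (\<lambda>x. f x + g x)"
  using assms(2,3)
proof (induction k arbitrary: f g)
  case 0
  then show ?case by (simp add: continuous_on_add)
next
  case (Suc k)
  have der: "((\<lambda>x. f x + g x) has_derivative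
      (\<lambda>v. frechet_derivative f (at x) v + frechet_derivative g (at x) v)) (at x)"
    if "x \<in> S" for x
    using Suc.prems that
    by (auto intro!: has_derivative_add simp flip: frechet_derivative_works)
  show ?case
    unfolding Ck_on.simps
  proof (intro conjI ballI allI)
    show "(\<lambda>x. f x + g x) differentiable (at x)" if "x \<in> S" for x
      using der[OF that] by (auto simp: differentiable_def)
    show "Ck_on k S (\<lambda>x. frechet_derivative (\<lambda>x. f x + g x) (at x) v)" for v
    proof (rule Ck_on_cong[OF \<open>open S\<close> Suc.IH])
      show "Ck_on k S (\<lambda>x. frechet_derivative f (at x) v)"
        "Ck_on k S (\<lambda>x. frechet_derivative g (at x) v)" using Suc.prems by auto
      show "frechet_derivative f (at x) v + frechet_derivative g (at x) v =
          frechet_derivative (\<lambda>x. f x + g x) (at x) v" if "x \<in> S" for x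
        using frechet_derivative_eqI[OF der[OF that]] by simp
    qed
  qed
qed

lemma Ck_on_bilinear:
  assumes "bounded_bilinear B" "open S" "Ck_on k S f" "Ck_on k S g"
  shows "Ck_on k S (\<lambda>x. B (f x) (g x))"
  using assms(3,4)
proof (induction k arbitrary: f g)
  case 0
  then show ?case using assms(1) by (simp add: bounded_bilinear.continuous_on)
next
  case (Suc k)
  have der: "((\<lambda>x. B (f x) (g x)) has_derivative
      (\<lambda>v. B (f x) (frechet_derivative g (at x) v) + B (frechet_derivative f (at x) v) (g x))) (at x)"
    if "x \<in> S" for x
    using Suc.prems that assms(1)
    by (intro bounded_bilinear.FDERIV) (auto simp flip: frechet_derivative_works)
  show ?case
    unfolding Ck_on.simps
  proof (intro conjI ballI allI)
    show "(\<lambda>x. B (f x) (g x)) differentiable (at x)" if "x \<in> S" for x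
      using der[OF that] by (auto simp: differentiable_def)
    show "Ck_on k S (\<lambda>x. frechet_derivative (\<lambda>x. B (f x) (g x)) (at x) v)" for v
    \<comment> \<open>The product rule pairs a derivative with an undifferentiated factor; the
      latter is used one order below what is given.\<close>
    proof (rule Ck_on_cong[OF \<open>open S\<close> Ck_on_add[OF \<open>open S\<close> Suc.IH Suc.IH]])
      show "B (f x) (frechet_derivative g (at x) v) + B (frechet_derivative f (at x) v) (g x) =
          frechet_derivative (\<lambda>x. B (f x) (g x)) (at x) v" if "x \<in> S" for x
        using frechet_derivative_eqI[OF der[OF that]] by simp
    qed (use Suc.prems Ck_on_Suc_imp in auto)
  qed
qed

lemma Ck_on_sum:
  assumes "open S" "\<And>i. i \<in> I \<Longrightarrow> Ck_on k S (f i)"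
  shows "Ck_on k S (\<lambda>x. \<Sum>i\<in>I. f i x)"
proof (cases "finite I")
  case True
  then show ?thesis
    using assms(2) by (induction I) (auto intro: Ck_on_const Ck_on_add[OF \<open>open S\<close>])
qed (simp add: Ck_on_const)

text \<open>\<open>Ck_on\<close> speaks of derivatives in fixed directions, whereas the chain rule
  differentiates \<open>g\<close> in the direction Df(x) v, which moves with x. Expanding this
  direction in \<open>Basis\<close> leaves a finite sum of products of its components with
  derivatives of \<open>g\<close> in fixed directions, to which the induction applies; this is where
  finite dimension of the middle space enters.\<close>

lemma Ck_on_compose:
  fixes f :: "'a::real_normed_vector \<Rightarrow> 'b::euclidean_space"
    and g :: "'b \<Rightarrow> 'c::real_normed_vector"
  assumes "open S" "Ck_on k S f" "Ck_on k T g" "f ` S \<subseteq> T"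
  shows "Ck_on k S (\<lambda>x. g (f x))"
  using assms(2,3)
proof (induction k arbitrary: g)
  case 0
  then show ?case using assms(4) by (auto intro: continuous_on_compose2)
next
  case (Suc k)
  have dg: "g differentiable (at (f x))" if "x \<in> S" for x
    using Suc.prems assms(4) that by auto
  have df: "f differentiable (at x)" if "x \<in> S" for x
    using Suc.prems that by auto
  have der: "((\<lambda>x. g (f x)) has_derivative
      (\<lambda>v. frechet_derivative g (at (f x)) (frechet_derivative f (at x) v))) (at x)"
    if "x \<in> S" for x
    by (rule has_derivative_compose) (use df[OF that] dg[OF that] in \<open>auto simp: frechet_derivative_works\<close>)
  have expand: "frechet_derivative g (at (f x)) w =
      (\<Sum>i\<in>Basis. (w \<bullet> i) *\<^sub>R frechet_derivative g (at (f x)) i)" if "x \<in> S" for x w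
  proof -
    interpret linear "frechet_derivative g (at (f x))"
      using dg[OF that] by (rule linear_frechet_derivative)
    show ?thesis
      by (simp flip: sum scale add: euclidean_representation)
  qed
  show ?case
    unfolding Ck_on.simps
  proof (intro conjI ballI allI)
    show "(\<lambda>x. g (f x)) differentiable (at x)" if "x \<in> S" for x
      using der[OF that] by (auto simp: differentiable_def)
    show "Ck_on k S (\<lambda>x. frechet_derivative (\<lambda>x. g (f x)) (at x) v)" for v
    proof (rule Ck_on_cong[OF \<open>open S\<close>])
      show "Ck_on k S (\<lambda>x. \<Sum>i\<in>Basis. (frechet_derivative f (at x) v \<bullet> i) *\<^sub>R
          frechet_derivative g (at (f x)) i)"
        by (intro Ck_on_sum Ck_on_bilinear[OF bounded_bilinear_scaleR] \<open>open S\<close> Suc.IH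
            Ck_on_compose_linear[OF bounded_linear_inner_left] Ck_on_Suc_imp[OF Suc.prems(1)])
          (use Suc.prems in auto)
      show "(\<Sum>i\<in>Basis. (frechet_derivative f (at x) v \<bullet> i) *\<^sub>R frechet_derivative g (at (f x)) i) =
          frechet_derivative (\<lambda>x. g (f x)) (at x) v" if "x \<in> S" for x
        by (simp only: frechet_derivative_eqI[OF der[OF that]] flip: expand[OF that])
    qed
  qed
qed

section \<open>Closure properties of smooth maps\<close>

lemma smooth_on_cong:
  "open S \<Longrightarrow> smooth_on S f \<Longrightarrow> (\<And>x. x \<in> S \<Longrightarrow> f x = g x) \<Longrightarrow> smooth_on S g"
  unfolding smooth_on_def by (metis Ck_on_cong)

lemma smooth_on_subset: "smooth_on S f \<Longrightarrow> T \<subseteq> S \<Longrightarrow> smooth_on T f"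
  unfolding smooth_on_def by (metis Ck_on_subset)

lemma smooth_on_local:
  assumes "\<And>x. x \<in> S \<Longrightarrow> \<exists>T. open T \<and> x \<in> T \<and> smooth_on T f"
  shows "smooth_on S f"
  using assms unfolding smooth_on_def by (metis Ck_on_local)

lemma smooth_on_const [simp]: "smooth_on S (\<lambda>x. c)"
  by (simp add: smooth_on_def Ck_on_const)

lemma smooth_on_bounded_linear: "bounded_linear L \<Longrightarrow> smooth_on S L"
  by (simp add: smooth_on_def Ck_on_bounded_linear)

lemma smooth_on_compose_linear:
  "bounded_linear L \<Longrightarrow> open S \<Longrightarrow> smooth_on S f \<Longrightarrow> smooth_on S (\<lambda>x. L (f x))"
  by (simp add: smooth_on_def Ck_on_compose_linear)

lemma smooth_on_add:
  "open S \<Longrightarrow> smooth_on S f \<Longrightarrow> smooth_on S g \<Longrightarrow> smooth_on S (\<lambda>x. f x + g x)"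
  by (simp add: smooth_on_def Ck_on_add)

lemma smooth_on_scaleR:
  "open S \<Longrightarrow> smooth_on S f \<Longrightarrow> smooth_on S g \<Longrightarrow> smooth_on S (\<lambda>x. f x *\<^sub>R g x)"
  by (simp add: smooth_on_def Ck_on_bilinear bounded_bilinear_scaleR)

lemma smooth_on_mult:
  fixes f g :: "_ \<Rightarrow> real"
  shows "open S \<Longrightarrow> smooth_on S f \<Longrightarrow> smooth_on S g \<Longrightarrow> smooth_on S (\<lambda>x. f x * g x)"
  using smooth_on_scaleR[of S f g] by simp

lemma smooth_on_minus: "open S \<Longrightarrow> smooth_on S f \<Longrightarrow> smooth_on S (\<lambda>x. - f x)"
  by (rule smooth_on_compose_linear[OF bounded_linear_minus[OF bounded_linear_ident]])

lemma smooth_on_diff: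
  "open S \<Longrightarrow> smooth_on S f \<Longrightarrow> smooth_on S g \<Longrightarrow> smooth_on S (\<lambda>x. f x - g x)"
  using smooth_on_add[OF _ _ smooth_on_minus, of S f g] by simp

lemma smooth_on_sum:
  "open S \<Longrightarrow> (\<And>i. i \<in> I \<Longrightarrow> smooth_on S (f i)) \<Longrightarrow> smooth_on S (\<lambda>x. \<Sum>i\<in>I. f i x)"
  by (simp add: smooth_on_def Ck_on_sum)

lemma smooth_on_compose:
  fixes f :: "'a::real_normed_vector \<Rightarrow> 'b::euclidean_space"
  assumes "open S" "smooth_on S f" "smooth_on T g" "f ` S \<subseteq> T"
  shows "smooth_on S (\<lambda>x. g (f x))"
  using assms unfolding smooth_on_def by (blast intro: Ck_on_compose)

lemma smooth_on_imp_differentiable: "smooth_on S f \<Longrightarrow> x \<in> S \<Longrightarrow> f differentiable (at x)"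
  unfolding smooth_on_def by (metis Ck_on.simps(2))

lemma smooth_on_imp_continuous_on: "smooth_on S f \<Longrightarrow> continuous_on S f"
  unfolding smooth_on_def by (metis Ck_on.simps(1))

lemma smooth_on_has_derivative:
  "smooth_on S f \<Longrightarrow> x \<in> S \<Longrightarrow> (f has_derivative frechet_derivative f (at x)) (at x)"
  using smooth_on_imp_differentiable frechet_derivative_works by blast

lemma Ck_on_exp: "Ck_on k S (exp :: real \<Rightarrow> real)"
proof -
  \<comment> \<open>A constant factor is carried along because differentiation in direction v
    multiplies by v; this keeps the family closed.\<close>
  have "Ck_on k UNIV (\<lambda>x. c * exp x)" for c :: real
  proof (induction k arbitrary: c)
    case 0
    then show ?case by (simp add: continuous_intros)
  next
    case (Suc k)
    have der: "((\<lambda>x. c * exp x) has_derivative (\<lambda>v. v * (c * exp x))) (at x)" for x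
      by (auto intro!: derivative_eq_intros)
    have "(\<lambda>x. frechet_derivative (\<lambda>x. c * exp x) (at x) v) = (\<lambda>x. (v * c) * exp x)" for v
      using frechet_derivative_eqI[OF der] by (auto simp: fun_eq_iff)
    then show ?case using Suc der by (auto simp: differentiable_def)
  qed
  from this[of 1] show ?thesis by (auto intro: Ck_on_subset)
qed

lemma smooth_on_exp: "open S \<Longrightarrow> smooth_on S f \<Longrightarrow> smooth_on S (\<lambda>x. exp (f x :: real))"
  by (rule smooth_on_compose[of S f UNIV exp]) (auto simp: smooth_on_def Ck_on_exp)

section \<open>Smooth functions and tangent vectors on manifolds\<close>

context
  fixes A :: "('p::{t2_space,second_countable_topology}, 'e::euclidean_space) chart set"
  assumes A: "smooth_atlas A"
begin

lemma atlas_cover: "\<exists>c\<in>A. q \<in> fst c"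
  using A unfolding smooth_atlas_def by (metis UNIV_I UN_E)

lemma chart_open: "c \<in> A \<Longrightarrow> open (fst c)" "c \<in> A \<Longrightarrow> open (snd c ` fst c)"
  using A unfolding smooth_atlas_def by auto

lemma chart_homeomorphism: "c \<in> A \<Longrightarrow> homeomorphism (fst c) (snd c ` fst c) (snd c) (chart_inv c)"
  using A unfolding smooth_atlas_def by auto

lemma chart_inv_left: "c \<in> A \<Longrightarrow> q \<in> fst c \<Longrightarrow> chart_inv c (snd c q) = q"
  using chart_homeomorphism unfolding homeomorphism_def by blast

lemma chart_inv_right:
  "x \<in> snd c ` fst c \<Longrightarrow> snd c (chart_inv c x) = x"
  "x \<in> snd c ` fst c \<Longrightarrow> chart_inv c x \<in> fst c"
  by (auto simp: chart_inv_def f_inv_into_f inv_into_into)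

lemma chart_transition:
  "c \<in> A \<Longrightarrow> d \<in> A \<Longrightarrow> smooth_on (snd c ` (fst c \<inter> fst d)) (snd d \<circ> chart_inv c)"
  using A unfolding smooth_atlas_def by auto

lemma open_chart_image:
  assumes "c \<in> A" "open V" "V \<subseteq> fst c"
  shows "open (snd c ` V)"
proof -
  have "openin (top_of_set (snd c ` fst c)) (snd c ` V)"
    using homeomorphism_imp_open_map[OF chart_homeomorphism[OF assms(1)]] assms
      open_subset by blast
  then show ?thesis
    using chart_open(2)[OF assms(1)] openin_open_trans by blast
qed

lemma open_chart_inv_image:
  assumes "c \<in> A" "open T" "T \<subseteq> snd c ` fst c"
  shows "open (chart_inv c ` T)"
proof -
  have "openin (top_of_set (fst c)) (chart_inv c ` T)"
    using homeomorphism_imp_open_map[OF homeomorphism_symD[OF chart_homeomorphism[OF assms(1)]]]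
      assms open_subset by blast
  then show ?thesis
    using chart_open(1)[OF assms(1)] openin_open_trans by blast
qed

text \<open>One chart decides: in any other chart the function is the given local expression
  composed with a smooth transition map. Smoothness at a point can thus be checked in a convenient
  chart.\<close>

lemma smooth_at_chartI:
  assumes "c \<in> A" "q \<in> fst c" "open T" "snd c q \<in> T" "T \<subseteq> snd c ` fst c"
    and "smooth_on T (F \<circ> chart_inv c)"
  shows "smooth_at A q F"
proof -
  define W where "W = chart_inv c ` T"
  have W: "open W" "q \<in> W" "W \<subseteq> fst c" "snd c ` W \<subseteq> T"
  proof -
    show "open W" using assms open_chart_inv_image by (simp add: W_def)
    show "q \<in> W" using assms chart_inv_left[of c q] by (force simp: W_def)
    show "W \<subseteq> fst c" "snd c ` W \<subseteq> T"
      using assms(5) chart_inv_right[of _ c] by (auto simp: W_def subset_iff)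
  qed
  have "smooth_on (snd d ` (fst d \<inter> W)) (F \<circ> chart_inv d)" if d: "d \<in> A" for d
  proof -
    have op: "open (snd d ` (fst d \<inter> W))"
      using open_chart_image[OF d] W(1) chart_open(1)[OF d] by auto
    have tr: "smooth_on (snd d ` (fst d \<inter> W)) (snd c \<circ> chart_inv d)"
      by (rule smooth_on_subset[OF chart_transition[OF d assms(1)]]) (use W in auto)
    have inT: "(snd c \<circ> chart_inv d) ` (snd d ` (fst d \<inter> W)) \<subseteq> T"
      using W chart_inv_left[OF d] by auto
    show ?thesis
      by (rule smooth_on_cong[OF op smooth_on_compose[OF op tr assms(6) inT]])
        (use W chart_inv_left[OF d] chart_inv_left[OF assms(1)] in auto)
  qed
  then show ?thesis
    using W unfolding smooth_at_def smooth_fun_def by blast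
qed

lemma smooth_at_chartD:
  assumes "smooth_at A q F" "c \<in> A" "q \<in> fst c"
  obtains T where "open T" "snd c q \<in> T" "T \<subseteq> snd c ` fst c" "smooth_on T (F \<circ> chart_inv c)"
proof -
  obtain W where W: "q \<in> W" "open W" "smooth_on (snd c ` (fst c \<inter> W)) (F \<circ> chart_inv c)"
    using assms unfolding smooth_at_def smooth_fun_def by blast
  show ?thesis
    by (rule that[of "snd c ` (fst c \<inter> W)"])
      (use W assms chart_open(1)[OF assms(2)] in \<open>auto intro!: open_chart_image\<close>)
qed

lemma smooth_fun_iff: "smooth_fun A W F \<longleftrightarrow> open W \<and> (\<forall>q\<in>W. smooth_at A q F)"
proof
  assume R: "open W \<and> (\<forall>q\<in>W. smooth_at A q F)"
  have "smooth_on (snd c ` (fst c \<inter> W)) (F \<circ> chart_inv c)" if c: "c \<in> A" for c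
  proof (rule smooth_on_local)
    fix x assume "x \<in> snd c ` (fst c \<inter> W)"
    then obtain q where q: "x = snd c q" "q \<in> fst c" "q \<in> W" by blast
    then have "smooth_at A q F" using R by blast
    from smooth_at_chartD[OF this c q(2)]
    show "\<exists>T. open T \<and> x \<in> T \<and> smooth_on T (F \<circ> chart_inv c)"
      unfolding q(1) by metis
  qed
  with R show "smooth_fun A W F" by (simp add: smooth_fun_def)
qed (auto simp: smooth_at_def smooth_fun_def)

lemma smooth_at_cong:
  assumes "smooth_at A q F" "open U" "q \<in> U" "\<And>p. p \<in> U \<Longrightarrow> F p = G p"
  shows "smooth_at A q G"
proof -
  obtain W where W: "q \<in> W" "smooth_fun A W F"
    using assms unfolding smooth_at_def by blast
  have "smooth_fun A (W \<inter> U) G"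
    unfolding smooth_fun_def
  proof (intro conjI ballI)
    show "open (W \<inter> U)" using W assms by (auto simp: smooth_fun_def)
    fix c assume c: "c \<in> A"
    show "smooth_on (snd c ` (fst c \<inter> (W \<inter> U))) (G \<circ> chart_inv c)"
    proof (rule smooth_on_cong)
      show "open (snd c ` (fst c \<inter> (W \<inter> U)))"
        using \<open>open (W \<inter> U)\<close> c chart_open(1)[OF c] by (intro open_chart_image) auto
      show "smooth_on (snd c ` (fst c \<inter> (W \<inter> U))) (F \<circ> chart_inv c)"
        using W c unfolding smooth_fun_def by (auto intro: smooth_on_subset)
    qed (use chart_inv_left[OF c] assms(4) in auto)
  qed
  then show ?thesis using W assms unfolding smooth_at_def by blast
qed

lemma smooth_at_cong_iff:
  assumes "open U" "q \<in> U" "\<And>p. p \<in> U \<Longrightarrow> F p = G p"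
  shows "smooth_at A q F \<longleftrightarrow> smooth_at A q G"
  using smooth_at_cong[of q F U G] smooth_at_cong[of q G U F] assms by auto

lemma smooth_at_const: "smooth_at A q (\<lambda>p. r)"
  unfolding smooth_at_def smooth_fun_def by (rule exI[of _ UNIV]) (auto simp: comp_def)

lemma smooth_at_binop:
  assumes "smooth_at A q F" "smooth_at A q G"
    and "\<And>S f g. open S \<Longrightarrow> smooth_on S f \<Longrightarrow> smooth_on S g \<Longrightarrow> smooth_on S (\<lambda>x::'e. h (f x) (g x))"
  shows "smooth_at A q (\<lambda>p. h (F p) (G p))"
proof -
  obtain c where c: "c \<in> A" "q \<in> fst c" using atlas_cover by blast
  obtain S where S: "open S" "snd c q \<in> S" "S \<subseteq> snd c ` fst c" "smooth_on S (F \<circ> chart_inv c)"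
    using smooth_at_chartD[OF assms(1) c] by blast
  obtain T where T: "open T" "snd c q \<in> T" "T \<subseteq> snd c ` fst c" "smooth_on T (G \<circ> chart_inv c)"
    using smooth_at_chartD[OF assms(2) c] by blast
  have "smooth_on (S \<inter> T) (\<lambda>x. h ((F \<circ> chart_inv c) x) ((G \<circ> chart_inv c) x))"
    using S(1) T(1) smooth_on_subset[OF S(4), of "S \<inter> T"] smooth_on_subset[OF T(4), of "S \<inter> T"]
    by (intro assms(3)) (auto simp: comp_def)
  then show ?thesis
    using S T by (intro smooth_at_chartI[OF c, of "S \<inter> T"]) (auto simp: comp_def)
qed

lemma smooth_at_add: "smooth_at A q F \<Longrightarrow> smooth_at A q G \<Longrightarrow> smooth_at A q (\<lambda>p. F p + G p)"
  by (rule smooth_at_binop) (auto intro: smooth_on_add)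

lemma smooth_at_diff: "smooth_at A q F \<Longrightarrow> smooth_at A q G \<Longrightarrow> smooth_at A q (\<lambda>p. F p - G p)"
  by (rule smooth_at_binop) (auto intro: smooth_on_diff)

lemma smooth_at_mult: "smooth_at A q F \<Longrightarrow> smooth_at A q G \<Longrightarrow> smooth_at A q (\<lambda>p. F p * G p)"
  by (rule smooth_at_binop) (auto intro: smooth_on_mult)

lemma smooth_at_exp: "smooth_at A q F \<Longrightarrow> smooth_at A q (\<lambda>p. exp (F p))"
  \<comment> \<open>The unary operation is treated as a binary one that ignores its second
    argument.\<close>
  by (rule smooth_at_binop[where G = F]) (auto intro: smooth_on_exp)

lemma smooth_at_sum:
  "finite I \<Longrightarrow> (\<And>i. i \<in> I \<Longrightarrow> smooth_at A q (F i)) \<Longrightarrow> smooth_at A q (\<lambda>p. \<Sum>i\<in>I. F i p)"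
  by (induction I rule: finite_induct) (auto intro: smooth_at_const smooth_at_add)

lemma smooth_at_coordinate:
  assumes "c \<in> A" "q \<in> fst c"
  shows "smooth_at A q (\<lambda>p. snd c p \<bullet> i)"
proof (rule smooth_at_chartI[OF assms chart_open(2)])
  show "smooth_on (snd c ` fst c) ((\<lambda>p. snd c p \<bullet> i) \<circ> chart_inv c)"
    by (rule smooth_on_cong[OF chart_open(2) smooth_on_bounded_linear[OF bounded_linear_inner_left[of i]]])
      (use assms chart_inv_left[OF assms(1)] in auto)
qed (use assms in auto)

lemma smooth_at_differentiable:
  assumes "smooth_at A q F" "c \<in> A" "q \<in> fst c"
  shows "(F \<circ> chart_inv c) differentiable (at (snd c q))"
  using smooth_at_chartD[OF assms] smooth_on_imp_differentiable by metis

section \<open>Tangent vectors in charts\<close>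

lemma app_coord_vec:
  "smooth_at A q F \<Longrightarrow>
    app (coord_vec A c q u) F = frechet_derivative (F \<circ> chart_inv c) (at (snd c q)) u"
  by (simp add: coord_vec_def)

lemma app_tangent_nonsmooth:
  "v \<in> tangent_space A q \<Longrightarrow> \<not> smooth_at A q F \<Longrightarrow> app v F = 0"
  by (auto simp: tangent_space_def coord_vec_def)

lemma coord_vec_add:
  assumes "c \<in> A" "q \<in> fst c"
  shows "coord_vec A c q (u + w) = coord_vec A c q u + coord_vec A c q w"
  using linear_add[OF linear_frechet_derivative[OF smooth_at_differentiable[OF _ assms]]]
  by (auto intro!: tvec_eqI simp: coord_vec_def plus_tvec_def)

lemma coord_vec_scaleR:
  assumes "c \<in> A" "q \<in> fst c"
  shows "coord_vec A c q (r *\<^sub>R u) = r *\<^sub>R coord_vec A c q u"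
  using linear_scale[OF linear_frechet_derivative[OF smooth_at_differentiable[OF _ assms]]]
  by (auto intro!: tvec_eqI simp: coord_vec_def scaleR_tvec_def)

lemma linear_coord_vec: "c \<in> A \<Longrightarrow> q \<in> fst c \<Longrightarrow> linear (coord_vec A c q)"
  by (intro linearI coord_vec_add coord_vec_scaleR)

text \<open>Chain rule for the transition map. On functions not smooth at \<open>q\<close> both
  sides are 0 by convention, so the operators agree on all arguments, and a single chart already
  yields the whole tangent space.\<close>

lemma coord_vec_change:
  assumes "c \<in> A" "d \<in> A" "q \<in> fst c" "q \<in> fst d"
  shows "coord_vec A c q u =
    coord_vec A d q (frechet_derivative (snd d \<circ> chart_inv c) (at (snd c q)) u)"
proof (rule tvec_eqI)
  fix F
  show "app (coord_vec A c q u) F =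
    app (coord_vec A d q (frechet_derivative (snd d \<circ> chart_inv c) (at (snd c q)) u)) F"
  proof (cases "smooth_at A q F")
    case True
    let ?t = "snd d \<circ> chart_inv c"
    have op: "open (snd c ` (fst c \<inter> fst d))"
      using chart_open(1)[OF assms(1)] chart_open(1)[OF assms(2)] assms(1)
      by (intro open_chart_image) auto
    have t: "(?t has_derivative frechet_derivative ?t (at (snd c q))) (at (snd c q))"
      using smooth_on_has_derivative[OF chart_transition[OF assms(1,2)]] assms by blast
    have tq: "?t (snd c q) = snd d q"
      using assms by (simp add: chart_inv_left)
    have G: "((F \<circ> chart_inv d) has_derivative frechet_derivative (F \<circ> chart_inv d) (at (snd d q)))
        (at (?t (snd c q)))"
      using smooth_at_differentiable[OF True assms(2,4)] tq by (simp add: frechet_derivative_works)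
    have "((F \<circ> chart_inv c) has_derivative
        (\<lambda>u. frechet_derivative (F \<circ> chart_inv d) (at (snd d q)) (frechet_derivative ?t (at (snd c q)) u)))
        (at (snd c q))"
      by (rule has_derivative_transform_within_open[OF has_derivative_compose[OF t G] op])
        (use assms(3,4) chart_inv_left[OF assms(1)] chart_inv_left[OF assms(2)] in auto)
    from frechet_derivative_eqI[OF this] True show ?thesis by (simp add: app_coord_vec)
  qed (simp add: coord_vec_def)
qed

lemma tangent_space_chart:
  assumes "c \<in> A" "q \<in> fst c"
  shows "tangent_space A q = range (coord_vec A c q)"
proof
  show "tangent_space A q \<subseteq> range (coord_vec A c q)"
    unfolding tangent_space_def using coord_vec_change[OF _ assms(1) _ assms(2)] by blast
  show "range (coord_vec A c q) \<subseteq> tangent_space A q"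
    unfolding tangent_space_def using assms by blast
qed

lemma subspace_tangent_space: "subspace (tangent_space A q)"
proof -
  obtain c where c: "c \<in> A" "q \<in> fst c" using atlas_cover by blast
  show ?thesis
    unfolding tangent_space_chart[OF c]
    using linear_subspace_image[OF linear_coord_vec[OF c] subspace_UNIV] .
qed

text \<open>A tangent vector sees only the germ of its argument. This includes the default value 0,
  since smoothness at \<open>q\<close> is itself a property of the germ.\<close>

lemma app_tangent_cong:
  assumes "v \<in> tangent_space A q" "open U" "q \<in> U" "\<And>p. p \<in> U \<Longrightarrow> F p = G p"
  shows "app v F = app v G"
proof (cases "smooth_at A q F")
  case True
  obtain c u where c: "c \<in> A" "q \<in> fst c" and v: "v = coord_vec A c q u"
    using assms(1) unfolding tangent_space_def by blast
  have G: "smooth_at A q G" using True smooth_at_cong assms by blast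
  have "frechet_derivative (F \<circ> chart_inv c) (at (snd c q)) =
      frechet_derivative (G \<circ> chart_inv c) (at (snd c q))"
  proof (rule frechet_derivative_transform_within_open)
    show "open (snd c ` (fst c \<inter> U))"
      using assms chart_open(1)[OF c(1)] by (intro open_chart_image[OF c(1)]) auto
  qed (use c assms chart_inv_left[OF c(1)] smooth_at_differentiable[OF True c] in auto)
  then show ?thesis using True G v by (simp add: app_coord_vec)
next
  case False
  then have "\<not> smooth_at A q G" using smooth_at_cong_iff assms by blast
  with False show ?thesis using app_tangent_nonsmooth assms(1) by metis
qed

lemma app_tangent_const: "v \<in> tangent_space A q \<Longrightarrow> app v (\<lambda>p. r) = 0"
  by (auto simp: tangent_space_def coord_vec_def comp_def)

text \<open>Coordinate functions recover the components of a vector. This gives uniqueness of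
  components here and, later, smoothness of the components of a field.\<close>

lemma app_coord_vec_coordinate:
  assumes "c \<in> A" "q \<in> fst c"
  shows "app (coord_vec A c q u) (\<lambda>p. snd c p \<bullet> i) = u \<bullet> i"
proof -
  have op: "open (snd c ` fst c)" using assms chart_open by blast
  have "(((\<lambda>p. snd c p \<bullet> i) \<circ> chart_inv c) has_derivative (\<lambda>u. u \<bullet> i)) (at (snd c q))"
    by (rule has_derivative_transform_within_open[OF _ op, where f = "\<lambda>x. x \<bullet> i"])
      (use assms chart_inv_left[OF assms(1)] in \<open>auto intro!: derivative_eq_intros\<close>)
  then show ?thesis
    using smooth_at_coordinate[OF assms] by (simp add: app_coord_vec frechet_derivative_eqI)
qed

lemma coord_vec_inject:
  assumes "c \<in> A" "q \<in> fst c"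
  shows "coord_vec A c q u = coord_vec A c q w \<longleftrightarrow> u = w"
  by (metis assms app_coord_vec_coordinate euclidean_eqI)

section \<open>Vector fields and their brackets\<close>

lemma vector_field_tangent: "vector_field A W X \<Longrightarrow> q \<in> W \<Longrightarrow> X q \<in> tangent_space A q"
  by (simp add: vector_field_def)

lemma vector_field_smooth_at:
  assumes "vector_field A W X" "q \<in> W" "smooth_at A q F"
  shows "smooth_at A q (\<lambda>p. app (X p) F)"
proof -
  obtain V where "q \<in> V" "smooth_fun A V F" using assms unfolding smooth_at_def by blast
  then have "smooth_fun A (V \<inter> W) F" "q \<in> V \<inter> W"
    using assms smooth_fun_iff unfolding vector_field_def by auto
  then show ?thesis
    using assms(1) unfolding vector_field_def smooth_at_def by (meson inf_le2)
qed

lemma vector_fieldI: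
  assumes "open W" "\<And>q. q \<in> W \<Longrightarrow> X q \<in> tangent_space A q"
    and "\<And>q F. q \<in> W \<Longrightarrow> smooth_at A q F \<Longrightarrow> smooth_at A q (\<lambda>p. app (X p) F)"
  shows "vector_field A W X"
  using assms unfolding vector_field_def smooth_fun_iff by blast

text \<open>Tangency of the bracket is a hypothesis: for horizontal lifts it can be read off from
  the expansion in the adapted frame, which replaces the cancellation of second derivatives.\<close>

lemma vector_field_lie_bracket:
  assumes "vector_field A W X" "vector_field A W Y"
    and "\<And>q. q \<in> W \<Longrightarrow> lie_bracket A X Y q \<in> tangent_space A q"
  shows "vector_field A W (lie_bracket A X Y)"
proof (rule vector_fieldI)
  show W: "open W" using assms by (simp add: vector_field_def)
  fix q F assume q: "q \<in> W" and F: "smooth_at A q F"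
  obtain V where V: "q \<in> V" "open V" "\<And>p. p \<in> V \<Longrightarrow> smooth_at A p F"
    using F smooth_fun_iff unfolding smooth_at_def[of A q] by blast
  show "smooth_at A q (\<lambda>p. app (lie_bracket A X Y p) F)"
    by (rule smooth_at_cong[OF smooth_at_diff[OF
          vector_field_smooth_at[OF assms(1) q vector_field_smooth_at[OF assms(2) q F]]
          vector_field_smooth_at[OF assms(2) q vector_field_smooth_at[OF assms(1) q F]]] V(2,1)])
      (simp add: lie_bracket_def V(3))
qed (use assms in auto)

end

section \<open>Smooth maps\<close>

context
  fixes A :: "('p::{t2_space,second_countable_topology}, 'e::euclidean_space) chart set"
    and B :: "('r::{t2_space,second_countable_topology}, 'f::euclidean_space) chart set"
    and W :: "'p set" and f :: "'p \<Rightarrow> 'r"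
  assumes A: "smooth_atlas A" and B: "smooth_atlas B" and f: "smooth_map A B W f"
begin

lemma smooth_map_chart_open:
  assumes "c \<in> A" "d \<in> B"
  shows "open (snd c ` (fst c \<inter> W \<inter> f -` fst d))"
proof (rule open_chart_image[OF A assms(1)])
  have "open (W \<inter> f -` fst d)"
    using f chart_open(1)[OF B assms(2)] continuous_open_preimage unfolding smooth_map_def by blast
  then show "open (fst c \<inter> W \<inter> f -` fst d)"
    using chart_open(1)[OF A assms(1)] by (simp add: Int_assoc open_Int)
qed auto

lemma smooth_map_chart_smooth:
  "c \<in> A \<Longrightarrow> d \<in> B \<Longrightarrow> smooth_on (snd c ` (fst c \<inter> W \<inter> f -` fst d)) (snd d \<circ> f \<circ> chart_inv c)"
  using f unfolding smooth_map_def by blast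

lemma smooth_at_compose:
  assumes "q \<in> W" "smooth_at B (f q) F"
  shows "smooth_at A q (F \<circ> f)"
proof -
  obtain c d where c: "c \<in> A" "q \<in> fst c" and d: "d \<in> B" "f q \<in> fst d"
    using atlas_cover[OF A] atlas_cover[OF B] by meson
  obtain T where T: "open T" "snd d (f q) \<in> T" "T \<subseteq> snd d ` fst d" "smooth_on T (F \<circ> chart_inv d)"
    using smooth_at_chartD[OF B assms(2) d] by blast
  let ?S = "snd c ` (fst c \<inter> W \<inter> f -` fst d)" and ?g = "snd d \<circ> f \<circ> chart_inv c"
  define S' where "S' = ?S \<inter> ?g -` T"
  have S': "open S'"
    unfolding S'_def using smooth_on_imp_continuous_on[OF smooth_map_chart_smooth[OF c(1) d(1)]]
      smooth_map_chart_open[OF c(1) d(1)] T(1)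
    by (rule continuous_open_preimage)
  have "smooth_on S' (\<lambda>x. (F \<circ> chart_inv d) (?g x))"
    by (rule smooth_on_compose[OF S' smooth_on_subset[OF smooth_map_chart_smooth[OF c(1) d(1)]] T(4)])
      (auto simp: S'_def)
  then have "smooth_on S' (F \<circ> f \<circ> chart_inv c)"
    by (rule smooth_on_cong[OF S'])
      (auto simp: S'_def chart_inv_left[OF A c(1)] chart_inv_left[OF B d(1)])
  then show ?thesis
    using S' T c d assms
    by (intro smooth_at_chartI[OF A c, of S']) (auto simp: S'_def chart_inv_left[OF A c(1)])
qed

text \<open>Chain rule in charts. Smoothness of the map makes pullbacks of smooth functions smooth,
  so the default value 0 of the inner vector is not met on them.\<close>

lemma push_coord_vec:
  assumes "q \<in> W" "c \<in> A" "q \<in> fst c" "d \<in> B" "f q \<in> fst d"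
  shows "push A B f q (coord_vec A c q u) =
    coord_vec B d (f q) (frechet_derivative (snd d \<circ> f \<circ> chart_inv c) (at (snd c q)) u)"
proof (rule tvec_eqI)
  fix F
  show "app (push A B f q (coord_vec A c q u)) F =
    app (coord_vec B d (f q) (frechet_derivative (snd d \<circ> f \<circ> chart_inv c) (at (snd c q)) u)) F"
  proof (cases "smooth_at B (f q) F")
    case True
    let ?t = "snd d \<circ> f \<circ> chart_inv c"
    have t: "(?t has_derivative frechet_derivative ?t (at (snd c q))) (at (snd c q))"
      using smooth_on_has_derivative[OF smooth_map_chart_smooth[OF assms(2,4)]] assms by blast
    have tq: "?t (snd c q) = snd d (f q)"
      using assms by (simp add: chart_inv_left[OF A])
    have G: "((F \<circ> chart_inv d) has_derivative frechet_derivative (F \<circ> chart_inv d) (at (snd d (f q))))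
        (at (?t (snd c q)))"
      using smooth_at_differentiable[OF B True assms(4,5)] tq by (simp add: frechet_derivative_works)
    have "((F \<circ> f \<circ> chart_inv c) has_derivative
        (\<lambda>u. frechet_derivative (F \<circ> chart_inv d) (at (snd d (f q)))
          (frechet_derivative ?t (at (snd c q)) u))) (at (snd c q))"
      by (rule has_derivative_transform_within_open[OF has_derivative_compose[OF t G]
            smooth_map_chart_open[OF assms(2,4)]])
        (use assms chart_inv_left[OF A assms(2)] chart_inv_left[OF B assms(4)] in auto)
    from frechet_derivative_eqI[OF this] True show ?thesis
      using smooth_at_compose[OF assms(1) True]
      by (simp add: push_def app_coord_vec[OF B] app_coord_vec[OF A])
  qed (simp add: push_def coord_vec_def)
qed

lemma push_tangent:
  assumes "q \<in> W" "v \<in> tangent_space A q"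
  shows "push A B f q v \<in> tangent_space B (f q)"
proof -
  obtain d where d: "d \<in> B" "f q \<in> fst d" using atlas_cover[OF B] by blast
  show ?thesis
    using assms push_coord_vec[OF assms(1) _ _ d] d unfolding tangent_space_def by blast
qed

end

section \<open>Linearity and functoriality of the differential\<close>

lemma app_push: "smooth_at B (f q) F \<Longrightarrow> app (push A B f q v) F = app v (F \<circ> f)"
  by (simp add: push_def)

lemma push_add: "push A B f q (v + w) = push A B f q v + push A B f q w"
  by (auto intro!: tvec_eqI simp: push_def plus_tvec_def)

lemma push_diff: "push A B f q (v - w) = push A B f q v - push A B f q w"
  by (auto intro!: tvec_eqI simp: push_def minus_tvec_def)

lemma push_scaleR: "push A B f q (r *\<^sub>R v) = r *\<^sub>R push A B f q v"
  by (auto intro!: tvec_eqI simp: push_def scaleR_tvec_def)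

lemma linear_push: "linear (push A B f q)"
  by (intro linearI push_add push_scaleR)

text \<open>Smoothness of \<open>g\<close> ensures that a smooth function composed with
  \<open>g\<close> passes the smoothness test built into the inner \<open>push\<close>.\<close>

lemma push_compose:
  assumes "smooth_atlas B" "smooth_atlas D" "smooth_map B D V g" "f q \<in> V"
  shows "push B D g (f q) (push A B f q v) = push A D (g \<circ> f) q v"
  by (rule tvec_eqI)
    (auto simp: push_def comp_assoc smooth_at_compose[OF assms])

lemma push_const_map:
  "smooth_atlas A \<Longrightarrow> v \<in> tangent_space A q \<Longrightarrow> push A B (\<lambda>p. r) q v = 0"
  by (rule tvec_eqI) (auto simp: push_def zero_tvec_def comp_def app_tangent_const)

section \<open>Restriction of maps on a product to slices\<close>

lemma chart_inv_prod:
  assumes "smooth_atlas A" "smooth_atlas B" "c \<in> A" "d \<in> B" "p \<in> fst c" "r \<in> fst d"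
  shows "chart_inv (fst c \<times> fst d, map_prod (snd c) (snd d)) (snd c p, snd d r) = (p, r)"
proof -
  have "inj_on (map_prod (snd c) (snd d)) (fst c \<times> fst d)"
    using chart_inv_left[OF assms(1,3)] chart_inv_left[OF assms(2,4)]
    by (auto intro!: map_prod_inj_on inj_on_inverseI[of _ "chart_inv c"] inj_on_inverseI[of _ "chart_inv d"])
  from inv_into_f_f[OF this, of "(p, r)"] show ?thesis
    using assms by (simp add: chart_inv_def)
qed

text \<open>Serves both the orbit maps of the action and, with \<open>U\<close> a trivialising open
  set, the local sections of the bundle. In charts the slice is an affine embedding.\<close>

lemma smooth_map_slice_left:
  assumes "smooth_atlas A" "smooth_atlas B" "smooth_atlas D"
    and g: "smooth_map (prod_atlas A B) D (U \<times> UNIV) g" and "open U"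
  shows "smooth_map A D U (\<lambda>p. g (p, b))"
  unfolding smooth_map_def
proof (intro conjI ballI \<open>open U\<close>)
  show cont: "continuous_on U (\<lambda>p. g (p, b))"
    by (rule continuous_on_compose2[of "U \<times> UNIV" g U "\<lambda>p. (p, b)"])
      (use g in \<open>auto simp: smooth_map_def intro!: continuous_on_Pair continuous_on_id continuous_on_const\<close>)
  fix c e assume c: "c \<in> A" and e: "e \<in> D"
  obtain d where d: "d \<in> B" "b \<in> fst d" using atlas_cover[OF assms(2)] by blast
  let ?cd = "(fst c \<times> fst d, map_prod (snd c) (snd d))"
  let ?S = "snd c ` (fst c \<inter> U \<inter> (\<lambda>p. g (p, b)) -` fst e)"
  let ?T = "snd ?cd ` (fst ?cd \<inter> (U \<times> UNIV) \<inter> g -` fst e)"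
  have op: "open ?S"
  proof (rule open_chart_image[OF assms(1) c])
    have "open (U \<inter> (\<lambda>p. g (p, b)) -` fst e)"
      using cont \<open>open U\<close> chart_open(1)[OF assms(3) e] continuous_open_preimage by blast
    then show "open (fst c \<inter> U \<inter> (\<lambda>p. g (p, b)) -` fst e)"
      using chart_open(1)[OF assms(1) c] by (simp add: Int_assoc open_Int)
  qed auto
  have sm: "smooth_on ?T (snd e \<circ> g \<circ> chart_inv ?cd)"
    using g c d e unfolding smooth_map_def prod_atlas_def by blast
  have aff: "smooth_on ?S (\<lambda>x. (x, snd d b))"
    using smooth_on_add[OF op smooth_on_bounded_linear[of "\<lambda>x. (x, 0)" ?S]
        smooth_on_const[of ?S "(0, snd d b)"]]
    by (simp add: bounded_linear_Pair)
  have inT: "(\<lambda>x. (x, snd d b)) ` ?S \<subseteq> ?T"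
    using d by force
  show "smooth_on ?S (snd e \<circ> (\<lambda>p. g (p, b)) \<circ> chart_inv c)"
    by (rule smooth_on_cong[OF op smooth_on_compose[OF op aff sm inT]])
      (use d chart_inv_left[OF assms(1) c] chart_inv_prod[OF assms(1,2) c d(1) _ d(2)] in auto)
qed

lemma smooth_map_slice_right:
  assumes "smooth_atlas A" "smooth_atlas B" "smooth_atlas D"
    and g: "smooth_map (prod_atlas A B) D UNIV g"
  shows "smooth_map B D UNIV (\<lambda>p. g (a, p))"
  unfolding smooth_map_def
proof (intro conjI ballI open_UNIV)
  show cont: "continuous_on UNIV (\<lambda>p. g (a, p))"
    by (rule continuous_on_compose2[of UNIV g UNIV "\<lambda>p. (a, p)"])
      (use g in \<open>auto simp: smooth_map_def intro!: continuous_on_Pair continuous_on_id continuous_on_const\<close>)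
  fix c e assume c: "c \<in> B" and e: "e \<in> D"
  obtain d where d: "d \<in> A" "a \<in> fst d" using atlas_cover[OF assms(1)] by blast
  let ?cd = "(fst d \<times> fst c, map_prod (snd d) (snd c))"
  let ?S = "snd c ` (fst c \<inter> UNIV \<inter> (\<lambda>p. g (a, p)) -` fst e)"
  let ?T = "snd ?cd ` (fst ?cd \<inter> UNIV \<inter> g -` fst e)"
  have op: "open ?S"
  proof (rule open_chart_image[OF assms(2) c])
    have "open ((\<lambda>p. g (a, p)) -` fst e)"
      using cont chart_open(1)[OF assms(3) e] open_vimage by blast
    then show "open (fst c \<inter> UNIV \<inter> (\<lambda>p. g (a, p)) -` fst e)"
      using chart_open(1)[OF assms(2) c] by (simp add: open_Int)
  qed auto
  have sm: "smooth_on ?T (snd e \<circ> g \<circ> chart_inv ?cd)"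
    using g c d e unfolding smooth_map_def prod_atlas_def by blast
  have aff: "smooth_on ?S (\<lambda>x. (snd d a, x))"
    using smooth_on_add[OF op smooth_on_bounded_linear[of "\<lambda>x. (0, x)" ?S]
        smooth_on_const[of ?S "(snd d a, 0)"]]
    by (simp add: bounded_linear_Pair)
  have inT: "(\<lambda>x. (snd d a, x)) ` ?S \<subseteq> ?T"
    using d by force
  show "smooth_on ?S (snd e \<circ> (\<lambda>p. g (a, p)) \<circ> chart_inv c)"
    by (rule smooth_on_cong[OF op smooth_on_compose[OF op aff sm inT]])
      (use d chart_inv_left[OF assms(2) c] chart_inv_prod[OF assms(1,2) d(1) c d(2)] in auto)
qed

section \<open>Reparametrization of integral curves\<close>

lemma open_interval_antiderivative:
  fixes w :: "real \<Rightarrow> real"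
  assumes J: "open_interval J" and w: "continuous_on J w"
  obtains \<phi> where "\<And>t. t \<in> J \<Longrightarrow> (\<phi> has_real_derivative w t) (at t)"
proof -
  obtain t0 where t0: "t0 \<in> J" using J by (auto simp: open_interval_def)
  \<comment> \<open>The signed integral from \<open>t0\<close> to \<open>t\<close>: the interval
    with reversed ends is empty and contributes 0.\<close>
  define \<phi> where "\<phi> t = integral {t0..t} w - integral {t..t0} w" for t
  have "(\<phi> has_real_derivative w t) (at t)" if t: "t \<in> J" for t
  proof -
    have "min t t0 \<in> J" "max t t0 \<in> J" using t t0 by (auto simp: min_def max_def)
    with J obtain e1 e2 where e: "e1 > 0" "cball (min t t0) e1 \<subseteq> J" "e2 > 0" "cball (max t t0) e2 \<subseteq> J"
      unfolding open_interval_def open_contains_cball by meson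
    \<comment> \<open>A compact interval inside \<open>J\<close> with \<open>t\<close> and
      \<open>t0\<close> in its interior. On it \<phi> is, up to a constant, the integral from the
      fixed end \<open>a\<close>, so the fundamental theorem applies.\<close>
    define a b where "a = min t t0 - e1" and "b = max t t0 + e2"
    have ab: "a < t" "t < b" "a < t0" "t0 < b" using e by (auto simp: a_def b_def)
    have "a \<in> cball (min t t0) e1" "b \<in> cball (max t t0) e2"
      using e by (auto simp: a_def b_def dist_real_def)
    then have sub: "{a..b} \<subseteq> J"
      using e J unfolding open_interval_def is_interval_1 by (meson atLeastAtMost_iff subset_eq)
    have cont: "continuous_on {a..b} w" using w sub continuous_on_subset by blast
    have int: "w integrable_on {p..r}" if "{p..r} \<subseteq> {a..b}" for p r
      using integrable_continuous_interval continuous_on_subset[OF cont that] by blast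
    have eq: "\<phi> s = integral {a..s} w - integral {a..t0} w" if "s \<in> {a<..<b}" for s
    proof (cases "t0 \<le> s")
      case True
      then have "integral {a..t0} w + integral {t0..s} w = integral {a..s} w"
        using that ab by (intro Henstock_Kurzweil_Integration.integral_combine int) auto
      moreover have "integral {s..t0} w = 0" using True by (cases "s = t0") auto
      ultimately show ?thesis by (simp add: \<phi>_def)
    next
      case False
      then have "integral {a..s} w + integral {s..t0} w = integral {a..t0} w"
        using that ab by (intro Henstock_Kurzweil_Integration.integral_combine int) auto
      then show ?thesis using False by (simp add: \<phi>_def)
    qed
    have "((\<lambda>s. integral {a..s} w) has_real_derivative w t) (at t within {a..b})"
      using cont ab by (intro integral_has_real_derivative) auto
    then have "((\<lambda>s. integral {a..s} w) has_real_derivative w t) (at t)"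
      using ab by (simp add: at_within_Icc_at)
    then have "((\<lambda>s. integral {a..s} w - integral {a..t0} w) has_real_derivative w t - 0) (at t)"
      by (intro DERIV_diff DERIV_const)
    then have "((\<lambda>s. integral {a..s} w - integral {a..t0} w) has_real_derivative w t) (at t)"
      by simp
    then show ?thesis
      by (rule has_field_derivative_transform_within_open[of _ _ _ "{a<..<b}"])
        (use ab eq in auto)
  qed
  then show ?thesis by (rule that)
qed

text \<open>The new parameter is an antiderivative of \<open>exp u\<close>, and \<open>\<tau>\<close> is its inverse.\<close>

lemma reparam_exists:
  fixes u :: "real \<Rightarrow> real"
  assumes J: "open_interval J" and u: "smooth_on J u"
  obtains I \<tau> where "orientation_preserving_reparam I J \<tau>"
    "\<And>s. s \<in> I \<Longrightarrow> (\<tau> has_real_derivative exp (- u (\<tau> s))) (at s)"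
proof -
  have "open J" using J by (simp add: open_interval_def)
  have "continuous_on J (\<lambda>t. exp (u t))"
    using smooth_on_imp_continuous_on[OF u] by (intro continuous_intros)
  then obtain \<phi> where \<phi>: "\<And>t. t \<in> J \<Longrightarrow> (\<phi> has_real_derivative exp (u t)) (at t)"
    using open_interval_antiderivative[OF J] by blast
  have cont: "continuous_on J \<phi>"
    by (intro continuous_at_imp_continuous_on ballI DERIV_isCont) (rule \<phi>)
  have less: "\<phi> s < \<phi> t" if "s \<in> J" "t \<in> J" "s < t" for s t
  proof (rule DERIV_pos_imp_increasing[OF \<open>s < t\<close>])
    fix r assume "s \<le> r" "r \<le> t"
    then have "r \<in> J" using J that unfolding open_interval_def is_interval_1 by blast
    then show "\<exists>y. (\<phi> has_real_derivative y) (at r) \<and> y > 0" using \<phi> by (meson exp_gt_zero)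
  qed
  then have inj: "inj_on \<phi> J" by (intro linorder_inj_onI') (metis less_irrefl)
  \<comment> \<open>Invariance of domain gives continuity of the inverse and, below, openness of the
    new parameter interval.\<close>
  obtain \<tau> where h: "homeomorphism J (\<phi> ` J) \<phi> \<tau>"
    using invariance_of_domain_homeomorphism[OF \<open>open J\<close> cont _ inj] by auto
  define I where "I = \<phi> ` J"
  have I: "open I" unfolding I_def by (rule invariance_of_domain[OF cont \<open>open J\<close> inj])
  have oi: "open_interval I"
    using J I connected_continuous_image[OF cont]
    unfolding open_interval_def I_def is_interval_connected_1 by auto
  have \<tau>: "\<tau> ` I = J" "\<And>s. s \<in> I \<Longrightarrow> \<phi> (\<tau> s) = s" "continuous_on I \<tau>"
    using h unfolding homeomorphism_def I_def by auto
  have der: "(\<tau> has_real_derivative exp (- u (\<tau> s))) (at s)" if s: "s \<in> I" for s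
  proof -
    obtain e where e: "e > 0" "ball s e \<subseteq> I" using I s open_contains_ball by blast
    have "(\<tau> has_real_derivative inverse (exp (u (\<tau> s)))) (at s)"
    proof (rule DERIV_inverse_function[where a = "s - e" and b = "s + e" and f = \<phi>])
      show "(\<phi> has_real_derivative exp (u (\<tau> s))) (at (\<tau> s))" using \<phi> \<tau>(1) s by blast
      show "\<phi> (\<tau> y) = y" if "s - e < y" "y < s + e" for y
        using that e by (intro \<tau>(2)) (auto simp: dist_real_def subset_iff)
      show "isCont \<tau> s" using \<tau>(3) I s continuous_on_eq_continuous_at by blast
    qed (use e in auto)
    then show ?thesis by (simp add: exp_minus)
  qed
  have sm: "smooth_on J (\<lambda>t. exp (- u t))"
    using u \<open>open J\<close> by (intro smooth_on_exp smooth_on_minus)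
  have fre: "frechet_derivative \<tau> (at s) v = exp (- u (\<tau> s)) *\<^sub>R v" if "s \<in> I" for s v
    using frechet_derivative_eqI[OF der[OF that, unfolded has_field_derivative_def]] by simp
  \<comment> \<open>Bootstrap: the derivative of \<tau> is exp (- u) composed with \<tau>, so each
    order of smoothness of \<tau> yields the next.\<close>
  have "Ck_on k I \<tau>" for k
  proof (induction k)
    case 0
    show ?case using \<tau>(3) by simp
  next
    case (Suc k)
    have "Ck_on k I (\<lambda>s. exp (- u (\<tau> s)))"
      by (rule Ck_on_compose[OF I Suc]) (use sm \<tau>(1) in \<open>auto simp: smooth_on_def\<close>)
    then have "Ck_on k I (\<lambda>s. exp (- u (\<tau> s)) *\<^sub>R v)" for v
      by (intro Ck_on_bilinear[OF bounded_bilinear_scaleR I] Ck_on_const)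
    then have "Ck_on k I (\<lambda>s. frechet_derivative \<tau> (at s) v)" for v
      by (rule Ck_on_cong[OF I]) (simp add: fre)
    then show ?case
      using der by (auto simp: real_differentiable_def)
  qed
  then have "orientation_preserving_reparam I J \<tau>"
    using oi \<tau>(1) der DERIV_imp_deriv[OF der]
    unfolding orientation_preserving_reparam_def smooth_on_def by simp
  then show ?thesis using der that by blast
qed

text \<open>Let w be the velocity in the old time and \<rho> = exp (- f) along the curve. The new
  velocity is \<rho> w and the new acceleration \<rho>^2 (Z1(w) - df(w) w), which by quadratic
  homogeneity of Z1 equals Z1(\<rho> w) - df(\<rho> w) \<rho> w. Stated for two arbitrary fields so
  that it serves both directions, with f and with - f.\<close>

lemma pregeodesic_reparam:
  fixes A :: "('p::{t2_space,second_countable_topology}, real^'m) chart set"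
    and Z1 Z2 :: "('p, 'm::finite) tfield"
  assumes A: "smooth_atlas A" and f: "smooth_fun A UNIV f"
    and quadratic: "\<And>c x v r. c \<in> A \<Longrightarrow> x \<in> snd c ` fst c \<Longrightarrow>
      snd (Z1 c (x, r *\<^sub>R v)) = r\<^sup>2 *\<^sub>R snd (Z1 c (x, v))"
    and second_order: "\<And>c x v. c \<in> A \<Longrightarrow> x \<in> snd c ` fst c \<Longrightarrow> fst (Z2 c (x, v)) = v"
      "\<And>c x v. c \<in> A \<Longrightarrow> x \<in> snd c ` fst c \<Longrightarrow> fst (Z1 c (x, v)) = v"
    and projective: "\<And>c x v. c \<in> A \<Longrightarrow> x \<in> snd c ` fst c \<Longrightarrow> snd (Z2 c (x, v)) =
      snd (Z1 c (x, v)) - frechet_derivative (f \<circ> chart_inv c) (at x) v *\<^sub>R v"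
    and curve: "base_integral_curve A Z1 J \<sigma>"
  shows "\<exists>I \<tau>. orientation_preserving_reparam I J \<tau> \<and> base_integral_curve A Z2 I (\<sigma> \<circ> \<tau>)"
proof -
  have J: "open_interval J" "open J" and \<sigma>: "continuous_on J \<sigma>"
    using curve by (auto simp: base_integral_curve_def open_interval_def)
  define K where "K c = J \<inter> \<sigma> -` fst c" for c :: "('p, real^'m) chart"
  \<comment> \<open>The logarithm of the rate ds/dt of the new time s.\<close>
  define u where "u = f \<circ> \<sigma>"
  have K: "open (K c)" if "c \<in> A" for c
    unfolding K_def using \<sigma> J(2) chart_open(1)[OF A that] by (rule continuous_open_preimage)
  have x: "smooth_on (K c) (snd c \<circ> \<sigma>)"
    "\<And>t. t \<in> K c \<Longrightarrow> ((\<lambda>s. ((snd c \<circ> \<sigma>) s, vector_derivative (snd c \<circ> \<sigma>) (at s)))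
      has_vector_derivative Z1 c ((snd c \<circ> \<sigma>) t, vector_derivative (snd c \<circ> \<sigma>) (at t))) (at t)"
    if "c \<in> A" for c
    using curve that unfolding base_integral_curve_def K_def Let_def by blast+
  have fc: "smooth_on (snd c ` fst c) (f \<circ> chart_inv c)" if "c \<in> A" for c
    using f that unfolding smooth_fun_def by auto
  have u_eq: "u t = (f \<circ> chart_inv c) ((snd c \<circ> \<sigma>) t)" if "c \<in> A" "t \<in> K c" for c t
    using that chart_inv_left[OF A that(1)] by (simp add: u_def K_def)
  have u_smooth_chart: "smooth_on (K c) u" if "c \<in> A" for c
    by (rule smooth_on_cong[OF K[OF that] smooth_on_compose[OF K[OF that] x(1)[OF that] fc[OF that]]])
      (use that u_eq in \<open>auto simp: K_def\<close>)
  have "smooth_on J u"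
  proof (rule smooth_on_local)
    fix t assume "t \<in> J"
    obtain c where "c \<in> A" "\<sigma> t \<in> fst c" using atlas_cover[OF A] by blast
    with \<open>t \<in> J\<close> show "\<exists>T. open T \<and> t \<in> T \<and> smooth_on T u"
      by (intro exI[of _ "K c"] conjI K u_smooth_chart) (auto simp: K_def)
  qed
  from reparam_exists[OF J(1) this] obtain I \<tau> where \<tau>: "orientation_preserving_reparam I J \<tau>"
    and d\<tau>: "\<And>s. s \<in> I \<Longrightarrow> (\<tau> has_real_derivative exp (- u (\<tau> s))) (at s)" by blast
  have I: "open_interval I" "open I" "smooth_on I \<tau>" "\<tau> ` I = J"
    using \<tau> by (auto simp: orientation_preserving_reparam_def open_interval_def)
  have c\<tau>: "continuous_on I \<tau>" using I(3) smooth_on_imp_continuous_on by blast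
  have "base_integral_curve A Z2 I (\<sigma> \<circ> \<tau>)"
    unfolding base_integral_curve_def Let_def
  proof (intro conjI ballI)
    show "open_interval I" by fact
    show "continuous_on I (\<sigma> \<circ> \<tau>)" 
      by (rule continuous_on_compose[OF c\<tau>]) (use \<sigma> I(4) in simp)
    fix c assume c: "c \<in> A"
    define y where "y = snd c \<circ> (\<sigma> \<circ> \<tau>)"
    define \<xi> where "\<xi> = snd c \<circ> \<sigma>"
    define \<xi>' where "\<xi>' t = vector_derivative \<xi> (at t)" for t
    define L where "L = I \<inter> (\<sigma> \<circ> \<tau>) -` fst c"
    have y_eq: "y = (\<lambda>s. \<xi> (\<tau> s))" by (auto simp: y_def \<xi>_def)
    have L_eq: "L = I \<inter> \<tau> -` K c" using I(4) by (auto simp: L_def K_def)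
    have L: "open L" unfolding L_eq using c\<tau> I(2) K[OF c] by (rule continuous_open_preimage)
    have y_smooth: "smooth_on L y"
      unfolding y_eq
      by (rule smooth_on_compose[OF L smooth_on_subset[OF I(3)] x(1)[OF c, folded \<xi>_def]])
        (auto simp: L_eq)
    show "smooth_on (I \<inter> (\<sigma> \<circ> \<tau>) -` fst c) (snd c \<circ> (\<sigma> \<circ> \<tau>))"
      using y_smooth by (simp add: y_def L_def)
    have xv: "((\<lambda>s. (\<xi> s, \<xi>' s)) has_vector_derivative Z1 c (\<xi> t, \<xi>' t)) (at t)" if "t \<in> K c" for t
      using x(2)[OF c that] by (simp add: \<xi>_def \<xi>'_def)
    have inx: "\<xi> t \<in> snd c ` fst c" if "t \<in> K c" for t
      using that by (auto simp: \<xi>_def K_def)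
    have d\<xi>: "(\<xi> has_vector_derivative \<xi>' t) (at t)"
      and d\<xi>': "(\<xi>' has_vector_derivative snd (Z1 c (\<xi> t, \<xi>' t))) (at t)" if "t \<in> K c" for t
      using bounded_linear.has_vector_derivative[OF bounded_linear_fst xv[OF that]]
        bounded_linear.has_vector_derivative[OF bounded_linear_snd xv[OF that]]
        second_order(2)[OF c inx[OF that]] by auto
    define \<rho> where "\<rho> s = exp (- u (\<tau> s))" for s
    have d\<tau>v: "(\<tau> has_vector_derivative \<rho> s) (at s)" if "s \<in> L" for s
      using d\<tau>[of s] that by (simp add: L_def \<rho>_def has_real_derivative_iff_has_vector_derivative)
    have dy: "(y has_vector_derivative \<rho> s *\<^sub>R \<xi>' (\<tau> s)) (at s)" if "s \<in> L" for s
      using vector_diff_chain_at[OF d\<tau>v[OF that] d\<xi>] that by (auto simp: y_eq L_eq comp_def)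
    define D where "D t = frechet_derivative (f \<circ> chart_inv c) (at (\<xi> t)) (\<xi>' t)" for t
    have du: "(u has_vector_derivative D t) (at t)" if t: "t \<in> K c" for t
    proof -
      have "((f \<circ> chart_inv c) has_derivative frechet_derivative (f \<circ> chart_inv c) (at (\<xi> t))) (at (\<xi> t))"
        using smooth_on_has_derivative[OF fc[OF c] inx[OF t]] .
      from vector_derivative_diff_chain_within[OF d\<xi>[OF t], of _ _ ] has_derivative_at_withinI[OF this]
      have "(((f \<circ> chart_inv c) \<circ> \<xi>) has_vector_derivative D t) (at t)"
        unfolding D_def by blast
      then show ?thesis
        by (rule has_vector_derivative_transform_within_open[OF _ K[OF c] t])
          (use u_eq[OF c] in \<open>simp add: \<xi>_def\<close>)
    qed
    \<comment> \<open>One factor \<rho> is the exponential itself, the other is the inner derivative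
      dt/ds = \<rho>.\<close>
    have d\<rho>: "(\<rho> has_real_derivative - (\<rho> s)\<^sup>2 * D (\<tau> s)) (at s)" if s: "s \<in> L" for s
    proof -
      have "\<tau> s \<in> K c" using s by (simp add: L_eq)
      from vector_diff_chain_at[OF d\<tau>v[OF s] du[OF this]]
      have "((\<lambda>s. u (\<tau> s)) has_real_derivative \<rho> s * D (\<tau> s)) (at s)"
        by (simp add: has_real_derivative_iff_has_vector_derivative comp_def)
      then have "((\<lambda>s. exp (- u (\<tau> s))) has_real_derivative - (\<rho> s)\<^sup>2 * D (\<tau> s)) (at s)"
        by (auto intro!: derivative_eq_intros simp: \<rho>_def power2_eq_square)
      then show ?thesis by (simp add: \<rho>_def[abs_def])
    qed
    fix s assume "s \<in> I \<inter> (\<sigma> \<circ> \<tau>) -` fst c"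
    then have s: "s \<in> L" and t: "\<tau> s \<in> K c" by (auto simp: L_eq L_def[symmetric])
    let ?Z = "snd (Z1 c (\<xi> (\<tau> s), \<xi>' (\<tau> s)))"
    interpret lin: linear "frechet_derivative (f \<circ> chart_inv c) (at (\<xi> (\<tau> s)))"
      using smooth_on_imp_differentiable[OF fc[OF c] inx[OF t]] by (rule linear_frechet_derivative)
    have d\<xi>\<tau>: "((\<lambda>s. \<xi>' (\<tau> s)) has_vector_derivative \<rho> s *\<^sub>R ?Z) (at s)"
      using vector_diff_chain_at[OF d\<tau>v[OF s] d\<xi>'[OF t]] by (simp add: comp_def)
    have "((\<lambda>s. \<rho> s *\<^sub>R \<xi>' (\<tau> s)) has_vector_derivative
        \<rho> s *\<^sub>R \<rho> s *\<^sub>R ?Z + (- (\<rho> s)\<^sup>2 * D (\<tau> s)) *\<^sub>R \<xi>' (\<tau> s)) (at s)"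
      using has_vector_derivative_scaleR[OF d\<rho>[OF s] d\<xi>\<tau>] by simp
    also have "\<rho> s *\<^sub>R \<rho> s *\<^sub>R ?Z + (- (\<rho> s)\<^sup>2 * D (\<tau> s)) *\<^sub>R \<xi>' (\<tau> s) =
        snd (Z2 c (y s, \<rho> s *\<^sub>R \<xi>' (\<tau> s)))"
      using inx[OF t] c
      by (simp add: y_eq projective quadratic lin.scale D_def power2_eq_square)
    finally have "((\<lambda>s. (y s, \<rho> s *\<^sub>R \<xi>' (\<tau> s))) has_vector_derivative
        Z2 c (y s, \<rho> s *\<^sub>R \<xi>' (\<tau> s))) (at s)"
    proof -
      assume *: "((\<lambda>s. \<rho> s *\<^sub>R \<xi>' (\<tau> s)) has_vector_derivative
        snd (Z2 c (y s, \<rho> s *\<^sub>R \<xi>' (\<tau> s)))) (at s)"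
      have "fst (Z2 c (y s, \<rho> s *\<^sub>R \<xi>' (\<tau> s))) = \<rho> s *\<^sub>R \<xi>' (\<tau> s)"
        using second_order(1)[OF c inx[OF t]] by (simp add: y_eq)
      then have "Z2 c (y s, \<rho> s *\<^sub>R \<xi>' (\<tau> s)) =
          (\<rho> s *\<^sub>R \<xi>' (\<tau> s), snd (Z2 c (y s, \<rho> s *\<^sub>R \<xi>' (\<tau> s))))"
        by (simp add: prod_eq_iff)
      with has_vector_derivative_Pair[OF dy[OF s] *] show ?thesis by simp
    qed
    \<comment> \<open>\<open>base_integral_curve\<close> asks for the literal
      \<open>vector_derivative\<close>. It equals \<rho> times the old velocity on the whole open
      set \<open>L\<close>, so it may be substituted under the derivative.\<close>
    then have "((\<lambda>s. (y s, vector_derivative y (at s))) has_vector_derivative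
        Z2 c (y s, vector_derivative y (at s))) (at s)"
      unfolding vector_derivative_at[OF dy[OF s]]
      by (rule has_vector_derivative_transform_within_open[OF _ L s])
        (simp add: vector_derivative_at[OF dy])
    then show "((\<lambda>s. ((snd c \<circ> (\<sigma> \<circ> \<tau>)) s, vector_derivative (snd c \<circ> (\<sigma> \<circ> \<tau>)) (at s)))
      has_vector_derivative Z2 c ((snd c \<circ> (\<sigma> \<circ> \<tau>)) s, vector_derivative (snd c \<circ> (\<sigma> \<circ> \<tau>)) (at s))) (at s)"
      by (simp add: y_def)
  qed
  with \<tau> show ?thesis by blast
qed

section \<open>Symmetric tensor fields\<close>

context
  fixes A :: "('p::{t2_space,second_countable_topology}, 'e::euclidean_space) chart set"
    and T :: "'p \<Rightarrow> 'p tvec \<Rightarrow> 'p tvec \<Rightarrow> real"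
  assumes A: "smooth_atlas A" and T: "sym_tensor_field A T"
begin

lemma tensor_sym: "u \<in> tangent_space A q \<Longrightarrow> v \<in> tangent_space A q \<Longrightarrow> T q u v = T q v u"
  using T unfolding sym_tensor_field_def by blast

text \<open>\<open>sym_tensor_field\<close> states linearity in the first argument; symmetry moves
  it to the second.\<close>

lemma tensor_scaleR:
  "u \<in> tangent_space A q \<Longrightarrow> v \<in> tangent_space A q \<Longrightarrow> T q u (r *\<^sub>R v) = r * T q u v"
  using T tensor_sym subspace_scale[OF subspace_tangent_space[OF A]]
  unfolding sym_tensor_field_def by metis

lemma tensor_add:
  "u \<in> tangent_space A q \<Longrightarrow> v \<in> tangent_space A q \<Longrightarrow> w \<in> tangent_space A q \<Longrightarrow>
    T q u (v + w) = T q u v + T q u w"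
  using T tensor_sym subspace_add[OF subspace_tangent_space[OF A]]
  unfolding sym_tensor_field_def by metis

lemma tensor_sum:
  assumes u: "u \<in> tangent_space A q" and "finite I" "\<And>i. i \<in> I \<Longrightarrow> v i \<in> tangent_space A q"
  shows "T q u (\<Sum>i\<in>I. r i *\<^sub>R v i) = (\<Sum>i\<in>I. r i * T q u (v i))"
  using assms(2,3)
proof (induction I rule: finite_induct)
  case empty
  have "0 \<in> tangent_space A q" by (rule subspace_0[OF subspace_tangent_space[OF A]])
  from tensor_scaleR[OF u this, of 0] show ?case by simp
next
  case (insert i I)
  have "(\<Sum>i\<in>I. r i *\<^sub>R v i) \<in> tangent_space A q"
    using insert by (intro subspace_sum subspace_scale subspace_tangent_space[OF A]) auto
  then show ?case
    using insert u by (simp add: tensor_add tensor_scaleR subspace_scale[OF subspace_tangent_space[OF A]])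
qed

lemma tensor_sum_sum:
  assumes "finite I" "\<And>i. i \<in> I \<Longrightarrow> v i \<in> tangent_space A q"
  shows "T q (\<Sum>i\<in>I. r i *\<^sub>R v i) (\<Sum>i\<in>I. s i *\<^sub>R v i) =
    (\<Sum>i\<in>I. \<Sum>j\<in>I. T q (v i) (v j) * r i * s j)"
proof -
  have sum: "(\<Sum>i\<in>I. r i *\<^sub>R v i) \<in> tangent_space A q" for r
    using assms by (intro subspace_sum subspace_scale subspace_tangent_space[OF A]) auto
  have "T q (\<Sum>i\<in>I. r i *\<^sub>R v i) (\<Sum>i\<in>I. s i *\<^sub>R v i) =
      (\<Sum>i\<in>I. r i * T q (v i) (\<Sum>j\<in>I. s j *\<^sub>R v j))"
    using tensor_sum[OF sum[of s] assms, where r = r] sum tensor_sym[OF sum sum, of r s]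
      tensor_sym[OF sum[of s] assms(2)] by simp
  also have "\<dots> = (\<Sum>i\<in>I. r i * (\<Sum>j\<in>I. s j * T q (v i) (v j)))"
    using assms by (intro sum.cong refl arg_cong2[of _ _ _ _ "(*)"] tensor_sum) auto
  finally show ?thesis by (simp add: sum_distrib_left mult_ac)
qed

lemma tensor_smooth:
  assumes "vector_field A W X" "vector_field A W Y" "q \<in> W"
  shows "smooth_at A q (\<lambda>q. T q (X q) (Y q))"
proof -
  have "smooth_fun A W (\<lambda>q. T q (X q) (Y q))"
    using T assms(1,2) unfolding sym_tensor_field_def by blast
  then show ?thesis using assms(3) unfolding smooth_at_def by blast
qed

end

section \<open>Geometry of Chaplygin systems\<close>

lemma linear_combination_axis: "(\<Sum>a\<in>UNIV. r a *\<^sub>R axis a (1::real)) = (\<chi> a. r a)"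
  by (simp add: vec_eq_iff axis_def if_distrib cong: if_cong)

text \<open>A nonzero kernel vector would make the quadratic form vanish on it. Once an inverse
  exists, the choice in \<open>matrix_inv\<close> is a two-sided one.\<close>

lemma pos_def_matrix_inv:
  fixes M :: "real^'d^'d"
  assumes "\<And>v. v \<noteq> 0 \<Longrightarrow> (\<Sum>a\<in>UNIV. \<Sum>b\<in>UNIV. M $ a $ b * v $ a * v $ b) > 0"
  shows "matrix_inv M ** M = mat 1" "M ** matrix_inv M = mat 1"
proof -
  have "v = 0" if "M *v v = 0" for v
  proof (rule ccontr)
    assume "v \<noteq> 0"
    have "(\<Sum>a\<in>UNIV. \<Sum>b\<in>UNIV. M $ a $ b * v $ a * v $ b) = (\<Sum>a\<in>UNIV. v $ a * (M *v v) $ a)"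
      by (simp add: matrix_vector_mult_def sum_distrib_left mult_ac)
    with assms[OF \<open>v \<noteq> 0\<close>] that show False by simp
  qed
  then have "invertible M"
    using matrix_left_invertible_ker invertible_left_inverse by blast
  then have "M ** matrix_inv M = mat 1 \<and> matrix_inv M ** M = mat 1"
    unfolding invertible_def matrix_inv_def by (rule someI_ex)
  then show "matrix_inv M ** M = mat 1" "M ** matrix_inv M = mat 1" by auto
qed

lemma inner_axis_1: "v \<bullet> axis a (1::real) = v $ a"
  by (simp add: inner_axis)

lemma sum_axis: "(\<Sum>a\<in>UNIV. r a * axis i (1::real) $ a) = r i"
  by (simp add: axis_def if_distrib cong: if_cong)

locale chaplygin =
  fixes C :: "('q::{t2_space,second_countable_topology}, 'n::finite,
      'g::{t2_space,second_countable_topology}, 'k::finite,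
      'b::{t2_space,second_countable_topology}, 'm::finite) chaplygin_data"
    and \<xi> :: "'k \<Rightarrow> 'g tvec"
    and X :: "('q, 'b, 'm) lifts"
    and R :: "('q, 'b, 'm, 'k) coeffs"
  assumes system: "chaplygin_system C"
    and basis: "lie_algebra_basis C \<xi>"
    and lifts: "horizontal_lifts C X"
    and struct: "structure_functions C \<xi> X R"
begin

abbreviation "Q \<equiv> Q_atlas C"
abbreviation "B \<equiv> B_atlas C"
abbreviation "g \<equiv> Q_metric C"
abbreviation "\<pi> \<equiv> proj C"
abbreviation "bracket c a b \<equiv> lie_bracket Q (X c a) (X c b)"
abbreviation "base_point \<equiv> inv_into UNIV \<pi>"

lemma atlas: "smooth_atlas Q" "smooth_atlas B" "smooth_atlas (G_atlas C)"
  and metric: "sym_tensor_field Q g" "\<And>q v. v \<in> tangent_space Q q \<Longrightarrow> v \<noteq> 0 \<Longrightarrow> g q v v > 0"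
  and metric_invariant: "G_invariant_tensor C g"
  and proj_smooth: "smooth_map Q B UNIV \<pi>" and proj_surj: "surj \<pi>"
  and carrier_UNIV: "carrier (grp C) = UNIV"
  using system unfolding chaplygin_system_def principal_bundle_def lie_group_def riemannian_metric_def
  by auto

lemma constr_subspace: "subspace (constr C q)"
  and constr_tangent: "v \<in> constr C q \<Longrightarrow> v \<in> tangent_space Q q"
  using system unfolding chaplygin_system_def distribution_def by auto

lemma proj_base_point [simp]: "\<pi> (base_point p) = p"
  using proj_surj by (simp add: surj_f_inv_f)

lemma fibre_orbit: "\<pi> p = \<pi> q \<longleftrightarrow> (\<exists>h. p = actn C h q)"
proof -
  have "\<pi> -` {\<pi> q} = {actn C h q |h. h \<in> carrier (grp C)}"
    using system unfolding chaplygin_system_def principal_bundle_def orbit_def by blast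
  then show ?thesis unfolding carrier_UNIV by blast
qed

lemma proj_actn [simp]: "\<pi> (actn C h q) = \<pi> q"
  using fibre_orbit by blast

lemma actn_smooth: "smooth_map Q Q UNIV (actn C h)"
  and orbit_map_smooth: "smooth_map (G_atlas C) Q UNIV (\<lambda>h. actn C h q)"
proof -
  have "smooth_map (prod_atlas (G_atlas C) Q) Q (UNIV \<times> UNIV) (\<lambda>(h, q). actn C h q)"
    using system unfolding chaplygin_system_def free_proper_action_def by simp
  then show "smooth_map Q Q UNIV (actn C h)" "smooth_map (G_atlas C) Q UNIV (\<lambda>h. actn C h q)"
    using smooth_map_slice_left[OF atlas(3,1,1), of UNIV "\<lambda>(h, q). actn C h q" q]
      smooth_map_slice_right[OF atlas(3,1,1), of "\<lambda>(h, q). actn C h q" h]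
    by auto
qed

lemma actn_one: "actn C \<one>\<^bsub>grp C\<^esub> q = q"
proof -
  have "group_action (grp C) UNIV (actn C)"
    using system unfolding chaplygin_system_def free_proper_action_def by simp
  from group_action.id_eq_one[OF this] show ?thesis by (metis UNIV_I restrict_apply')
qed

text \<open>The difference of two such vectors is both horizontal and vertical.\<close>

lemma lift_unique:
  assumes "u \<in> constr C q" "v \<in> constr C q" "push Q B \<pi> q u = push Q B \<pi> q v"
  shows "u = v"
proof -
  have "u - v \<in> constr C q" using subspace_diff[OF constr_subspace] assms by blast
  moreover have "u - v \<in> vertical C q"
    using assms calculation constr_tangent by (simp add: vertical_def push_diff)
  ultimately have "u - v \<in> {0}"
    using system unfolding chaplygin_system_def principal_connection_def by blast
  then show ?thesis by simp
qed

section \<open>Horizontal lifts, generators and their brackets\<close>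

lemma tube_open: "c \<in> B \<Longrightarrow> open (tube C c)"
  unfolding tube_def using proj_smooth chart_open(1)[OF atlas(2), of c]
  by (simp add: smooth_map_def open_vimage)

lemma tube_iff: "q \<in> tube C c \<longleftrightarrow> \<pi> q \<in> fst c"
  by (simp add: tube_def)

lemma X_field: "c \<in> B \<Longrightarrow> vector_field Q (tube C c) (X c a)"
  and X_constr: "c \<in> B \<Longrightarrow> q \<in> tube C c \<Longrightarrow> X c a q \<in> constr C q"
  and push_X: "c \<in> B \<Longrightarrow> q \<in> tube C c \<Longrightarrow>
    push Q B \<pi> q (X c a q) = coord_vec B c (\<pi> q) (axis a 1)"
  using lifts unfolding horizontal_lifts_def by auto

lemma X_tangent: "c \<in> B \<Longrightarrow> q \<in> tube C c \<Longrightarrow> X c a q \<in> tangent_space Q q"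
  using X_constr constr_tangent by blast

text \<open>The pushed vector is horizontal because the constraint distribution is invariant, and
  lies over the same coordinate vector because the action preserves fibres; such a vector is
  unique.\<close>

lemma X_invariant:
  assumes c: "c \<in> B" "q \<in> tube C c"
  shows "push Q Q (actn C h) q (X c a q) = X c a (actn C h q)"
proof (rule lift_unique)
  have q': "actn C h q \<in> tube C c" using c by (simp add: tube_iff)
  show "X c a (actn C h q) \<in> constr C (actn C h q)" using X_constr c q' by blast
  show "push Q Q (actn C h) q (X c a q) \<in> constr C (actn C h q)"
    using X_constr[OF c] system unfolding chaplygin_system_def principal_connection_def by blast
  have "\<pi> \<circ> actn C h = \<pi>" by auto
  then show "push Q B \<pi> (actn C h q) (push Q Q (actn C h) q (X c a q)) =
      push Q B \<pi> (actn C h q) (X c a (actn C h q))"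
    using push_X[OF c] push_X[OF c(1) q'] push_compose[OF atlas(1,2) proj_smooth UNIV_I,
        where A = Q and f = "actn C h" and q = q]
    by simp
qed

text \<open>The generators are vertical because the projection is constant along orbits.\<close>

lemma inf_gen_tangent: "inf_gen C \<xi> i q \<in> tangent_space Q q"
  and push_inf_gen: "push Q B \<pi> q (inf_gen C \<xi> i q) = 0"
proof -
  have \<xi>: "\<xi> i \<in> tangent_space (G_atlas C) \<one>\<^bsub>grp C\<^esub>"
    using basis unfolding lie_algebra_basis_def by (metis rangeI span_base)
  show "inf_gen C \<xi> i q \<in> tangent_space Q q"
    using push_tangent[OF atlas(3,1) orbit_map_smooth UNIV_I \<xi>, of q]
    by (simp add: inf_gen_def actn_one)
  have "\<pi> \<circ> (\<lambda>h. actn C h q) = (\<lambda>h. \<pi> q)" by auto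
  then show "push Q B \<pi> q (inf_gen C \<xi> i q) = 0"
    using push_compose[OF atlas(1,2) proj_smooth UNIV_I, where A = "G_atlas C"
        and f = "\<lambda>h. actn C h q" and q = "\<one>\<^bsub>grp C\<^esub>" and v = "\<xi> i"] push_const_map[OF atlas(3) \<xi>]
    by (simp add: inf_gen_def actn_one)
qed

lemma frame_tangent:
  assumes "c \<in> B" "q \<in> tube C c"
  shows "frame C \<xi> X c \<kappa> q \<in> tangent_space Q q"
  using X_tangent[OF assms] inf_gen_tangent
  by (cases \<kappa>) (auto simp: frame_def
      intro!: subspace_add subspace_sum subspace_scale subspace_tangent_space[OF atlas(1)])

lemma bracket_structure:
  "c \<in> B \<Longrightarrow> q \<in> tube C c \<Longrightarrow>
    bracket c a b q = (\<Sum>\<gamma>\<in>UNIV. R c \<gamma> (Inl a) (Inl b) q *\<^sub>R frame C \<xi> X c \<gamma> q)"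
proof -
  assume c: "c \<in> B" "q \<in> tube C c"
  have "frame C \<xi> X c (Inl a) = X c a" for a by (auto simp: frame_def)
  moreover have "lie_bracket Q (frame C \<xi> X c (Inl a)) (frame C \<xi> X c (Inl b)) q =
      (\<Sum>\<gamma>\<in>UNIV. R c \<gamma> (Inl a) (Inl b) q *\<^sub>R frame C \<xi> X c \<gamma> q)"
    using struct c unfolding structure_functions_def by blast
  ultimately show ?thesis by simp
qed

lemma bracket_tangent: "c \<in> B \<Longrightarrow> q \<in> tube C c \<Longrightarrow> bracket c a b q \<in> tangent_space Q q"
  unfolding bracket_structure
  by (intro subspace_sum subspace_scale subspace_tangent_space[OF atlas(1)] frame_tangent)

lemma bracket_field: "c \<in> B \<Longrightarrow> vector_field Q (tube C c) (bracket c a b)"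
  by (intro vector_field_lie_bracket[OF atlas(1)] X_field bracket_tangent)

text \<open>The lifts annihilate constants, and map the pulled back coordinates to constants.\<close>

lemma bracket_vertical:
  assumes c: "c \<in> B" "q \<in> tube C c"
  shows "push Q B \<pi> q (bracket c a b q) = 0"
proof -
  have pq: "\<pi> q \<in> fst c" using c by (simp add: tube_iff)
  have "push Q B \<pi> q (bracket c a b q) \<in> tangent_space B (\<pi> q)"
    using push_tangent[OF atlas(1,2) proj_smooth UNIV_I bracket_tangent[OF c]] .
  then obtain u where u: "push Q B \<pi> q (bracket c a b q) = coord_vec B c (\<pi> q) u"
    unfolding tangent_space_chart[OF atlas(2) c(1) pq] by blast
  have "u \<bullet> i = 0" for i
  proof -
    let ?x = "\<lambda>p. snd c p \<bullet> i"
    have sm: "smooth_at B (\<pi> p) ?x" if "p \<in> tube C c" for p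
      using that c smooth_at_coordinate[OF atlas(2)] by (auto simp: tube_iff)
    have const: "app (X c e p) (?x \<circ> \<pi>) = axis e 1 \<bullet> i" if "p \<in> tube C c" for p e
      using app_push[where f = \<pi> and q = p, OF sm[OF that], where A = Q and v = "X c e p"] push_X[OF c(1) that]
        app_coord_vec_coordinate[OF atlas(2) c(1), of "\<pi> p"] that
      by (simp add: tube_iff)
    have zero: "app (X c d q) (\<lambda>p. app (X c e p) (?x \<circ> \<pi>)) = 0" for d e
      using app_tangent_cong[OF atlas(1) X_tangent[OF c] tube_open[OF c(1)] c(2) const]
        app_tangent_const[OF atlas(1) X_tangent[OF c]] by simp
    have smQ: "smooth_at Q q (?x \<circ> \<pi>)"
      using smooth_at_compose[OF atlas(1,2) proj_smooth UNIV_I sm[OF c(2)]] .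
    have "u \<bullet> i = app (bracket c a b q) (?x \<circ> \<pi>)"
      using app_coord_vec_coordinate[OF atlas(2) c(1) pq, of u i] u
        app_push[where f = \<pi> and q = q, OF sm[OF c(2)], where A = Q and v = "bracket c a b q"] by simp
    also have "\<dots> = 0" using smQ zero by (simp add: lie_bracket_def)
    finally show ?thesis .
  qed
  then have "u = 0" by (metis euclidean_all_zero_iff)
  then show ?thesis
    using u linear_0[OF linear_coord_vec[OF atlas(2) c(1) pq]] by simp
qed

lemma push_combination_X:
  assumes c: "c \<in> B" "q \<in> tube C c"
  shows "push Q B \<pi> q (\<Sum>a\<in>UNIV. r a *\<^sub>R X c a q) = coord_vec B c (\<pi> q) (\<chi> a. r a)"
proof -
  have pq: "\<pi> q \<in> fst c" using c by (simp add: tube_iff)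
  show ?thesis
    using linear_sum[OF linear_coord_vec[OF atlas(2) c(1) pq], of "\<lambda>a. r a *\<^sub>R axis a 1" UNIV]
    by (simp add: linear_sum[OF linear_push] push_scaleR push_X[OF c]
        linear_combination_axis coord_vec_scaleR[OF atlas(2) c(1) pq])
qed

text \<open>Splitting each frame field X_k into V_k and its horizontal correction gives the bracket
  horizontal coefficients \<open>r d\<close>. They vanish because the bracket and the V_k are
  vertical while the lifts project to a basis. The vanishing of \<open>r d\<close> is the component
  form of g_ad R^d_bc = G_ak R^k_bc.\<close>

lemma bracket_inf_gen:
  assumes c: "c \<in> B" "q \<in> tube C c"
  shows "bracket c a b q = (\<Sum>k\<in>UNIV. R c (Inr k) (Inl a) (Inl b) q *\<^sub>R inf_gen C \<xi> k q)"
proof -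
  have pq: "\<pi> q \<in> fst c" using c by (simp add: tube_iff)
  define r where "r d = R c (Inl d) (Inl a) (Inl b) q +
    (\<Sum>k\<in>UNIV. R c (Inr k) (Inl a) (Inl b) q * K_coeff C \<xi> X c d k q)" for d
  have "bracket c a b q = (\<Sum>d\<in>UNIV. R c (Inl d) (Inl a) (Inl b) q *\<^sub>R X c d q) +
     (\<Sum>k\<in>UNIV. R c (Inr k) (Inl a) (Inl b) q *\<^sub>R (inf_gen C \<xi> k q +
       (\<Sum>d\<in>UNIV. K_coeff C \<xi> X c d k q *\<^sub>R X c d q)))"
    unfolding bracket_structure[OF c] UNIV_Plus_UNIV[symmetric]
    by (subst sum.Plus) (simp_all add: frame_def)
  also have "\<dots> = (\<Sum>d\<in>UNIV. R c (Inl d) (Inl a) (Inl b) q *\<^sub>R X c d q) +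
     (\<Sum>k\<in>UNIV. R c (Inr k) (Inl a) (Inl b) q *\<^sub>R inf_gen C \<xi> k q) +
     (\<Sum>k\<in>UNIV. \<Sum>d\<in>UNIV. (R c (Inr k) (Inl a) (Inl b) q * K_coeff C \<xi> X c d k q) *\<^sub>R X c d q)"
    by (simp add: scaleR_add_right sum.distrib scaleR_sum_right add_ac)
  also have "(\<Sum>k\<in>UNIV. \<Sum>d\<in>UNIV. (R c (Inr k) (Inl a) (Inl b) q * K_coeff C \<xi> X c d k q) *\<^sub>R X c d q) =
     (\<Sum>d\<in>UNIV. (\<Sum>k\<in>UNIV. R c (Inr k) (Inl a) (Inl b) q * K_coeff C \<xi> X c d k q) *\<^sub>R X c d q)"
    by (subst sum.swap) (simp add: scaleR_sum_left)
  finally have decomp: "bracket c a b q = (\<Sum>d\<in>UNIV. r d *\<^sub>R X c d q) +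
      (\<Sum>k\<in>UNIV. R c (Inr k) (Inl a) (Inl b) q *\<^sub>R inf_gen C \<xi> k q)"
    by (simp add: r_def scaleR_add_left sum.distrib add_ac)
  have "coord_vec B c (\<pi> q) (\<chi> d. r d) = coord_vec B c (\<pi> q) 0"
    using bracket_vertical[OF c, of a b] linear_0[OF linear_coord_vec[OF atlas(2) c(1) pq]]
    unfolding decomp push_add push_combination_X[OF c]
    by (simp add: linear_sum[OF linear_push] push_scaleR push_inf_gen)
  then have "r d = 0" for d
    unfolding coord_vec_inject[OF atlas(2) c(1) pq] by (simp add: vec_eq_iff)
  with decomp show ?thesis by simp
qed

text \<open>Naturality of the bracket: differentiating \<open>F\<close> composed with the action
  along a lift gives the derivative of \<open>F\<close> along that lift, composed with the action.
  This holds on a neighbourhood of \<open>q\<close>, so a second lift may be applied to it.\<close>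

lemma bracket_invariant:
  assumes c: "c \<in> B" "q \<in> tube C c"
  shows "push Q Q (actn C h) q (bracket c a b q) = bracket c a b (actn C h q)"
proof (rule tvec_eqI)
  fix F
  let ?L = "actn C h"
  show "app (push Q Q ?L q (bracket c a b q)) F = app (bracket c a b (?L q)) F"
  proof (cases "smooth_at Q (?L q) F")
    case True
    have q': "?L q \<in> tube C c" using c by (simp add: tube_iff)
    obtain V where V: "open V" "?L q \<in> V" "\<And>p. p \<in> V \<Longrightarrow> smooth_at Q p F"
      using True smooth_fun_iff[OF atlas(1)] unfolding smooth_at_def[of Q "?L q"] by blast
    define U where "U = tube C c \<inter> ?L -` V"
    have U: "open U" "q \<in> U"
      using V c actn_smooth[of h] tube_open[OF c(1)]
      by (simp_all add: U_def smooth_map_def open_Int open_vimage)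
    have pull: "app (X c e p) (F \<circ> ?L) = ((\<lambda>p. app (X c e p) F) \<circ> ?L) p" if "p \<in> U" for p e
      using that app_push[where f = ?L and q = p, OF V(3), where A = Q and v = "X c e p"] X_invariant[OF c(1), of p h e]
      by (simp add: U_def)
    have "app (X c d q) (\<lambda>p. app (X c e p) (F \<circ> ?L)) =
        app (X c d (?L q)) (\<lambda>p. app (X c e p) F)" for d e
    proof -
      have "app (X c d q) (\<lambda>p. app (X c e p) (F \<circ> ?L)) =
          app (X c d q) ((\<lambda>p. app (X c e p) F) \<circ> ?L)"
        by (rule app_tangent_cong[OF atlas(1) X_tangent[OF c] U]) (rule pull)
      also have "\<dots> = app (X c d (?L q)) (\<lambda>p. app (X c e p) F)"
        using app_push[where f = ?L and q = q, OF vector_field_smooth_at[OF atlas(1) X_field[OF c(1)] q' True],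
            where A = Q and v = "X c d q"]
          X_invariant[OF c] by simp
      finally show ?thesis .
    qed
    then show ?thesis
      using True smooth_at_compose[OF atlas(1,1) actn_smooth UNIV_I True]
      by (simp add: app_push lie_bracket_def)
  qed (simp add: push_def lie_bracket_def)
qed

section \<open>Horizontal metric coefficients and curvature contractions\<close>

lemma G_hor_sym: "c \<in> B \<Longrightarrow> q \<in> tube C c \<Longrightarrow> G_hor C X c q $ a $ b = G_hor C X c q $ b $ a"
  using tensor_sym[OF atlas(1) metric(1)] X_tangent by (simp add: G_hor_def)

lemma G_hor_quadratic:
  assumes c: "c \<in> B" "q \<in> tube C c"
  shows "g q (\<Sum>a\<in>UNIV. u $ a *\<^sub>R X c a q) (\<Sum>a\<in>UNIV. v $ a *\<^sub>R X c a q) =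
    (\<Sum>a\<in>UNIV. \<Sum>b\<in>UNIV. G_hor C X c q $ a $ b * u $ a * v $ b)"
  using tensor_sum_sum[OF atlas(1) metric(1) finite X_tangent[OF c],
      where r = "\<lambda>a. u $ a" and s = "\<lambda>a. v $ a" and I = UNIV]
  by (simp add: G_hor_def)

text \<open>A nonzero combination of lifts projects to a nonzero vector of the base, so it is itself
  nonzero and the metric on Q is positive on it.\<close>

lemma G_hor_pos:
  assumes c: "c \<in> B" "q \<in> tube C c" and "v \<noteq> 0"
  shows "(\<Sum>a\<in>UNIV. \<Sum>b\<in>UNIV. G_hor C X c q $ a $ b * v $ a * v $ b) > 0"
proof -
  have pq: "\<pi> q \<in> fst c" using c by (simp add: tube_iff)
  let ?v = "\<Sum>a\<in>UNIV. v $ a *\<^sub>R X c a q"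
  have "?v \<in> tangent_space Q q"
    using X_tangent[OF c] by (intro subspace_sum subspace_scale subspace_tangent_space[OF atlas(1)])
  moreover have "?v \<noteq> 0"
  proof
    assume "?v = 0"
    then have "coord_vec B c (\<pi> q) v = coord_vec B c (\<pi> q) 0"
      using push_combination_X[OF c, of "\<lambda>a. v $ a"] linear_0[OF linear_push, of Q B \<pi> q]
        linear_0[OF linear_coord_vec[OF atlas(2) c(1) pq]] by simp
    then show False using \<open>v \<noteq> 0\<close> coord_vec_inject[OF atlas(2) c(1) pq] by blast
  qed
  ultimately have "g q ?v ?v > 0" by (rule metric(2))
  then show ?thesis using G_hor_quadratic[OF c, of v v] by simp
qed

text \<open>The right side mentions neither generators nor structure functions, so invariance and
  smoothness can be checked on lifts and brackets alone.\<close>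

lemma curv_G_mix:
  assumes c: "c \<in> B" "q \<in> tube C c"
  shows "curv (G_mix C \<xi> X) R c a b e q = g q (X c a q) (bracket c b e q)"
  unfolding bracket_inf_gen[OF c] curv_def G_mix_def
  by (subst tensor_sum[OF atlas(1) metric(1) X_tangent[OF c] finite inf_gen_tangent])
    (simp add: mult_ac)

text \<open>The coefficients K are chosen to make X_k orthogonal to the constraint distribution;
  this is that orthogonality, with the inverse matrix cleared.\<close>

lemma K_coeff_eq:
  assumes c: "c \<in> B" "q \<in> tube C c"
  shows "(\<Sum>b\<in>UNIV. G_hor C X c q $ a $ b * K_coeff C \<xi> X c b k q) = - G_mix C \<xi> X c a k q"
proof -
  let ?G = "G_hor C X c q"
  have inv: "(\<Sum>b\<in>UNIV. matrix_inv ?G $ d $ b * ?G $ b $ a) = (if d = a then 1 else 0)" for d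
  proof -
    have "(matrix_inv ?G ** ?G) $ d $ a = (if d = a then 1 else 0)"
      using pos_def_matrix_inv(1)[OF G_hor_pos[OF c]] by (simp add: mat_def)
    then show ?thesis by (simp add: matrix_matrix_mult_def)
  qed
  have "(\<Sum>b\<in>UNIV. ?G $ a $ b * K_coeff C \<xi> X c b k q) =
      - (\<Sum>b\<in>UNIV. \<Sum>d\<in>UNIV. matrix_inv ?G $ d $ b * ?G $ b $ a * G_mix C \<xi> X c d k q)"
    unfolding K_coeff_def by (simp add: sum_distrib_left sum_negf G_hor_sym[OF c, of a] mult_ac)
  also have "\<dots> = - (\<Sum>d\<in>UNIV. (\<Sum>b\<in>UNIV. matrix_inv ?G $ d $ b * ?G $ b $ a) * G_mix C \<xi> X c d k q)"
    by (subst sum.swap) (simp add: sum_distrib_right)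
  finally show ?thesis by (simp add: inv if_distrib[of "\<lambda>x. x * _"] cong: if_cong)
qed

text \<open>The frame field X_k is V_k plus a horizontal correction. On the correction
  \<open>gbar\<close> agrees with g, and by orthogonality of X_k its product with X_a is - G_ak;
  summed against R^k this produces the second term.\<close>

lemma curv_gbar_mix:
  assumes c: "c \<in> B" "q \<in> tube C c"
    and gbar: "sym_tensor_field Q gbar"
    and restr: "\<And>u v. u \<in> constr C q \<Longrightarrow> v \<in> constr C q \<Longrightarrow> gbar q u v = g q u v"
  shows "curv (gbar_mix C \<xi> X gbar) R c a b e q =
    gbar q (X c a q) (bracket c b e q) - g q (X c a q) (bracket c b e q)"
proof -
  have "gbar_mix C \<xi> X gbar c a k q = gbar q (X c a q) (inf_gen C \<xi> k q) - G_mix C \<xi> X c a k q" for k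
  proof -
    have "gbar_mix C \<xi> X gbar c a k q = gbar q (X c a q) (inf_gen C \<xi> k q) +
        gbar q (X c a q) (\<Sum>b\<in>UNIV. K_coeff C \<xi> X c b k q *\<^sub>R X c b q)"
      unfolding gbar_mix_def frame_def
      using X_tangent[OF c] inf_gen_tangent
      by (auto intro!: tensor_add[OF atlas(1) gbar] subspace_sum subspace_scale
          subspace_tangent_space[OF atlas(1)])
    also have "gbar q (X c a q) (\<Sum>b\<in>UNIV. K_coeff C \<xi> X c b k q *\<^sub>R X c b q) =
        (\<Sum>b\<in>UNIV. K_coeff C \<xi> X c b k q * gbar q (X c a q) (X c b q))"
      by (rule tensor_sum[OF atlas(1) gbar X_tangent[OF c] finite X_tangent[OF c]])
    also have "\<dots> = (\<Sum>b\<in>UNIV. G_hor C X c q $ a $ b * K_coeff C \<xi> X c b k q)"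
      by (simp add: restr X_constr[OF c] G_hor_def mult_ac)
    finally show ?thesis by (simp add: K_coeff_eq[OF c])
  qed
  then have "curv (gbar_mix C \<xi> X gbar) R c a b e q =
     (\<Sum>k\<in>UNIV. R c (Inr k) (Inl b) (Inl e) q * gbar q (X c a q) (inf_gen C \<xi> k q)) -
     curv (G_mix C \<xi> X) R c a b e q"
    unfolding curv_def sum_subtractf[symmetric]
    by (intro sum.cong) (simp_all add: right_diff_distrib mult.commute)
  then show ?thesis
    unfolding curv_G_mix[OF c] unfolding bracket_inf_gen[OF c]
    by (subst tensor_sum[OF atlas(1) gbar X_tangent[OF c] finite inf_gen_tangent]) simp
qed

text \<open>The bracket is vertical, so orthogonality removes the \<open>gbar\<close> term of
  \<open>curv_gbar_mix\<close>.\<close>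

lemma curv_gbar_mix_orthogonal:
  assumes c: "c \<in> B" "q \<in> tube C c"
    and gbar: "sym_tensor_field Q gbar"
    and restr: "\<And>u v. u \<in> constr C q \<Longrightarrow> v \<in> constr C q \<Longrightarrow> gbar q u v = g q u v"
    and orth: "VD_orthogonal C gbar"
  shows "curv (gbar_mix C \<xi> X gbar) R c a b e q = - curv (G_mix C \<xi> X) R c a b e q"
proof -
  have "bracket c b e q \<in> vertical C q"
    using bracket_tangent[OF c] bracket_vertical[OF c] by (simp add: vertical_def)
  then have "gbar q (bracket c b e q) (X c a q) = 0"
    using orth X_constr[OF c] unfolding VD_orthogonal_def by blast
  then show ?thesis
    using curv_gbar_mix[OF c gbar restr] curv_G_mix[OF c]
      tensor_sym[OF atlas(1) gbar X_tangent[OF c] bracket_tangent[OF c]] by simp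
qed

lemma bracket_antisym: "bracket c a b q = - bracket c b a q"
  by (rule tvec_eqI) (simp add: lie_bracket_def uminus_tvec_def)

lemma curv_G_mix_antisym:
  assumes c: "c \<in> B" "q \<in> tube C c"
  shows "curv (G_mix C \<xi> X) R c a b e q = - curv (G_mix C \<xi> X) R c a e b q"
  using tensor_scaleR[OF atlas(1) metric(1) X_tangent[OF c] bracket_tangent[OF c], of a "-1" e b]
  by (simp add: curv_G_mix[OF c] bracket_antisym[of c b e])

lemma curv_gbar_mix_antisym:
  assumes c: "c \<in> B" "q \<in> tube C c"
    and gbar: "sym_tensor_field Q gbar"
    and restr: "\<And>u v. u \<in> constr C q \<Longrightarrow> v \<in> constr C q \<Longrightarrow> gbar q u v = g q u v"
  shows "curv (gbar_mix C \<xi> X gbar) R c a b e q = - curv (gbar_mix C \<xi> X gbar) R c a e b q"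
  using tensor_scaleR[OF atlas(1) gbar X_tangent[OF c] bracket_tangent[OF c], of a "-1" e b]
    tensor_scaleR[OF atlas(1) metric(1) X_tangent[OF c] bracket_tangent[OF c], of a "-1" e b]
  by (simp add: curv_gbar_mix[OF c gbar restr] bracket_antisym[of c b e])

section \<open>Invariant functions and their descent to the quotient\<close>

lemma tensor_bracket_invariant:
  assumes "c \<in> B" "q \<in> tube C c" "G_invariant_tensor C T"
  shows "T (actn C h q) (X c a (actn C h q)) (bracket c b e (actn C h q)) =
    T q (X c a q) (bracket c b e q)"
  using assms(3) X_tangent[OF assms(1,2)] bracket_tangent[OF assms(1,2)]
  unfolding G_invariant_tensor_def X_invariant[OF assms(1,2), symmetric]
    bracket_invariant[OF assms(1,2), symmetric] by blast

lemma G_hor_invariant: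
  assumes "c \<in> B" "q \<in> tube C c"
  shows "G_hor C X c (actn C h q) = G_hor C X c q"
  using metric_invariant X_tangent[OF assms]
  unfolding G_hor_def G_invariant_tensor_def X_invariant[OF assms, symmetric] by simp

text \<open>\<open>base_point\<close> is an arbitrary right inverse of the projection and need not
  be continuous. A local trivialisation, evaluated at the identity of the group, supplies a smooth
  section. In each fibre section and \<open>base_point\<close> differ by a group element, which the
  invariant \<phi> does not see.\<close>

lemma smooth_at_base_point:
  assumes c: "c \<in> B" "p \<in> fst c"
    and smooth: "\<And>q. q \<in> tube C c \<Longrightarrow> smooth_at Q q \<phi>"
    and inv: "\<And>q h. q \<in> tube C c \<Longrightarrow> \<phi> (actn C h q) = \<phi> q"
  shows "smooth_at B p (\<lambda>p. \<phi> (base_point p))"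
proof -
  obtain U \<tau> where U: "open U" "p \<in> U"
    and bij: "bij_betw (\<lambda>q. (\<pi> q, \<tau> q)) (\<pi> -` U) (U \<times> UNIV)"
    and sm: "smooth_map (prod_atlas B (G_atlas C)) Q (U \<times> UNIV)
      (inv_into (\<pi> -` U) (\<lambda>q. (\<pi> q, \<tau> q)))"
    using system unfolding chaplygin_system_def principal_bundle_def Let_def by meson
  define s where "s p = inv_into (\<pi> -` U) (\<lambda>q. (\<pi> q, \<tau> q)) (p, \<one>\<^bsub>grp C\<^esub>)" for p
  have s: "smooth_map B Q U s"
    unfolding s_def by (rule smooth_map_slice_left[OF atlas(2,3,1) sm U(1)])
  have proj_s: "\<pi> (s p) = p" if "p \<in> U" for p
  proof -
    have "(p, \<one>\<^bsub>grp C\<^esub>) \<in> (\<lambda>q. (\<pi> q, \<tau> q)) ` (\<pi> -` U)"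
      using bij that unfolding bij_betw_def by blast
    from f_inv_into_f[OF this] show ?thesis by (simp add: s_def)
  qed
  have "s p \<in> tube C c" using proj_s U c by (simp add: tube_iff)
  from smooth_at_compose[OF atlas(2,1) s U(2) smooth[OF this]]
  show ?thesis
  proof (rule smooth_at_cong[OF atlas(2)])
    show "open (U \<inter> fst c)" using U chart_open(1)[OF atlas(2) c(1)] by blast
    show "(\<phi> \<circ> s) p' = \<phi> (base_point p')" if p': "p' \<in> U \<inter> fst c" for p'
    proof -
      have "\<pi> (s p') = \<pi> (base_point p')" using p' proj_s by simp
      then obtain h where "s p' = actn C h (base_point p')" using fibre_orbit by blast
      then show ?thesis using p' inv by (simp add: tube_iff)
    qed
  qed (use U c in auto)
qed

lemma descend_smooth:
  assumes c: "c \<in> B"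
    and smooth: "\<And>q. q \<in> tube C c \<Longrightarrow> smooth_at Q q \<phi>"
    and inv: "\<And>q h. q \<in> tube C c \<Longrightarrow> \<phi> (actn C h q) = \<phi> q"
  shows "smooth_on (snd c ` fst c) (descend C c \<phi>)"
proof -
  have "smooth_fun B (fst c) (\<lambda>p. \<phi> (base_point p))"
    using smooth_at_base_point[OF c _ smooth inv] chart_open(1)[OF atlas(2) c]
    by (simp add: smooth_fun_iff[OF atlas(2)])
  then have "smooth_on (snd c ` (fst c \<inter> fst c)) ((\<lambda>p. \<phi> (base_point p)) \<circ> chart_inv c)"
    using c unfolding smooth_fun_def by blast
  then show ?thesis by (simp add: comp_def descend_def[abs_def])
qed

lemma base_point_tube: "x \<in> snd c ` fst c \<Longrightarrow> base_point (chart_inv c x) \<in> tube C c"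
  using chart_inv_right(2)[OF atlas(2)] by (simp add: tube_iff)

lemma descend_G_hor_smooth:
  assumes c: "c \<in> B"
  shows "smooth_on (snd c ` fst c) (\<lambda>x. descend C c (G_hor C X c) x $ a $ b)"
proof -
  have "smooth_on (snd c ` fst c) (descend C c (\<lambda>q. G_hor C X c q $ a $ b))"
    using G_hor_invariant[OF c] tensor_smooth[OF atlas(1) metric(1) X_field[OF c] X_field[OF c]]
    by (intro descend_smooth[OF c]) (auto simp: G_hor_def)
  then show ?thesis by (simp add: descend_def[abs_def])
qed

lemma descend_tensor_bracket_smooth:
  assumes c: "c \<in> B" and "sym_tensor_field Q T" "G_invariant_tensor C T"
  shows "smooth_on (snd c ` fst c) (descend C c (\<lambda>q. T q (X c a q) (bracket c b e q)))"
  using tensor_bracket_invariant[OF c _ assms(3)]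
    tensor_smooth[OF atlas(1) assms(2) X_field[OF c] bracket_field[OF c]]
  by (intro descend_smooth[OF c]) auto

text \<open>The factors of the contraction need not be invariant one by one; the form with the
  bracket is, and it descends.\<close>

lemma descend_curv_smooth:
  assumes c: "c \<in> B"
  shows "smooth_on (snd c ` fst c) (descend C c (curv (G_mix C \<xi> X) R c a b e))"
  by (rule smooth_on_cong[OF chart_open(2)[OF atlas(2) c]
        descend_tensor_bracket_smooth[OF c metric(1) metric_invariant]])
    (use curv_G_mix[OF c base_point_tube] in \<open>simp add: descend_def\<close>)

lemma descend_curv_gbar_smooth:
  assumes c: "c \<in> B" and gbar: "sym_tensor_field Q gbar" "G_invariant_tensor C gbar"
    and restr: "\<And>q u v. u \<in> constr C q \<Longrightarrow> v \<in> constr C q \<Longrightarrow> gbar q u v = g q u v"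
  shows "smooth_on (snd c ` fst c) (descend C c (curv (gbar_mix C \<xi> X gbar) R c a b e))"
  by (rule smooth_on_cong[OF chart_open(2)[OF atlas(2) c]
        smooth_on_diff[OF chart_open(2)[OF atlas(2) c] descend_tensor_bracket_smooth[OF c gbar]
          descend_tensor_bracket_smooth[OF c metric(1) metric_invariant]]])
    (use curv_gbar_mix[OF c base_point_tube gbar(1) restr] in \<open>simp add: descend_def\<close>)

end

section \<open>Geodesic sprays and the reduced equations\<close>

text \<open>Lowering the index with \<open>H\<close> cancels the inverse matrix and leaves the
  Christoffel symbols of the first kind, \<open>J\<close> in the proof. Contracted twice with
  \<open>v\<close>, the first two terms of \<open>J\<close> coincide, which absorbs their factor
  1/2.\<close>

lemma christoffel_quadratic:
  fixes H :: "real^'m \<Rightarrow> real^'m^'m::finite"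
  assumes diff: "\<And>a b. (\<lambda>y. H y $ a $ b) differentiable (at x)"
    and inv: "H x ** matrix_inv (H x) = mat 1"
  shows "(\<Sum>e\<in>UNIV. H x $ d $ e * (- (\<Sum>a\<in>UNIV. \<Sum>b\<in>UNIV. christoffel H x e a b * v $ a * v $ b))) =
    - (\<Sum>b\<in>UNIV. frechet_derivative (\<lambda>y. H y $ d $ b) (at x) v * v $ b)
    + (\<Sum>a\<in>UNIV. \<Sum>b\<in>UNIV. frechet_derivative (\<lambda>y. H y $ a $ b) (at x) (axis d 1) * v $ a * v $ b) / 2"
proof -
  define D where "D a b w = frechet_derivative (\<lambda>y. H y $ a $ b) (at x) w" for a b w
  define J where "J d a b = (D d b (axis a 1) + D d a (axis b 1) - D a b (axis d 1)) / 2" for d a b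
  have chr: "christoffel H x e a b = (\<Sum>d\<in>UNIV. matrix_inv (H x) $ e $ d * J d a b)" for e a b
    by (simp add: christoffel_def Let_def J_def D_def sum_divide_distrib)
  have HI: "(\<Sum>e\<in>UNIV. H x $ d $ e * matrix_inv (H x) $ e $ d') = (if d = d' then 1 else 0)" for d'
    using inv by (simp add: matrix_matrix_mult_def mat_def vec_eq_iff)
  have "(\<Sum>e\<in>UNIV. H x $ d $ e * christoffel H x e a b) = J d a b" for a b
  proof -
    have "(\<Sum>e\<in>UNIV. H x $ d $ e * christoffel H x e a b) =
        (\<Sum>d'\<in>UNIV. (\<Sum>e\<in>UNIV. H x $ d $ e * matrix_inv (H x) $ e $ d') * J d' a b)"
      unfolding chr sum_distrib_left sum_distrib_right mult.assoc by (rule sum.swap)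
    then show ?thesis by (simp add: HI if_distrib[of "\<lambda>r. r * _"] cong: if_cong)
  qed
  then have "(\<Sum>a\<in>UNIV. \<Sum>b\<in>UNIV. J d a b * v $ a * v $ b) =
      (\<Sum>a\<in>UNIV. \<Sum>b\<in>UNIV. \<Sum>e\<in>UNIV. H x $ d $ e * christoffel H x e a b * v $ a * v $ b)"
    by (simp flip: sum_distrib_right)
  also have "\<dots> = (\<Sum>a\<in>UNIV. \<Sum>e\<in>UNIV. \<Sum>b\<in>UNIV. H x $ d $ e * christoffel H x e a b * v $ a * v $ b)"
    by (intro sum.cong refl sum.swap)
  also have "\<dots> = (\<Sum>e\<in>UNIV. \<Sum>a\<in>UNIV. \<Sum>b\<in>UNIV. H x $ d $ e * christoffel H x e a b * v $ a * v $ b)"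
    by (rule sum.swap)
  finally have lhs: "(\<Sum>e\<in>UNIV. H x $ d $ e * (- (\<Sum>a\<in>UNIV. \<Sum>b\<in>UNIV. christoffel H x e a b * v $ a * v $ b)))
      = - (\<Sum>a\<in>UNIV. \<Sum>b\<in>UNIV. J d a b * v $ a * v $ b)"
    by (simp add: sum_distrib_left sum_negf mult.assoc)
  have D_expand: "D a b v = (\<Sum>i\<in>UNIV. D a b (axis i 1) * v $ i)" for a b
  proof -
    interpret linear "D a b"
      unfolding D_def[abs_def] using diff by (rule linear_frechet_derivative)
    have "v = (\<Sum>i\<in>UNIV. v $ i *\<^sub>R axis i 1)"
      by (simp add: vec_eq_iff axis_def if_distrib cong: if_cong)
    then have "D a b v = (\<Sum>i\<in>UNIV. D a b (v $ i *\<^sub>R axis i 1))"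
      by (metis (no_types, lifting) sum sum.cong)
    then show ?thesis by (simp add: scale mult.commute)
  qed
  have 1: "(\<Sum>a\<in>UNIV. \<Sum>b\<in>UNIV. D d b (axis a 1) * v $ a * v $ b) = (\<Sum>b\<in>UNIV. D d b v * v $ b)"
    by (subst sum.swap) (simp add: D_expand sum_distrib_right)
  have 2: "(\<Sum>a\<in>UNIV. \<Sum>b\<in>UNIV. D d a (axis b 1) * v $ a * v $ b) = (\<Sum>b\<in>UNIV. D d b v * v $ b)"
    by (simp add: D_expand sum_distrib_right sum_distrib_left mult_ac)
  have "(\<Sum>a\<in>UNIV. \<Sum>b\<in>UNIV. J d a b * v $ a * v $ b) =
      (\<Sum>a\<in>UNIV. \<Sum>b\<in>UNIV. D d b (axis a 1) * v $ a * v $ b / 2 + D d a (axis b 1) * v $ a * v $ b / 2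
        - D a b (axis d 1) * v $ a * v $ b / 2)"
    by (intro sum.cong refl) (simp add: J_def field_simps)
  also have "\<dots> = (\<Sum>b\<in>UNIV. D d b v * v $ b)
      - (\<Sum>a\<in>UNIV. \<Sum>b\<in>UNIV. D a b (axis d 1) * v $ a * v $ b) / 2"
    unfolding sum.distrib sum_subtractf sum_divide_distrib[symmetric] 1 2 by simp
  finally show ?thesis using lhs by (simp add: D_def)
qed

text \<open>Exchanging the names b and c in the second term and using antisymmetry turns it into the
  first, whence the factor 2.\<close>

lemma antisym_contract:
  fixes S :: "'m::finite \<Rightarrow> 'm \<Rightarrow> 'm \<Rightarrow> real"
  assumes "\<And>a b c. S a b c = - S a c b"
  shows "(\<Sum>a\<in>UNIV. \<Sum>b\<in>UNIV. \<Sum>c\<in>UNIV. S a b c * u a * (v b * w c - v c * w b)) =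
    2 * (\<Sum>a\<in>UNIV. \<Sum>b\<in>UNIV. \<Sum>c\<in>UNIV. S a b c * u a * v b * w c)"
proof -
  have "(\<Sum>b\<in>UNIV. \<Sum>c\<in>UNIV. S a b c * u a * (v c * w b)) =
      - (\<Sum>b\<in>UNIV. \<Sum>c\<in>UNIV. S a b c * u a * v b * w c)" for a
  proof -
    have "(\<Sum>b\<in>UNIV. \<Sum>c\<in>UNIV. S a b c * u a * (v c * w b)) =
        (\<Sum>b\<in>UNIV. \<Sum>c\<in>UNIV. S a c b * u a * (v b * w c))"
      by (rule sum.swap)
    also have "\<dots> = (\<Sum>b\<in>UNIV. \<Sum>c\<in>UNIV. - (S a b c * u a * v b * w c))"
      by (intro sum.cong refl) (subst assms, simp)
    finally show ?thesis by (simp add: sum_negf)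
  qed
  then show ?thesis
    by (simp add: right_diff_distrib sum_subtractf sum_negf mult.assoc sum_distrib_left)
qed

text \<open>The origin of the 1/6 in \<gamma>. Write P for the right side. Contracted with two
  copies of v, the term S b a c gives P, the term S c a b gives 0 since it is antisymmetric in the
  slots of v, and 2 S a b c gives 2 P; the wedge doubles the total 3 P.\<close>

lemma gamma_contract:
  fixes S :: "'m::finite \<Rightarrow> 'm \<Rightarrow> 'm \<Rightarrow> real"
  assumes S: "\<And>a b c. S a b c = - S a c b"
  shows "(\<Sum>a\<in>UNIV. \<Sum>b\<in>UNIV. \<Sum>c\<in>UNIV.
      (S b a c - S c a b + 2 * S a b c) * v a * (v b * w c - v c * w b)) / 6 =
    (\<Sum>a\<in>UNIV. \<Sum>b\<in>UNIV. \<Sum>c\<in>UNIV. S a b c * v a * v b * w c)"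
proof -
  let ?P = "\<Sum>a\<in>UNIV. \<Sum>b\<in>UNIV. \<Sum>c\<in>UNIV. S a b c * v a * v b * w c"
  have 1: "(\<Sum>a\<in>UNIV. \<Sum>b\<in>UNIV. \<Sum>c\<in>UNIV. S b a c * v a * v b * w c) = ?P"
    by (subst sum.swap) (simp add: mult_ac)
  have "(\<Sum>a\<in>UNIV. \<Sum>b\<in>UNIV. \<Sum>c\<in>UNIV. S c a b * v a * v b * w c) =
      (\<Sum>a\<in>UNIV. \<Sum>b\<in>UNIV. \<Sum>c\<in>UNIV. S c b a * v a * v b * w c)"
    by (subst sum.swap) (simp add: mult_ac)
  also have "\<dots> = - (\<Sum>a\<in>UNIV. \<Sum>b\<in>UNIV. \<Sum>c\<in>UNIV. S c a b * v a * v b * w c)"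
    unfolding sum_negf[symmetric] by (intro sum.cong refl) (subst S, simp)
  finally have 2: "(\<Sum>a\<in>UNIV. \<Sum>b\<in>UNIV. \<Sum>c\<in>UNIV. S c a b * v a * v b * w c) = 0" by simp
  have "(\<Sum>a\<in>UNIV. \<Sum>b\<in>UNIV. \<Sum>c\<in>UNIV.
      (S b a c - S c a b + 2 * S a b c) * v a * (v b * w c - v c * w b)) =
      2 * (\<Sum>a\<in>UNIV. \<Sum>b\<in>UNIV. \<Sum>c\<in>UNIV. (S b a c - S c a b + 2 * S a b c) * v a * v b * w c)"
    by (rule antisym_contract) (use S in \<open>smt (verit)\<close>)
  also have "\<dots> = 2 * (?P - 0 + 2 * ?P)"
    unfolding 2[symmetric] unfolding 1[symmetric]
    by (simp add: left_diff_distrib distrib_right sum.distrib sum_subtractf sum_distrib_left mult.assoc 1[unfolded mult.assoc])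
  finally show ?thesis by simp
qed

section \<open>The reduced equations of motion in a chart of the base\<close>

context chaplygin
begin

abbreviation "Gred c x \<equiv> descend C c (G_hor C X c) x"
abbreviation "DG c x a b \<equiv> frechet_derivative (\<lambda>y. Gred c y $ a $ b) (at x)"
abbreviation "T_red c x a b e \<equiv> descend C c (curv (G_mix C \<xi> X) R c a b e) x"
abbreviation "S_red gbar c x a b e \<equiv> descend C c (curv (gbar_mix C \<xi> X gbar) R c a b e) x"

lemma Gred_derivative:
  assumes "c \<in> B" "x \<in> snd c ` fst c"
  shows "((\<lambda>y. Gred c y $ a $ b) has_derivative DG c x a b) (at x)"
  using smooth_on_has_derivative[OF descend_G_hor_smooth] assms by blast

lemma Gred_sym: "c \<in> B \<Longrightarrow> x \<in> snd c ` fst c \<Longrightarrow> Gred c x $ a $ b = Gred c x $ b $ a"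
  using G_hor_sym[OF _ base_point_tube] by (simp add: descend_def)

lemma Gred_pos:
  "c \<in> B \<Longrightarrow> x \<in> snd c ` fst c \<Longrightarrow> v \<noteq> 0 \<Longrightarrow>
    (\<Sum>a\<in>UNIV. \<Sum>b\<in>UNIV. Gred c x $ a $ b * v $ a * v $ b) > 0"
  using G_hor_pos[OF _ base_point_tube] by (simp add: descend_def)

text \<open>The symplectic equation evaluated on the d-th base coordinate direction. It is the
  lowered geodesic equation of \<open>christoffel_quadratic\<close> with the gyroscopic force added,
  so the two can be subtracted term by term.\<close>

lemma reduced_equation:
  assumes Z: "reduced_vector_field C \<xi> X R Z" and c: "c \<in> B" and x: "x \<in> snd c ` fst c"
  shows "(\<Sum>a\<in>UNIV. Gred c x $ d $ a * snd (Z c (x, v)) $ a) =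
    - (\<Sum>a\<in>UNIV. DG c x d a v * v $ a)
    + (\<Sum>a\<in>UNIV. \<Sum>b\<in>UNIV. DG c x a b (axis d 1) * v $ a * v $ b) / 2
    + (\<Sum>a\<in>UNIV. \<Sum>b\<in>UNIV. T_red c x a b d * v $ a * v $ b)"
proof -
  have z: "(x, v) \<in> tchart_dom c" using x by (simp add: tchart_dom_def)
  define A where "A = snd (Z c (x, v))"
  have Zz: "Z c (x, v) = (v, A)"
    using Z c z unfolding reduced_vector_field_def second_order_field_def A_def
    by (metis prod.collapse snd_conv)
  define w :: "(real^'m) \<times> (real^'m)" where "w = (axis d 1, 0)"
  have Gz: "((\<lambda>z. Gred c (fst z) $ a $ b) has_derivative (\<lambda>w. DG c x a b (fst w))) (at (x, v))" for a b
    using has_derivative_compose[where f = fst and x = "(x, v)" and g = "\<lambda>y. Gred c y $ a $ b",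
        OF has_derivative_fst[OF has_derivative_ident]] Gred_derivative[OF c x] by simp
  have vz: "((\<lambda>z. snd z $ a) has_derivative (\<lambda>w. snd w $ a)) (at (x, v))" for a
    using bounded_linear_compose[OF bounded_linear_vec_nth bounded_linear_snd]
    by (rule bounded_linear_imp_has_derivative)
  have \<theta>: "((\<lambda>y. theta_l C X c y w') has_derivative
      (\<lambda>w. \<Sum>a\<in>UNIV. \<Sum>b\<in>UNIV. (DG c x a b (fst w) * v $ a + Gred c x $ a $ b * snd w $ a) * fst w' $ b))
      (at (x, v))" for w'
    unfolding theta_l_def
    by (rule has_derivative_eq_rhs, (rule derivative_intros Gz vz)+) (simp add: algebra_simps fun_eq_iff)
  have E: "(reduced_energy C X c has_derivative
      (\<lambda>w. (\<Sum>a\<in>UNIV. \<Sum>b\<in>UNIV. DG c x a b (fst w) * v $ a * v $ b +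
        Gred c x $ a $ b * snd w $ a * v $ b + Gred c x $ a $ b * v $ a * snd w $ b) / 2)) (at (x, v))"
    unfolding reduced_energy_def[abs_def] divide_inverse
    by (rule has_derivative_eq_rhs, (rule derivative_intros Gz vz)+) (simp add: algebra_simps fun_eq_iff)
  have axis: "(\<Sum>b\<in>UNIV. r b * axis d 1 $ b) = r d" for r :: "'m \<Rightarrow> real"
    by (simp add: axis_def if_distrib cong: if_cong)
  have DG0: "DG c x a b 0 = 0" for a b
    using linear_0[OF has_derivative_linear[OF Gred_derivative[OF c x]]] .
  have "contract (Z c) (omega_l C X c) (x, v) w =
      frechet_derivative (reduced_energy C X c) (at (x, v)) w + alpha_form C \<xi> X R c (x, v) w"
    using Z c z unfolding reduced_vector_field_def by blast
  also have "contract (Z c) (omega_l C X c) (x, v) w =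
      - ((\<Sum>a\<in>UNIV. DG c x a d v * v $ a + Gred c x $ a $ d * A $ a)
        - (\<Sum>a\<in>UNIV. \<Sum>b\<in>UNIV. DG c x a b (axis d 1) * v $ a * v $ b))"
    unfolding contract_def omega_l_def ext_deriv_def Zz frechet_derivative_eqI[OF \<theta>] w_def
    by (simp add: axis)
  also have "frechet_derivative (reduced_energy C X c) (at (x, v)) w =
      (\<Sum>a\<in>UNIV. \<Sum>b\<in>UNIV. DG c x a b (axis d 1) * v $ a * v $ b) / 2"
    unfolding frechet_derivative_eqI[OF E] w_def by simp
  also have "alpha_form C \<xi> X R c (x, v) w = - (\<Sum>a\<in>UNIV. \<Sum>b\<in>UNIV. T_red c x a b d * v $ a * v $ b)"
    unfolding alpha_form_def w_def by (simp add: axis)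
  finally have eq: "(\<Sum>a\<in>UNIV. Gred c x $ a $ d * A $ a) = - (\<Sum>a\<in>UNIV. DG c x a d v * v $ a)
    + (\<Sum>a\<in>UNIV. \<Sum>b\<in>UNIV. DG c x a b (axis d 1) * v $ a * v $ b) / 2
    + (\<Sum>a\<in>UNIV. \<Sum>b\<in>UNIV. T_red c x a b d * v $ a * v $ b)"
    by (simp add: sum.distrib)
  \<comment> \<open>\<open>theta_l\<close> pairs the first index of the metric with the velocity,
    the lowered geodesic equation the second. Symmetry holds throughout the chart and therefore
    passes to derivatives.\<close>
  have "DG c x a d = DG c x d a" for a
  proof (rule frechet_derivative_transform_within_open[OF _ chart_open(2)[OF atlas(2) c] x])
    show "(\<lambda>y. Gred c y $ a $ d) differentiable (at x)"
      using Gred_derivative[OF c x] by (auto simp: differentiable_def)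
  qed (rule Gred_sym[OF c])
  then show ?thesis using eq Gred_sym[OF c x] by (simp add: A_def)
qed

end

section \<open>The conformally reduced metric\<close>

context chaplygin
begin

text \<open>Defined without a chart, so that the metric built from it needs no compatibility check
  on overlaps. On tangent vectors of the base the choice is unique by
  \<open>lift_unique\<close>.\<close>

definition hlift :: "'q \<Rightarrow> 'b tvec \<Rightarrow> 'q tvec" where
  "hlift q u = (SOME v. v \<in> constr C q \<and> push Q B \<pi> q v = u)"

text \<open>The metric making the projection isometric on the constraint distribution, rescaled.
  With ds = exp f dt, a velocity has the same length for the rescaled metric in the new time as for
  the original one in the old time.\<close>

definition conformal_metric :: "('b \<Rightarrow> real) \<Rightarrow> 'b \<Rightarrow> 'b tvec \<Rightarrow> 'b tvec \<Rightarrow> real" where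
  "conformal_metric f p u v = exp (2 * f p) *
     g (base_point p) (hlift (base_point p) u) (hlift (base_point p) v)"

lemma hlift_coord_vec:
  assumes c: "c \<in> B" "q \<in> tube C c"
  shows "hlift q (coord_vec B c (\<pi> q) w) = (\<Sum>a\<in>UNIV. w $ a *\<^sub>R X c a q)"
  unfolding hlift_def
proof (rule some_equality)
  show *: "(\<Sum>a\<in>UNIV. w $ a *\<^sub>R X c a q) \<in> constr C q \<and>
      push Q B \<pi> q (\<Sum>a\<in>UNIV. w $ a *\<^sub>R X c a q) = coord_vec B c (\<pi> q) w"
    using X_constr[OF c] push_combination_X[OF c]
    by (auto intro!: subspace_sum subspace_scale constr_subspace)
  show "v = (\<Sum>a\<in>UNIV. w $ a *\<^sub>R X c a q)"
    if "v \<in> constr C q \<and> push Q B \<pi> q v = coord_vec B c (\<pi> q) w" for v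
    using that * by (intro lift_unique) auto
qed

lemma conformal_metric_coord_vec:
  assumes c: "c \<in> B" "p \<in> fst c"
  shows "conformal_metric f p (coord_vec B c p u) (coord_vec B c p v) =
    exp (2 * f p) * (\<Sum>a\<in>UNIV. \<Sum>b\<in>UNIV. G_hor C X c (base_point p) $ a $ b * u $ a * v $ b)"
proof -
  have q: "base_point p \<in> tube C c" using c by (simp add: tube_iff)
  show ?thesis
    using hlift_coord_vec[OF c(1) q] G_hor_quadratic[OF c(1) q, of u v]
    by (simp add: conformal_metric_def)
qed

lemma tangent_coord_vec:
  assumes "p \<in> fst c" "c \<in> B" "u \<in> tangent_space B p"
  obtains w where "u = coord_vec B c p w"
  using assms tangent_space_chart[OF atlas(2) assms(2,1)] by auto

text \<open>The components of a field are its values on coordinate functions, hence smooth; the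
  metric is a finite sum of their products with descended invariant functions.\<close>

lemma smooth_conformal_metric:
  assumes f: "smooth_fun B UNIV f" and V: "vector_field B W V" and V': "vector_field B W V'" and q: "q \<in> W"
  shows "smooth_at B q (\<lambda>p. conformal_metric f p (V p) (V' p))"
proof -
  obtain c where c: "c \<in> B" "q \<in> fst c" using atlas_cover[OF atlas(2)] by blast
  define x where "x a p = snd c p \<bullet> axis a 1" for a p
  have W: "open (W \<inter> fst c)" "q \<in> W \<inter> fst c"
    using V chart_open(1)[OF atlas(2) c(1)] q c by (auto simp: vector_field_def)
  have x: "smooth_at B q (x a)" for a
    unfolding x_def by (rule smooth_at_coordinate[OF atlas(2) c])
  have G: "smooth_at B q (\<lambda>p. G_hor C X c (base_point p) $ a $ b)" for a b
  proof (rule smooth_at_base_point[OF c])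
    show "smooth_at Q q (\<lambda>q. G_hor C X c q $ a $ b)" if "q \<in> tube C c" for q
      using tensor_smooth[OF atlas(1) metric(1) X_field[OF c(1)] X_field[OF c(1)] that]
      by (simp add: G_hor_def)
  qed (simp add: G_hor_invariant[OF c(1)])
  have coords: "U p = coord_vec B c p (\<chi> a. app (U p) (x a))"
    if U: "vector_field B W U" and p: "p \<in> W \<inter> fst c" for U p
  proof -
    have "U p \<in> tangent_space B p" using vector_field_tangent[OF atlas(2) U] p by blast
    then obtain w where w: "U p = coord_vec B c p w"
      using p by (metis IntD2 tangent_coord_vec[OF _ c(1)])
    then have "app (U p) (x a) = w $ a" for a
      unfolding x_def w using app_coord_vec_coordinate[OF atlas(2) c(1), of p w "axis a 1"] p
      by (simp add: inner_axis_1)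
    then show ?thesis using w by simp
  qed
  have fq: "smooth_at B q f" using f unfolding smooth_at_def by blast
  have comp: "smooth_at B q (\<lambda>p. app (V p) (x a))" "smooth_at B q (\<lambda>p. app (V' p) (x a))" for a
    using vector_field_smooth_at[OF atlas(2) V q x] vector_field_smooth_at[OF atlas(2) V' q x] by auto
  have "smooth_at B q (\<lambda>p. exp (2 * f p) * (\<Sum>a\<in>UNIV. \<Sum>b\<in>UNIV.
      G_hor C X c (base_point p) $ a $ b * app (V p) (x a) * app (V' p) (x b)))"
    by (intro smooth_at_mult[OF atlas(2)] smooth_at_exp[OF atlas(2)] smooth_at_sum[OF atlas(2)]
        smooth_at_const[OF atlas(2)] G comp fq finite)
  then show ?thesis
  proof (rule smooth_at_cong[OF atlas(2) _ W])
    fix p assume p: "p \<in> W \<inter> fst c"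
    then show "exp (2 * f p) * (\<Sum>a\<in>UNIV. \<Sum>b\<in>UNIV.
      G_hor C X c (base_point p) $ a $ b * app (V p) (x a) * app (V' p) (x b)) =
      conformal_metric f p (V p) (V' p)"
      using conformal_metric_coord_vec[OF c(1), of p f "\<chi> a. app (V p) (x a)" "\<chi> a. app (V' p) (x a)"]
        coords[OF V p] coords[OF V' p] by simp
  qed
qed

lemma conformal_metric_riemannian:
  assumes f: "smooth_fun B UNIV f"
  shows "riemannian_metric B (conformal_metric f)"
  unfolding riemannian_metric_def sym_tensor_field_def
proof (intro conjI allI ballI impI)
  fix p u v r
  assume uv: "u \<in> tangent_space B p" "v \<in> tangent_space B p"
  obtain c where c: "c \<in> B" "p \<in> fst c" using atlas_cover[OF atlas(2)] by blast
  have q: "base_point p \<in> tube C c" using c by (simp add: tube_iff)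
  obtain x where x: "u = coord_vec B c p x" by (rule tangent_coord_vec[OF c(2,1) uv(1)])
  obtain y where y: "v = coord_vec B c p y" by (rule tangent_coord_vec[OF c(2,1) uv(2)])
  note xy = x y
  show "conformal_metric f p u v = conformal_metric f p v u"
    unfolding xy conformal_metric_coord_vec[OF c]
    by (subst sum.swap) (simp add: G_hor_sym[OF c(1) q] mult_ac)
  show "conformal_metric f p (r *\<^sub>R u) v = r * conformal_metric f p u v"
    unfolding xy coord_vec_scaleR[OF atlas(2) c, symmetric] conformal_metric_coord_vec[OF c]
    by (simp add: sum_distrib_left mult_ac)
  show "conformal_metric f p (u + w) v = conformal_metric f p u v + conformal_metric f p w v"
    if w: "w \<in> tangent_space B p" for w
  proof -
    obtain z where z: "w = coord_vec B c p z" by (rule tangent_coord_vec[OF c(2,1) w])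
    show ?thesis
      unfolding xy z coord_vec_add[OF atlas(2) c, symmetric] conformal_metric_coord_vec[OF c]
      by (simp add: distrib_left distrib_right sum.distrib)
  qed
next
  fix W V V' assume V: "vector_field B W V" "vector_field B W V'"
  then show "smooth_fun B W (\<lambda>q. conformal_metric f q (V q) (V' q))"
    using smooth_conformal_metric[OF f V] by (simp add: smooth_fun_iff[OF atlas(2)] vector_field_def)
next
  fix p v assume v: "v \<in> tangent_space B p" "v \<noteq> 0"
  obtain c where c: "c \<in> B" "p \<in> fst c" using atlas_cover[OF atlas(2)] by blast
  have q: "base_point p \<in> tube C c" using c by (simp add: tube_iff)
  obtain y where y: "v = coord_vec B c p y" by (rule tangent_coord_vec[OF c(2,1) v(1)])
  have "y \<noteq> 0" using v y linear_0[OF linear_coord_vec[OF atlas(2) c]] by auto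
  from G_hor_pos[OF c(1) q this] show "conformal_metric f p v v > 0"
    unfolding y conformal_metric_coord_vec[OF c] by simp
qed

lemma conformal_metric_coeffs:
  assumes c: "c \<in> B" and x: "x \<in> snd c ` fst c"
  shows "metric_coeffs B (conformal_metric f) c x $ a $ b =
    exp (2 * f (chart_inv c x)) * Gred c x $ a $ b"
  using conformal_metric_coord_vec[OF c chart_inv_right(2)[OF atlas(2) x], of f "axis a 1" "axis b 1"]
  by (simp add: metric_coeffs_def Let_def sum_axis descend_def sum_distrib_right[symmetric])

text \<open>Positive definiteness on \<open>u - w\<close>; it allows accelerations to be compared
  after lowering the index.\<close>

lemma Gred_cancel:
  assumes "c \<in> B" "x \<in> snd c ` fst c"
    and "\<And>d. (\<Sum>e\<in>UNIV. Gred c x $ d $ e * u $ e) = (\<Sum>e\<in>UNIV. Gred c x $ d $ e * w $ e)"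
  shows "u = w"
proof (rule ccontr)
  assume "u \<noteq> w"
  then have "(\<Sum>d\<in>UNIV. \<Sum>e\<in>UNIV. Gred c x $ d $ e * (u - w) $ d * (u - w) $ e) > 0"
    using Gred_pos[OF assms(1,2), of "u - w"] by simp
  moreover have "(\<Sum>e\<in>UNIV. Gred c x $ d $ e * (u - w) $ d * (u - w) $ e) =
      (u - w) $ d * ((\<Sum>e\<in>UNIV. Gred c x $ d $ e * u $ e) - (\<Sum>e\<in>UNIV. Gred c x $ d $ e * w $ e))" for d
    unfolding sum_subtractf[symmetric] sum_distrib_left
    by (intro sum.cong) (simp_all add: algebra_simps)
  ultimately show False using assms(3) by simp
qed

text \<open>Differentiating exp (2 f) adds g(v, v) df - 2 df(v) g(v, .) to the lowered geodesic
  equation. Expressing the remaining metric terms by the reduced equation subtracts T(v, v, .),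
  which by hypothesis cancels the first summand and one of the two copies of the second.\<close>

lemma spray_conformal_metric:
  assumes f: "smooth_fun B UNIV f" and Z: "reduced_vector_field C \<xi> X R Z"
    and c: "c \<in> B" and x: "x \<in> snd c ` fst c"
    and curv: "\<And>d. (\<Sum>a\<in>UNIV. \<Sum>b\<in>UNIV. T_red c x a b d * v $ a * v $ b) =
      (\<Sum>a\<in>UNIV. \<Sum>b\<in>UNIV. Gred c x $ a $ b * v $ a * v $ b) *
        frechet_derivative (f \<circ> chart_inv c) (at x) (axis d 1)
      - (\<Sum>b\<in>UNIV. Gred c x $ d $ b * v $ b) * frechet_derivative (f \<circ> chart_inv c) (at x) v"
  shows "snd (geodesic_spray B (conformal_metric f) c (x, v)) =
    snd (Z c (x, v)) - frechet_derivative (f \<circ> chart_inv c) (at x) v *\<^sub>R v"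
proof (rule Gred_cancel[OF c x])
  fix d
  let ?D = "frechet_derivative (f \<circ> chart_inv c) (at x)"
  let ?H = "metric_coeffs B (conformal_metric f) c"
  \<comment> \<open>The conformal factor at the fixed point; it multiplies both sides and is
    cancelled as a positive number.\<close>
  define E where "E = exp (2 * f (chart_inv c x))"
  have E: "E > 0" by (simp add: E_def)
  have D: "((f \<circ> chart_inv c) has_derivative ?D) (at x)"
    using f c x smooth_on_has_derivative[of "snd c ` fst c"] unfolding smooth_fun_def by force
  have H: "?H x $ a $ b = E * Gred c x $ a $ b" for a b
    by (simp add: conformal_metric_coeffs[OF c x] E_def)
  have "((\<lambda>y. exp (2 * (f \<circ> chart_inv c) y) * Gred c y $ a $ b) has_derivative
      (\<lambda>w. E * (2 * ?D w * Gred c x $ a $ b + DG c x a b w))) (at x)" for a b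
    by (rule has_derivative_eq_rhs, (rule derivative_intros has_derivative_exp D Gred_derivative[OF c x])+)
      (simp add: E_def algebra_simps fun_eq_iff)
  then have dH: "((\<lambda>y. ?H y $ a $ b) has_derivative
      (\<lambda>w. E * (2 * ?D w * Gred c x $ a $ b + DG c x a b w))) (at x)" for a b
    by (rule has_derivative_transform_within_open[OF _ chart_open(2)[OF atlas(2) c] x])
      (simp add: conformal_metric_coeffs[OF c])
  have "?H x ** matrix_inv (?H x) = mat 1"
  proof (rule pos_def_matrix_inv(2))
    fix w :: "real^'m" assume "w \<noteq> 0"
    from Gred_pos[OF c x this] E show "(\<Sum>a\<in>UNIV. \<Sum>b\<in>UNIV. ?H x $ a $ b * w $ a * w $ b) > 0"
      by (simp add: H mult.assoc flip: sum_distrib_left)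
  qed
  with christoffel_quadratic[of ?H x d v] dH
  have "(\<Sum>e\<in>UNIV. ?H x $ d $ e * snd (geodesic_spray B (conformal_metric f) c (x, v)) $ e) =
    - (\<Sum>b\<in>UNIV. frechet_derivative (\<lambda>y. ?H y $ d $ b) (at x) v * v $ b)
    + (\<Sum>a\<in>UNIV. \<Sum>b\<in>UNIV. frechet_derivative (\<lambda>y. ?H y $ a $ b) (at x) (axis d 1) * v $ a * v $ b) / 2"
    by (auto simp: geodesic_spray_def differentiable_def)
  then have "E * (\<Sum>e\<in>UNIV. Gred c x $ d $ e * snd (geodesic_spray B (conformal_metric f) c (x, v)) $ e) =
      E * (- (\<Sum>b\<in>UNIV. (2 * ?D v * Gred c x $ d $ b + DG c x d b v) * v $ b)
      + (\<Sum>a\<in>UNIV. \<Sum>b\<in>UNIV. (2 * ?D (axis d 1) * Gred c x $ a $ b + DG c x a b (axis d 1)) * v $ a * v $ b) / 2)"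
    unfolding frechet_derivative_eqI[OF dH] H
    by (simp add: sum_distrib_left mult.assoc right_diff_distrib)
  then have "(\<Sum>e\<in>UNIV. Gred c x $ d $ e * snd (geodesic_spray B (conformal_metric f) c (x, v)) $ e) =
      - (\<Sum>b\<in>UNIV. (2 * ?D v * Gred c x $ d $ b + DG c x d b v) * v $ b)
      + (\<Sum>a\<in>UNIV. \<Sum>b\<in>UNIV. (2 * ?D (axis d 1) * Gred c x $ a $ b + DG c x a b (axis d 1)) * v $ a * v $ b) / 2"
    using E by simp
  also have "(\<Sum>b\<in>UNIV. (2 * ?D v * Gred c x $ d $ b + DG c x d b v) * v $ b) =
      2 * ?D v * (\<Sum>b\<in>UNIV. Gred c x $ d $ b * v $ b) + (\<Sum>b\<in>UNIV. DG c x d b v * v $ b)"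
    by (simp add: distrib_right sum.distrib sum_distrib_left mult.assoc)
  also have "(\<Sum>a\<in>UNIV. \<Sum>b\<in>UNIV. (2 * ?D (axis d 1) * Gred c x $ a $ b + DG c x a b (axis d 1)) * v $ a * v $ b) =
      2 * ?D (axis d 1) * (\<Sum>a\<in>UNIV. \<Sum>b\<in>UNIV. Gred c x $ a $ b * v $ a * v $ b)
      + (\<Sum>a\<in>UNIV. \<Sum>b\<in>UNIV. DG c x a b (axis d 1) * v $ a * v $ b)"
    by (simp add: distrib_right sum.distrib sum_distrib_left mult.assoc)
  also have "- (2 * ?D v * (\<Sum>b\<in>UNIV. Gred c x $ d $ b * v $ b) + (\<Sum>b\<in>UNIV. DG c x d b v * v $ b)) +
      (2 * ?D (axis d 1) * (\<Sum>a\<in>UNIV. \<Sum>b\<in>UNIV. Gred c x $ a $ b * v $ a * v $ b)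
      + (\<Sum>a\<in>UNIV. \<Sum>b\<in>UNIV. DG c x a b (axis d 1) * v $ a * v $ b)) / 2 =
      (\<Sum>e\<in>UNIV. Gred c x $ d $ e * snd (Z c (x, v)) $ e) - ?D v * (\<Sum>b\<in>UNIV. Gred c x $ d $ b * v $ b)"
    unfolding reduced_equation[OF Z c x] curv by (simp add: field_simps)
  finally show "(\<Sum>e\<in>UNIV. Gred c x $ d $ e * snd (geodesic_spray B (conformal_metric f) c (x, v)) $ e) =
      (\<Sum>e\<in>UNIV. Gred c x $ d $ e * (snd (Z c (x, v)) - ?D v *\<^sub>R v) $ e)"
    by (simp add: right_diff_distrib sum_subtractf sum_distrib_left mult_ac)
qed

end

section \<open>The gyroscopic two-forms and the Hamiltonian reparametrization\<close>

locale chaplygin_extension = chaplygin C \<xi> X R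
  for C :: "('q::{t2_space,second_countable_topology}, 'n::finite,
      'g::{t2_space,second_countable_topology}, 'k::finite,
      'b::{t2_space,second_countable_topology}, 'm::finite) chaplygin_data"
    and \<xi> :: "'k \<Rightarrow> 'g tvec"
    and X :: "('q, 'b, 'm) lifts"
    and R :: "('q, 'b, 'm, 'k) coeffs" +
  fixes gbar :: "'q \<Rightarrow> 'q tvec \<Rightarrow> 'q tvec \<Rightarrow> real"
    and f :: "'b \<Rightarrow> real"
    and Z :: "('b, 'm) tfield"
  assumes Z: "reduced_vector_field C \<xi> X R Z"
    and f: "smooth_fun B UNIV f"
    and gbar_invariant: "G_invariant_tensor C gbar"
    and gbar: "sym_tensor_field Q gbar"
    and gbar_constr: "\<And>q u v. u \<in> constr C q \<Longrightarrow> v \<in> constr C q \<Longrightarrow> gbar q u v = g q u v"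
    and cond_A: "condition_A C \<xi> X R gbar (f \<circ> \<pi>)"
begin

abbreviation "df c x \<equiv> frechet_derivative (f \<circ> chart_inv c) (at x)"

section \<open>Contractions of the two-forms with the reduced field\<close>

lemma fst_Z: "c \<in> B \<Longrightarrow> x \<in> snd c ` fst c \<Longrightarrow> fst (Z c (x, v)) = v"
  using Z unfolding reduced_vector_field_def second_order_field_def tchart_dom_def by force

lemma T_red_antisym: "c \<in> B \<Longrightarrow> x \<in> snd c ` fst c \<Longrightarrow> T_red c x a b e = - T_red c x a e b"
  unfolding descend_def by (rule curv_G_mix_antisym[OF _ base_point_tube])

lemma S_red_antisym: "c \<in> B \<Longrightarrow> x \<in> snd c ` fst c \<Longrightarrow> S_red gbar c x a b e = - S_red gbar c x a e b"
  unfolding descend_def by (rule curv_gbar_mix_antisym[OF _ base_point_tube gbar gbar_constr])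

lemma contract_gamma:
  assumes "c \<in> B" "x \<in> snd c ` fst c"
  shows "contract (Z c) (gamma_form C \<xi> X R gbar c) (x, v) w =
    (\<Sum>a\<in>UNIV. \<Sum>b\<in>UNIV. \<Sum>e\<in>UNIV. S_red gbar c x a b e * v $ a * v $ b * fst w $ e)"
  using gamma_contract[of "S_red gbar c x" "\<lambda>a. v $ a" "\<lambda>a. fst w $ a", OF S_red_antisym[OF assms]]
  by (simp add: contract_def gamma_form_def dq_wedge_def fst_Z[OF assms])

lemma contract_Xi:
  assumes "c \<in> B" "x \<in> snd c ` fst c"
  shows "contract (Z c) (Xi_form C \<xi> X R c) (x, v) w = alpha_form C \<xi> X R c (x, v) w"
  using antisym_contract[of "T_red c x" "\<lambda>a. v $ a" "\<lambda>a. v $ a" "\<lambda>a. fst w $ a", OF T_red_antisym[OF assms]]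
  by (simp add: contract_def Xi_form_def alpha_form_def dq_wedge_def fst_Z[OF assms])

text \<open>Both sides of the condition are linear in the base part of the test vector, so
  coordinate directions suffice. In this component form the condition can be combined with
  (A').\<close>

lemma gamma_condition_iff:
  "gamma_condition C \<xi> X R gbar Z \<longleftrightarrow> (\<forall>c\<in>B. \<forall>x\<in>snd c ` fst c. \<forall>v d.
     (\<Sum>a\<in>UNIV. \<Sum>b\<in>UNIV. S_red gbar c x a b d * v $ a * v $ b) =
     - (\<Sum>a\<in>UNIV. \<Sum>b\<in>UNIV. T_red c x a b d * v $ a * v $ b))" (is "?L \<longleftrightarrow> ?R")
proof
  assume L: ?L
  show ?R
  proof (intro ballI allI)
    fix c x d and v :: "real^'m" assume c: "c \<in> B" and x: "x \<in> snd c ` fst c"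
    have "contract (Z c) (gamma_form C \<xi> X R gbar c) (x, v) (axis d 1, 0) =
        alpha_form C \<xi> X R c (x, v) (axis d 1, 0)"
      using L c x unfolding gamma_condition_def tchart_dom_def by blast
    then show "(\<Sum>a\<in>UNIV. \<Sum>b\<in>UNIV. S_red gbar c x a b d * v $ a * v $ b) =
        - (\<Sum>a\<in>UNIV. \<Sum>b\<in>UNIV. T_red c x a b d * v $ a * v $ b)"
      unfolding contract_gamma[OF c x] by (simp add: alpha_form_def sum_axis)
  qed
next
  assume R: ?R
  have regroup: "(\<Sum>a\<in>UNIV. \<Sum>b\<in>UNIV. \<Sum>e\<in>UNIV. U a b e * v $ a * v $ b * w $ e) =
      (\<Sum>e\<in>UNIV. (\<Sum>a\<in>UNIV. \<Sum>b\<in>UNIV. U a b e * v $ a * v $ b) * w $ e)"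
    for U :: "'m \<Rightarrow> 'm \<Rightarrow> 'm \<Rightarrow> real" and v w :: "real^'m"
  proof -
    have "(\<Sum>a\<in>UNIV. \<Sum>b\<in>UNIV. \<Sum>e\<in>UNIV. U a b e * v $ a * v $ b * w $ e) =
        (\<Sum>a\<in>UNIV. \<Sum>e\<in>UNIV. \<Sum>b\<in>UNIV. U a b e * v $ a * v $ b * w $ e)"
      by (intro sum.cong refl sum.swap)
    also have "\<dots> = (\<Sum>e\<in>UNIV. \<Sum>a\<in>UNIV. \<Sum>b\<in>UNIV. U a b e * v $ a * v $ b * w $ e)"
      by (rule sum.swap)
    finally show ?thesis by (simp add: sum_distrib_right)
  qed
  show ?L
    unfolding gamma_condition_def tchart_dom_def
  proof (intro ballI allI)
    fix c z w assume c: "c \<in> B" and z: "z \<in> (snd c ` fst c) \<times> (UNIV :: (real^'m) set)"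
    obtain x v where zx: "z = (x, v)" and x: "x \<in> snd c ` fst c" using z by auto
    have "(\<Sum>a\<in>UNIV. \<Sum>b\<in>UNIV. S_red gbar c x a b d * v $ a * v $ b) =
        - (\<Sum>a\<in>UNIV. \<Sum>b\<in>UNIV. T_red c x a b d * v $ a * v $ b)" for d
      using R c x by blast
    then show "contract (Z c) (gamma_form C \<xi> X R gbar c) z w = alpha_form C \<xi> X R c z w"
      unfolding zx contract_gamma[OF c x] alpha_form_def fst_conv snd_conv regroup
      by (simp add: sum_negf)
  qed
qed

text \<open>The part of being a gauge transformation that holds for every extension considered here;
  smoothness of the coefficients of \<gamma> is where the invariance of \<open>gbar\<close>
  enters.\<close>

lemma semibasic_gamma_Xi:
  assumes c: "c \<in> B"
  shows "semibasic_2form c (\<lambda>z w w'. gamma_form C \<xi> X R gbar c z w w' - Xi_form C \<xi> X R c z w w')"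
  unfolding semibasic_2form_def
proof (intro conjI allI ballI impI)
  have op: "open (tchart_dom c)"
    unfolding tchart_dom_def using chart_open(2)[OF atlas(2) c] by (intro open_Times) auto
  have lift: "smooth_on (tchart_dom c) (\<lambda>z. \<phi> (fst z))" if "smooth_on (snd c ` fst c) \<phi>"
    for \<phi> :: "real^'m \<Rightarrow> real"
    by (rule smooth_on_compose[OF op smooth_on_bounded_linear[OF bounded_linear_fst] that])
      (auto simp: tchart_dom_def)
  have comp: "smooth_on (tchart_dom c) (\<lambda>z. snd z $ a)" for a
    using bounded_linear_compose[OF bounded_linear_vec_nth bounded_linear_snd]
    by (rule smooth_on_bounded_linear)
  note T = lift[OF descend_curv_smooth[OF c]]
  note S = lift[OF descend_curv_gbar_smooth[OF c gbar gbar_invariant gbar_constr]]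
  show "smooth_on (tchart_dom c) (\<lambda>z. gamma_form C \<xi> X R gbar c z w w' - Xi_form C \<xi> X R c z w w')" for w w'
    unfolding gamma_form_def Xi_form_def Let_def divide_inverse
    by (intro smooth_on_diff smooth_on_minus smooth_on_mult smooth_on_add smooth_on_sum op S T comp smooth_on_const)
  show "linear (\<lambda>w'. gamma_form C \<xi> X R gbar c z w w' - Xi_form C \<xi> X R c z w w')" for z w
    by (intro linearI)
      (simp_all add: gamma_form_def Xi_form_def Let_def dq_wedge_def algebra_simps sum.distrib
        sum_subtractf sum_distrib_left add_divide_distrib diff_divide_distrib sum_divide_distrib)
  show "gamma_form C \<xi> X R gbar c z w w' - Xi_form C \<xi> X R c z w w' =
      - (gamma_form C \<xi> X R gbar c z w' w - Xi_form C \<xi> X R c z w' w)" for z w w'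
  proof -
    have "dq_wedge b e w w' = - dq_wedge b e w' w" for b e by (simp add: dq_wedge_def)
    then show ?thesis by (simp add: gamma_form_def Xi_form_def Let_def sum_negf)
  qed
  show "gamma_form C \<xi> X R gbar c z w w' - Xi_form C \<xi> X R c z w w' = 0" if "fst w = 0" for z w w'
    using that by (simp add: gamma_form_def Xi_form_def Let_def dq_wedge_def)
qed

text \<open>The form \<Xi> always contracts to \<alpha>, so the difference contracts to 0 exactly
  when \<gamma> contracts to \<alpha>.\<close>

lemma gamma_condition_iff_gauge:
  "gamma_condition C \<xi> X R gbar Z \<longleftrightarrow> dynamical_gauge B Z
    (\<lambda>c z w w'. gamma_form C \<xi> X R gbar c z w w' - Xi_form C \<xi> X R c z w w')"
proof -
  have "contract (Z c) (\<lambda>z w w'. gamma_form C \<xi> X R gbar c z w w' - Xi_form C \<xi> X R c z w w') z w =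
      contract (Z c) (gamma_form C \<xi> X R gbar c) z w - alpha_form C \<xi> X R c z w"
    if "c \<in> B" "z \<in> tchart_dom c" for c z w
  proof -
    obtain x v where z: "z = (x, v)" by (cases z)
    have "x \<in> snd c ` fst c" using that(2) by (simp add: z tchart_dom_def)
    from contract_Xi[OF that(1) this, of v w] show ?thesis by (simp add: z contract_def)
  qed
  then show ?thesis
    unfolding gamma_condition_def dynamical_gauge_def using semibasic_gamma_Xi by simp
qed

text \<open>This is (A') at the chosen point of the fibre. Lifts act on f composed with the
  projection as coordinate derivatives of f, and the Kronecker deltas collapse the first sum to g(v,
  v) df - df(v) g(v, .).\<close>

lemma condition_A_reduced:
  assumes c: "c \<in> B" and x: "x \<in> snd c ` fst c"
  shows "(\<Sum>a\<in>UNIV. \<Sum>b\<in>UNIV. Gred c x $ a $ b * v $ a * v $ b) * df c x (axis d 1)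
    - (\<Sum>b\<in>UNIV. Gred c x $ d $ b * v $ b) * df c x v
    + (\<Sum>a\<in>UNIV. \<Sum>b\<in>UNIV. S_red gbar c x a b d * v $ a * v $ b) = 0"
proof -
  define q where "q = base_point (chart_inv c x)"
  have q: "q \<in> tube C c" and \<pi>q: "\<pi> q = chart_inv c x"
    using base_point_tube[OF x] by (auto simp: q_def)
  have sm: "smooth_at B (\<pi> q) f" using f unfolding smooth_at_def by blast
  have XF: "app (X c a q) (f \<circ> \<pi>) = df c x (axis a 1)" for a
    using app_push[where f = \<pi> and q = q, OF sm, where A = Q and v = "X c a q"] push_X[OF c q]
      app_coord_vec[OF atlas(2) sm] chart_inv_right(1)[OF atlas(2) x] \<pi>q by simp
  interpret lin: linear "df c x"
    using f c x smooth_on_imp_differentiable[of "snd c ` fst c"]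
    unfolding smooth_fun_def by (intro linear_frechet_derivative) force
  have dfv: "df c x v = (\<Sum>a\<in>UNIV. df c x (axis a 1) * v $ a)"
  proof -
    have "v = (\<Sum>i\<in>UNIV. v $ i *\<^sub>R axis i 1)" by (simp add: linear_combination_axis)
    then have "df c x v = (\<Sum>i\<in>UNIV. df c x (v $ i *\<^sub>R axis i 1))"
      by (metis (no_types, lifting) lin.sum sum.cong)
    then show ?thesis by (simp add: lin.scale mult.commute)
  qed
  let ?G = "G_hor C X c q"
  have "(\<Sum>a\<in>UNIV. \<Sum>b\<in>UNIV. \<Sum>e\<in>UNIV. ?G $ b $ e *
      ((if a = e then df c x (axis d 1) else 0) - (if d = e then df c x (axis a 1) else 0)) * v $ a * v $ b)
    + (\<Sum>k\<in>UNIV. \<Sum>a\<in>UNIV. (\<Sum>b\<in>UNIV. gbar_mix C \<xi> X gbar c b k q * v $ b) *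
        R c (Inr k) (Inl a) (Inl d) q * v $ a) = 0"
    using cond_A c q unfolding condition_A_def XF[symmetric] by blast
  also have "(\<Sum>k\<in>UNIV. \<Sum>a\<in>UNIV. (\<Sum>b\<in>UNIV. gbar_mix C \<xi> X gbar c b k q * v $ b) *
        R c (Inr k) (Inl a) (Inl d) q * v $ a) =
      (\<Sum>a\<in>UNIV. \<Sum>b\<in>UNIV. S_red gbar c x a b d * v $ a * v $ b)"
  proof -
    have "(\<Sum>k\<in>UNIV. \<Sum>a\<in>UNIV. (\<Sum>b\<in>UNIV. gbar_mix C \<xi> X gbar c b k q * v $ b) *
        R c (Inr k) (Inl a) (Inl d) q * v $ a) =
      (\<Sum>a\<in>UNIV. \<Sum>k\<in>UNIV. \<Sum>b\<in>UNIV. gbar_mix C \<xi> X gbar c b k q * v $ b *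
        R c (Inr k) (Inl a) (Inl d) q * v $ a)"
      unfolding sum_distrib_right by (rule sum.swap)
    also have "\<dots> = (\<Sum>a\<in>UNIV. \<Sum>b\<in>UNIV. \<Sum>k\<in>UNIV. gbar_mix C \<xi> X gbar c b k q * v $ b *
        R c (Inr k) (Inl a) (Inl d) q * v $ a)"
      by (intro sum.cong refl sum.swap)
    also have "\<dots> = (\<Sum>b\<in>UNIV. \<Sum>a\<in>UNIV. \<Sum>k\<in>UNIV. gbar_mix C \<xi> X gbar c b k q * v $ b *
        R c (Inr k) (Inl a) (Inl d) q * v $ a)"
      by (rule sum.swap)
    also have "\<dots> = (\<Sum>b\<in>UNIV. \<Sum>a\<in>UNIV. S_red gbar c x b a d * v $ b * v $ a)"
      by (simp add: descend_def curv_def q_def sum_distrib_left sum_distrib_right mult_ac)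
    finally show ?thesis .
  qed
  also have "(\<Sum>a\<in>UNIV. \<Sum>b\<in>UNIV. \<Sum>e\<in>UNIV. ?G $ b $ e *
      ((if a = e then df c x (axis d 1) else 0) - (if d = e then df c x (axis a 1) else 0)) * v $ a * v $ b) =
      (\<Sum>a\<in>UNIV. \<Sum>b\<in>UNIV. ?G $ b $ a * df c x (axis d 1) * v $ a * v $ b
        - ?G $ b $ d * df c x (axis a 1) * v $ a * v $ b)"
  proof (intro sum.cong refl)
    fix a b
    have "(\<Sum>e\<in>UNIV. ?G $ b $ e *
        ((if a = e then df c x (axis d 1) else 0) - (if d = e then df c x (axis a 1) else 0)) * v $ a * v $ b) =
        (\<Sum>e\<in>UNIV. (if a = e then ?G $ b $ e * df c x (axis d 1) * v $ a * v $ b else 0) -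
          (if d = e then ?G $ b $ e * df c x (axis a 1) * v $ a * v $ b else 0))"
      by (intro sum.cong) (auto simp: algebra_simps)
    then show "(\<Sum>e\<in>UNIV. ?G $ b $ e *
        ((if a = e then df c x (axis d 1) else 0) - (if d = e then df c x (axis a 1) else 0)) * v $ a * v $ b) =
        ?G $ b $ a * df c x (axis d 1) * v $ a * v $ b - ?G $ b $ d * df c x (axis a 1) * v $ a * v $ b"
      by (simp add: sum_subtractf)
  qed
  also have "\<dots> = (\<Sum>a\<in>UNIV. \<Sum>b\<in>UNIV. ?G $ a $ b * v $ a * v $ b) * df c x (axis d 1)
      - (\<Sum>b\<in>UNIV. ?G $ d $ b * v $ b) * df c x v"
  proof -
    have 1: "(\<Sum>a\<in>UNIV. \<Sum>b\<in>UNIV. ?G $ b $ a * df c x (axis d 1) * v $ a * v $ b) =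
        (\<Sum>a\<in>UNIV. \<Sum>b\<in>UNIV. ?G $ a $ b * v $ a * v $ b) * df c x (axis d 1)"
      by (simp add: sum_distrib_left sum_distrib_right G_hor_sym[OF c q] mult_ac)
    have 2: "(\<Sum>a\<in>UNIV. \<Sum>b\<in>UNIV. ?G $ b $ d * df c x (axis a 1) * v $ a * v $ b) =
        (\<Sum>b\<in>UNIV. ?G $ d $ b * v $ b) * df c x v"
      unfolding dfv sum_product
      by (subst sum.swap) (simp add: G_hor_sym[OF c q, of _ d] mult_ac)
    show ?thesis unfolding sum_subtractf 1 2 ..
  qed
  finally show ?thesis by (simp add: descend_def q_def)
qed

text \<open>(A') constrains S, whereas the spray computation needs T; the condition on \<gamma>
  exchanges one for the other.\<close>

lemma hamiltonian_reparametrization_of_gamma_condition: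
  assumes "gamma_condition C \<xi> X R gbar Z"
  shows "hamiltonian_reparametrization B Z"
proof -
  let ?S = "geodesic_spray B (conformal_metric f)"
  have spray: "snd (?S c (x, v)) = snd (Z c (x, v)) - df c x v *\<^sub>R v"
    if c: "c \<in> B" and x: "x \<in> snd c ` fst c" for c x v
  proof (rule spray_conformal_metric[OF f Z c x])
    fix d
    have "(\<Sum>a\<in>UNIV. \<Sum>b\<in>UNIV. S_red gbar c x a b d * v $ a * v $ b) =
        - (\<Sum>a\<in>UNIV. \<Sum>b\<in>UNIV. T_red c x a b d * v $ a * v $ b)"
      using assms c x unfolding gamma_condition_iff by blast
    with condition_A_reduced[OF c x, of v d]
    show "(\<Sum>a\<in>UNIV. \<Sum>b\<in>UNIV. T_red c x a b d * v $ a * v $ b) =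
      (\<Sum>a\<in>UNIV. \<Sum>b\<in>UNIV. Gred c x $ a $ b * v $ a * v $ b) * df c x (axis d 1)
      - (\<Sum>b\<in>UNIV. Gred c x $ d $ b * v $ b) * df c x v" by linarith
  qed
  have diff: "(f \<circ> chart_inv c) differentiable (at x)" if "c \<in> B" "x \<in> snd c ` fst c" for c x
    using f that smooth_on_imp_differentiable[of "snd c ` fst c"] unfolding smooth_fun_def by force
  have S_quad: "snd (?S c (x, r *\<^sub>R v)) = r\<^sup>2 *\<^sub>R snd (?S c (x, v))" for c x r v
    by (simp add: geodesic_spray_def vec_eq_iff sum_distrib_left power2_eq_square mult_ac)
  \<comment> \<open>Homogeneity is inherited from the spray: the two fields differ by df(v) v, which
    is itself quadratic in v.\<close>
  have Z_quad: "snd (Z c (x, r *\<^sub>R v)) = r\<^sup>2 *\<^sub>R snd (Z c (x, v))"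
    if "c \<in> B" "x \<in> snd c ` fst c" for c x r v
  proof -
    have "df c x (r *\<^sub>R v) = r * df c x v"
      using linear_scale[OF linear_frechet_derivative[OF diff[OF that]]] by simp
    moreover have "snd (Z c (x, v)) = snd (?S c (x, v)) + df c x v *\<^sub>R v" for v
      using spray[OF that] by simp
    ultimately show ?thesis
      by (simp only: S_quad scaleR_add_right scaleR_scaleR power2_eq_square mult_ac)
  qed
  have fst_S: "fst (?S c (x, v)) = v" for c x v by (simp add: geodesic_spray_def)
  \<comment> \<open>The inverse time change is governed by - f; it carries geodesics back to reduced
    trajectories.\<close>
  have mf: "smooth_fun B UNIV (\<lambda>p. - f p)"
    using f smooth_at_diff[OF atlas(2) smooth_at_const[OF atlas(2)], of _ f 0]
    by (simp add: smooth_fun_iff[OF atlas(2)])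
  have reverse: "snd (Z c (x, v)) = snd (?S c (x, v)) -
      frechet_derivative ((\<lambda>p. - f p) \<circ> chart_inv c) (at x) v *\<^sub>R v"
    if "c \<in> B" "x \<in> snd c ` fst c" for c x v
  proof -
    have "(((\<lambda>p. - f p) \<circ> chart_inv c) has_derivative (\<lambda>v. - df c x v)) (at x)"
      using has_derivative_minus[OF diff[OF that, unfolded frechet_derivative_works]]
      by (simp add: comp_def)
    from frechet_derivative_eqI[OF this] show ?thesis using spray[OF that] by simp
  qed
  have "complete_set_of_pregeodesics B Z (conformal_metric f)"
    unfolding complete_set_of_pregeodesics_def
    using pregeodesic_reparam[OF atlas(2) f Z_quad fst_S fst_Z spray]
      pregeodesic_reparam[OF atlas(2) mf S_quad fst_Z fst_S reverse] by blast
  then show ?thesis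
    using conformal_metric_riemannian[OF f] unfolding hamiltonian_reparametrization_def by blast
qed

lemma gamma_condition_of_orthogonal:
  assumes "VD_orthogonal C gbar"
  shows "gamma_condition C \<xi> X R gbar Z"
  unfolding gamma_condition_iff
proof (intro ballI allI)
  fix c x d and v :: "real^'m" assume c: "c \<in> B" and x: "x \<in> snd c ` fst c"
  have "S_red gbar c x a b d = - T_red c x a b d" for a b
    unfolding descend_def
    by (rule curv_gbar_mix_orthogonal[OF c base_point_tube[OF x] gbar gbar_constr assms])
  then show "(\<Sum>a\<in>UNIV. \<Sum>b\<in>UNIV. S_red gbar c x a b d * v $ a * v $ b) =
      - (\<Sum>a\<in>UNIV. \<Sum>b\<in>UNIV. T_red c x a b d * v $ a * v $ b)"
    by (simp add: sum_negf)
qed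

end

theorem proposition12:
  fixes C :: "('q::{t2_space,second_countable_topology}, 'n::finite,
      'g::{t2_space,second_countable_topology}, 'k::finite,
      'b::{t2_space,second_countable_topology}, 'm::finite) chaplygin_data"
    and \<xi> :: "'k \<Rightarrow> 'g tvec"
    and X :: "('q, 'b, 'm) lifts"
    and R :: "('q, 'b, 'm, 'k) coeffs"
    and nabla :: "('q \<Rightarrow> 'q tvec) \<Rightarrow> ('q \<Rightarrow> 'q tvec) \<Rightarrow> 'q \<Rightarrow> 'q tvec"
    and \<Gamma> :: "('b, real^'m) chart \<Rightarrow> 'm + 'k \<Rightarrow> 'm \<Rightarrow> 'm \<Rightarrow> 'q \<Rightarrow> real"
    and gbar :: "'q \<Rightarrow> 'q tvec \<Rightarrow> 'q tvec \<Rightarrow> real"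
    and f :: "'b \<Rightarrow> real"
    and \<Gamma>red :: "('b, 'm) tfield"
  assumes "chaplygin_system C"
    and "lie_algebra_basis C \<xi>"
    and "horizontal_lifts C X"
    and "structure_functions C \<xi> X R"
    and "levi_civita (Q_atlas C) (Q_metric C) nabla"
    and "connection_coeffs C \<xi> X nabla \<Gamma>"
    and "reduced_vector_field C \<xi> X R \<Gamma>red"
    and "smooth_fun (B_atlas C) UNIV f"
    and "G_invariant_tensor C gbar"
    and "projective_geodesic_extension C \<xi> X R \<Gamma> gbar (f \<circ> proj C)"
  shows "(gamma_condition C \<xi> X R gbar \<Gamma>red \<longleftrightarrow>
            dynamical_gauge (B_atlas C) \<Gamma>red
              (\<lambda>c z w w'. gamma_form C \<xi> X R gbar c z w w' - Xi_form C \<xi> X R c z w w')) \<and>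
         (gamma_condition C \<xi> X R gbar \<Gamma>red \<longrightarrow>
            hamiltonian_reparametrization (B_atlas C) \<Gamma>red) \<and>
         (VD_orthogonal C gbar \<longrightarrow> hamiltonian_reparametrization (B_atlas C) \<Gamma>red)"
proof -
  interpret chaplygin_extension C \<xi> X R gbar f \<Gamma>red
    using assms unfolding projective_geodesic_extension_def by unfold_locales auto
  show ?thesis
    using gamma_condition_iff_gauge hamiltonian_reparametrization_of_gamma_condition
      gamma_condition_of_orthogonal by blast
qed

end
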